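(* Let $\Omega\subset\mathbb{R}^N$ be a bounded $C^2$ domain, $p\in(1,2]$ and $f\in \mathrm{Lip}_{loc}(\Omega)\cap L^\infty(\Omega)$. Suppose that the Dirichlet problem $$-\lambda_N(D^2w)+|Dw|^p=f(x)\ \text{ in }\Omega,\qquad w=0\ \text{ on }\partial\Omega$$ has no viscosity solutions. For $\gamma>0$ let $u_\gamma\in C(\overline\Omega)$ be the unique viscosity solution of $$-\lambda_N(D^2u)+|Du|^p+\gamma u=f(x)\ \text{ in }\Omega,\qquad u=0\ \text{ on }\partial\Omega.$$ Then: a) $\displaystyle\lim_{\gamma\to0^+}\|u_\gamma^-\|_\infty=+\infty$; b) there exist a sequence $\gamma_n\to0^+$, as $n\to+\infty$, and a nonnegative constant $C$ such that $\gamma_nu_{\gamma_n}\to-C$ locally uniformly in $\Omega$ as $n\to+\infty$; c) for this sequence and this constant $C$, the sequence $v_{\gamma_n}=u_{\gamma_n}+\|u_{\gamma_n}^-\|_\infty$ converges locally uniformly in $\Omega$, as $n\to+\infty$, to a function $v$ satisfying $$-\lambda_N(D^2v)+|Dv|^p=f(x)+C\ \text{ in }\Omega,\qquad v=+\infty\ \text{ on }\partial\Omega,\qquad \min_\Omega v=0.$$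
   Context: For a real symmetric $N\times N$ matrix $X$, $\lambda_N(X)$ denotes its largest eigenvalue. $\mathrm{Lip}_{loc}(\Omega)$ is the set of locally Lipschitz functions on $\Omega$; $u^-=\max\{-u,0\}$; $\|\cdot\|_\infty$ is the sup norm over $\Omega$. For $\gamma\ge0$ and continuous $g$, a continuous $u$ is a viscosity solution of $-\lambda_N(D^2u)+|Du|^p+\gamma u=g$ in $\Omega$ if, whenever $\varphi$ is $C^2$ and $u-\varphi$ has a local maximum (respectively minimum) at $x\in\Omega$, one has $-\lambda_N(D^2\varphi(x))+|D\varphi(x)|^p+\gamma u(x)\le g(x)$ (respectively $\ge g(x)$). Solutions of the Dirichlet problems are viscosity solutions in $\Omega$ belonging to $C(\overline\Omega)$ and vanishing on $\partial\Omega$. All equations are understood in the viscosity sense, and $v=+\infty$ on $\partial\Omega$ means $v(x)\to+\infty$ as $x\in\Omega$, $\mathrm{dist}(x,\partial\Omega)\to0$. Under the stated hypotheses $u_\gamma$ exists and is unique for every $\gamma>0$. *)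

theory Defs
  imports "HOL-Analysis.Analysis"
begin

definition is_eigenvalue :: "real^'n^'n \<Rightarrow> real \<Rightarrow> bool" where
  "is_eigenvalue A l \<longleftrightarrow> (\<exists>v. v \<noteq> 0 \<and> A *v v = l *\<^sub>R v)"

text \<open>Used for symmetric matrices only: these have a finite nonempty set of real eigenvalues.\<close>
definition max_eigenvalue :: "real^'n^'n \<Rightarrow> real" where
  "max_eigenvalue A = Max {l. is_eigenvalue A l}"

definition gradient :: "(real^'n \<Rightarrow> real) \<Rightarrow> real^'n \<Rightarrow> real^'n" where
  "gradient \<phi> x = (\<chi> i. frechet_derivative \<phi> (at x) (axis i 1))"

definition hessian :: "(real^'n \<Rightarrow> real) \<Rightarrow> real^'n \<Rightarrow> real^'n^'n" where
  "hessian \<phi> x = jacobian (gradient \<phi>) (at x)"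

text \<open>Twice continuously differentiable on an open set \<open>U\<close>.\<close>
definition C2_on :: "(real^'n) set \<Rightarrow> (real^'n \<Rightarrow> real) \<Rightarrow> bool" where
  "C2_on U \<phi> \<longleftrightarrow> \<phi> differentiable_on U \<and> gradient \<phi> differentiable_on U
     \<and> continuous_on U (hessian \<phi>)"

text \<open>Near each boundary point, \<open>\<Omega>\<close> is the region on one side of the graph of a \<open>C\<^sup>2\<close> function
  \<open>g\<close> of the coordinates other than \<open>x\<^sub>k\<close>; \<open>g\<close> is taken on the whole space and constant in the
  direction \<open>k\<close>. The sign \<open>s\<close> accounts for the orientation of the \<open>k\<close>-th axis.\<close>
definition C2_boundary :: "(real^'n) set \<Rightarrow> bool" where
  "C2_boundary \<Omega> \<longleftrightarrow> (\<forall>x0\<in>frontier \<Omega>. \<exists>r>0. \<exists>k. \<exists>s\<in>{-1, 1}. \<exists>g.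
     C2_on UNIV g \<and> (\<forall>x t. g (x + t *\<^sub>R axis k 1) = g x)
     \<and> \<Omega> \<inter> ball x0 r = {x \<in> ball x0 r. s * x $ k > g x})"

definition bounded_C2_domain :: "(real^'n) set \<Rightarrow> bool" where
  "bounded_C2_domain \<Omega> \<longleftrightarrow> open \<Omega> \<and> connected \<Omega> \<and> \<Omega> \<noteq> {} \<and> bounded \<Omega> \<and> C2_boundary \<Omega>"

text \<open>The library notion is about families of functions; the index set here is a dummy singleton.\<close>
definition locally_lipschitz_on :: "(real^'n) set \<Rightarrow> (real^'n \<Rightarrow> real) \<Rightarrow> bool" where
  "locally_lipschitz_on \<Omega> f \<longleftrightarrow> local_lipschitz {0::real} \<Omega> (\<lambda>_. f)"

definition neg_part :: "('a \<Rightarrow> real) \<Rightarrow> 'a \<Rightarrow> real" where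
  "neg_part u x = max (- u x) 0"

text \<open>Supremum norm; meaningful for functions that are bounded on a nonempty set \<open>\<Omega>\<close>.\<close>
definition sup_norm_on :: "'a set \<Rightarrow> ('a \<Rightarrow> real) \<Rightarrow> real" where
  "sup_norm_on \<Omega> h = (SUP x\<in>\<Omega>. \<bar>h x\<bar>)"

definition local_max_at :: "('a::topological_space \<Rightarrow> real) \<Rightarrow> 'a \<Rightarrow> bool" where
  "local_max_at h x \<longleftrightarrow> (\<forall>\<^sub>F y in nhds x. h y \<le> h x)"

definition local_min_at :: "('a::topological_space \<Rightarrow> real) \<Rightarrow> 'a \<Rightarrow> bool" where
  "local_min_at h x \<longleftrightarrow> (\<forall>\<^sub>F y in nhds x. h x \<le> h y)"

text \<open>Viscosity solutions of \<open>-\<lambda>\<^sub>N(D\<^sup>2u) + |Du|\<^sup>p + \<gamma>u = g\<close> in the open set \<open>\<Omega>\<close>.\<close>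

definition viscosity_subsolution ::
  "(real^'n) set \<Rightarrow> real \<Rightarrow> real \<Rightarrow> (real^'n \<Rightarrow> real) \<Rightarrow> (real^'n \<Rightarrow> real) \<Rightarrow> bool" where
  "viscosity_subsolution \<Omega> p \<gamma> g u \<longleftrightarrow>
     (\<forall>\<phi>. \<forall>x\<in>\<Omega>. C2_on \<Omega> \<phi> \<longrightarrow> local_max_at (\<lambda>y. u y - \<phi> y) x \<longrightarrow>
        - max_eigenvalue (hessian \<phi> x) + norm (gradient \<phi> x) powr p + \<gamma> * u x \<le> g x)"

definition viscosity_supersolution ::
  "(real^'n) set \<Rightarrow> real \<Rightarrow> real \<Rightarrow> (real^'n \<Rightarrow> real) \<Rightarrow> (real^'n \<Rightarrow> real) \<Rightarrow> bool" where
  "viscosity_supersolution \<Omega> p \<gamma> g u \<longleftrightarrow>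
     (\<forall>\<phi>. \<forall>x\<in>\<Omega>. C2_on \<Omega> \<phi> \<longrightarrow> local_min_at (\<lambda>y. u y - \<phi> y) x \<longrightarrow>
        - max_eigenvalue (hessian \<phi> x) + norm (gradient \<phi> x) powr p + \<gamma> * u x \<ge> g x)"

definition viscosity_solution ::
  "(real^'n) set \<Rightarrow> real \<Rightarrow> real \<Rightarrow> (real^'n \<Rightarrow> real) \<Rightarrow> (real^'n \<Rightarrow> real) \<Rightarrow> bool" where
  "viscosity_solution \<Omega> p \<gamma> g u \<longleftrightarrow> continuous_on \<Omega> u
     \<and> viscosity_subsolution \<Omega> p \<gamma> g u \<and> viscosity_supersolution \<Omega> p \<gamma> g u"

definition dirichlet_solution ::
  "(real^'n) set \<Rightarrow> real \<Rightarrow> real \<Rightarrow> (real^'n \<Rightarrow> real) \<Rightarrow> (real^'n \<Rightarrow> real) \<Rightarrow> bool" where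
  "dirichlet_solution \<Omega> p \<gamma> g u \<longleftrightarrow> continuous_on (closure \<Omega>) u
     \<and> viscosity_solution \<Omega> p \<gamma> g u \<and> (\<forall>x\<in>frontier \<Omega>. u x = 0)"

definition locally_uniform_limit ::
  "'a::topological_space set \<Rightarrow> (nat \<Rightarrow> 'a \<Rightarrow> real) \<Rightarrow> ('a \<Rightarrow> real) \<Rightarrow> bool" where
  "locally_uniform_limit \<Omega> F l \<longleftrightarrow>
     (\<forall>K. compact K \<and> K \<subseteq> \<Omega> \<longrightarrow> uniform_limit K F l sequentially)"

definition infinite_on_boundary :: "(real^'n) set \<Rightarrow> (real^'n \<Rightarrow> real) \<Rightarrow> bool" where
  "infinite_on_boundary \<Omega> v \<longleftrightarrow>
     (\<forall>M. \<exists>\<delta>>0. \<forall>x\<in>\<Omega>. infdist x (frontier \<Omega>) < \<delta> \<longrightarrow> M < v x)"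

definition has_min_on :: "'a set \<Rightarrow> ('a \<Rightarrow> real) \<Rightarrow> real \<Rightarrow> bool" where
  "has_min_on \<Omega> v m \<longleftrightarrow> (\<exists>x\<in>\<Omega>. v x = m) \<and> (\<forall>x\<in>\<Omega>. m \<le> v x)"

end

theory Submission
  imports Defs "HOL-Complex_Analysis.Great_Picard"
begin

text \<open>Everything rests on comparison with explicit radial functions. At a point \<open>x \<noteq> c\<close> the Hessian of \<open>\<psi> (norm (x - c))\<close> has
eigenvalues \<open>\<psi>''\<close> (radial direction) and \<open>\<psi>' / t\<close> (the others), where \<open>t = norm (x - c)\<close>. Because
\<open>\<lambda>\<^sub>N\<close> is the \<^emph>\<open>largest\<close> eigenvalue, a supersolution that is touched from below by such a function obeys
the one-dimensional inequality \<open>\<psi>'' \<le> \<bar>\<psi>'\<bar> powr p + K\<close>. The maximum principle gives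
\<open>\<bar>\<gamma> u\<^sub>\<gamma>\<bar> \<le> \<parallel>f\<parallel>\<^sub>\<infinity>\<close>, so the zero-order term and \<open>f\<close> can be absorbed into one constant \<open>K\<close>, and all estimates
below are uniform in \<open>\<gamma>\<close> and invariant under adding constants to \<open>u\<^sub>\<gamma>\<close>.

As \<open>p \<le> 2\<close>, minus the logarithm of a concave parabola violates the one-dimensional inequality and can be made to drop by
any prescribed amount over a short interval. Placed in a ball, this barrier may have a corner at
the centre, and comparison yields a Lipschitz bound in terms of the oscillation
(\<open>super_jets_lipschitz\<close>) and an upper bound near any zero of a nonnegative supersolution
(\<open>super_jets_peak_bound\<close>). Placed around an exterior ball at a boundary point, it bounds supersolutions from below
(\<open>boundary_lower_bound\<close>). In the other direction, as \<open>p > 1\<close>, a steep linear function of the distance to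
an exterior ball bounds subsolutions from above (\<open>sub_jets_boundary_barrier\<close>), and a profile that
blows up on a sphere extends an upper bound from a small ball to a larger concentric one
(\<open>sub_jets_interior_barrier\<close>).

If \<open>\<parallel>u\<^sub>\<gamma>\<^sup>-\<parallel>\<^sub>\<infinity>\<close> stayed bounded along some sequence \<open>\<gamma> \<rightarrow> 0\<close>, the Lipschitz bound would give a locally
uniform limit, the boundary barriers would force it to vanish continuously on the boundary, and stability of
viscosity solutions would make it a solution of the Dirichlet problem with \<open>\<gamma> = 0\<close>
(\<open>dirichlet_problem_limit\<close>). This contradiction is part a).

For parts b) and c) put \<open>m = \<parallel>u\<^sub>\<gamma>\<^sup>-\<parallel>\<^sub>\<infinity>\<close> and \<open>v\<^sub>\<gamma> = u\<^sub>\<gamma> + m \<ge> 0\<close>, which equals \<open>m \<rightarrow> \<infinity>\<close> on the boundary.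
The boundary barrier makes \<open>v\<^sub>\<gamma>\<close> large near the boundary, uniformly in small \<open>\<gamma>\<close>
(\<open>boundary_blowup\<close>), so the zeros of \<open>v\<^sub>\<gamma>\<close> accumulate only inside \<open>\<Omega>\<close>. Near such an accumulation point \<open>v\<^sub>\<gamma>\<close> is bounded
by the peak bound, and by the interior barrier and connectedness it is bounded near every point of
\<open>\<Omega>\<close> (\<open>bounded_near_all_points\<close>). Local Lipschitz bounds, compactness and stability give the limit
\<open>v\<close>; the constant is \<open>C = lim \<gamma> m\<close>, a limit of numbers in \<open>[0, \<parallel>f\<parallel>\<^sub>\<infinity>]\<close>.\<close>

section \<open>Second-order expansions\<close>

lemma mvt_linear_error:
  fixes g g' :: "real \<Rightarrow> real"
  assumes "0 < s"
    and "\<And>t. 0 \<le> t \<Longrightarrow> t \<le> s \<Longrightarrow> (g has_real_derivative g' t) (at t)"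
    and "\<And>t. 0 \<le> t \<Longrightarrow> t \<le> s \<Longrightarrow> \<bar>g' t - c\<bar> \<le> B"
  shows "\<bar>g s - g 0 - c * s\<bar> \<le> B * s"
proof -
  obtain t where t: "0 < t" "t < s" "g s - g 0 = (s - 0) * g' t"
    using MVT2[of 0 s g g'] assms by auto
  have "\<bar>g s - g 0 - c * s\<bar> = s * \<bar>g' t - c\<bar>"
  proof -
    have "g s - g 0 - c * s = s * (g' t - c)" using t(3) by (simp add: algebra_simps)
    then show ?thesis using assms(1) by (simp add: abs_mult)
  qed
  then show ?thesis
    using assms(3)[of t] t assms(1) by (simp add: mult.commute mult_left_mono)
qed

lemma has_derivative_along_line:
  fixes f :: "'a::real_inner \<Rightarrow> real"
  assumes "(f has_derivative (\<lambda>h. G \<bullet> h)) (at (z + t *\<^sub>R v))"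
  shows "((\<lambda>t. f (z + t *\<^sub>R v)) has_real_derivative G \<bullet> v) (at t)"
proof -
  have "((\<lambda>t. z + t *\<^sub>R v) has_derivative (\<lambda>h. h *\<^sub>R v)) (at t)"
    by (auto intro!: derivative_eq_intros)
  from diff_chain_at[OF this assms] show ?thesis
    by (simp add: o_def has_field_derivative_def mult_commute_abs)
qed

text \<open>Taylor's formula with Peano remainder, for functions that are twice differentiable at one point only. It serves three
purposes: replacing general test functions by quadratic ones, computing jets of radial functions, and
finding exterior balls.\<close>

lemma second_order_Taylor:
  fixes f :: "'a::real_inner \<Rightarrow> real"
  assumes f: "\<forall>\<^sub>F y in nhds x. (f has_derivative (\<lambda>h. G y \<bullet> h)) (at y)"
    and G: "(G has_derivative H) (at x)" and "0 < \<epsilon>"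
  shows "\<forall>\<^sub>F y in nhds x.
    \<bar>f y - f x - G x \<bullet> (y - x) - 1/2 * (H (y - x) \<bullet> (y - x))\<bar> \<le> \<epsilon> * (norm (y - x))\<^sup>2"
proof -
  obtain d1 where d1: "d1 > 0" "\<And>y. dist y x < d1 \<Longrightarrow> (f has_derivative (\<lambda>h. G y \<bullet> h)) (at y)"
    using f by (auto simp: eventually_nhds_metric)
  obtain d2 where d2: "d2 > 0"
      "\<And>y. norm (y - x) < d2 \<Longrightarrow> norm (G y - G x - H (y - x)) \<le> \<epsilon> * norm (y - x)"
    using G \<open>0 < \<epsilon>\<close> unfolding has_derivative_at_alt by blast
  have lin: "linear H" using G by (simp add: has_derivative_linear)
  have main: "\<bar>f y - f x - G x \<bullet> (y - x) - 1/2 * (H (y - x) \<bullet> (y - x))\<bar> \<le> \<epsilon> * (norm (y - x))\<^sup>2"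
    if y: "dist y x < min d1 d2" for y
  proof -
    define v where "v = y - x"
    define g where "g = (\<lambda>t. f (x + t *\<^sub>R v) - t * (G x \<bullet> v) - t\<^sup>2 / 2 * (H v \<bullet> v))"
    define g' where "g' = (\<lambda>t. G (x + t *\<^sub>R v) \<bullet> v - G x \<bullet> v - t * (H v \<bullet> v))"
    have nv: "norm v < min d1 d2" using y by (simp add: v_def dist_norm)
    have small: "norm (t *\<^sub>R v) < min d1 d2" if "0 \<le> t" "t \<le> 1" for t
    proof -
      have "norm (t *\<^sub>R v) \<le> norm v" using that by (simp add: mult_left_le_one_le)
      with nv show ?thesis by linarith
    qed
    have "\<bar>g 1 - g 0 - 0 * 1\<bar> \<le> (\<epsilon> * (norm v)\<^sup>2) * 1"
    proof (rule mvt_linear_error[where g' = g'])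
      fix t :: real assume t: "0 \<le> t" "t \<le> 1"
      have "((\<lambda>t. f (x + t *\<^sub>R v)) has_real_derivative G (x + t *\<^sub>R v) \<bullet> v) (at t)"
        using d1(2)[of "x + t *\<^sub>R v"] small[OF t] 
        by (intro has_derivative_along_line) (simp add: dist_norm)
      then show "(g has_real_derivative g' t) (at t)"
        unfolding g_def g'_def by (auto intro!: derivative_eq_intros)
      have "g' t = (G (x + t *\<^sub>R v) - G x - H (t *\<^sub>R v)) \<bullet> v"
        by (simp add: g'_def inner_diff_left linear_scale[OF lin])
      also have "\<bar>\<dots>\<bar> \<le> norm (G (x + t *\<^sub>R v) - G x - H (t *\<^sub>R v)) * norm v"
        by (rule Cauchy_Schwarz_ineq2)
      also have "\<dots> \<le> (\<epsilon> * norm (t *\<^sub>R v)) * norm v"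
        using d2(2)[of "x + t *\<^sub>R v"] small[OF t] by (intro mult_right_mono) auto
      also have "\<dots> \<le> (\<epsilon> * norm v) * norm v"
        using t \<open>0 < \<epsilon>\<close> by (intro mult_right_mono mult_left_mono) (auto simp: mult_left_le_one_le)
      finally show "\<bar>g' t - 0\<bar> \<le> \<epsilon> * (norm v)\<^sup>2" by (simp add: power2_eq_square)
    qed simp
    then show ?thesis by (simp add: g_def v_def)
  qed
  show ?thesis unfolding eventually_nhds_metric
    using main d1(1) d2(1) by (intro exI[of _ "min d1 d2"]) auto
qed

text \<open>The second difference of \<open>f\<close> over a small parallelogram with edges \<open>s u\<close> and \<open>s v\<close> is symmetric in \<open>u\<close> and
\<open>v\<close>; by the mean value theorem along one edge it equals \<open>s\<^sup>2 * (H u \<bullet> v)\<close> up to \<open>o(s\<^sup>2)\<close>.\<close>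

lemma second_derivative_symmetric:
  fixes f :: "'a::real_inner \<Rightarrow> real"
  assumes f: "\<forall>\<^sub>F y in nhds x. (f has_derivative (\<lambda>h. G y \<bullet> h)) (at y)"
    and G: "(G has_derivative H) (at x)"
  shows "H u \<bullet> v = H v \<bullet> u"
proof -
  obtain d1 where d1: "d1 > 0" "\<And>y. norm (y - x) < d1 \<Longrightarrow> (f has_derivative (\<lambda>h. G y \<bullet> h)) (at y)"
    using f by (auto simp: eventually_nhds_metric dist_norm)
  have lin: "linear H" using G by (simp add: has_derivative_linear)
  define N where "N = norm u + norm v"
  have key: "\<exists>s0>0. \<forall>s. 0 < s \<and> s < s0 \<longrightarrow> (\<forall>u v. norm u + norm v = N \<longrightarrow>
      \<bar>f (x + s *\<^sub>R u + s *\<^sub>R v) - f (x + s *\<^sub>R v) - f (x + s *\<^sub>R u) + f x - s\<^sup>2 * (H u \<bullet> v)\<bar> \<le> e * s\<^sup>2 * (2 * N\<^sup>2))"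
    if e: "e > 0" for e
  proof -
    obtain d2 where d2: "d2 > 0"
      "\<And>y. norm (y - x) < d2 \<Longrightarrow> norm (G y - G x - H (y - x)) \<le> e * norm (y - x)"
      using G \<open>0 < e\<close> unfolding has_derivative_at_alt by blast
    define s0 where "s0 = min d1 d2 / (N + 1)"
    have N0: "N \<ge> 0" by (simp add: N_def)
    have "s0 > 0" using d1 d2 N0 by (simp add: s0_def)
    moreover have "\<bar>f (x + s *\<^sub>R u + s *\<^sub>R v) - f (x + s *\<^sub>R v) - f (x + s *\<^sub>R u) + f x - s\<^sup>2 * (H u \<bullet> v)\<bar> \<le> e * s\<^sup>2 * (2 * N\<^sup>2)"
      if s: "0 < s" "s < s0" and uv: "norm u + norm v = N" for s u v
    proof -
      have sN: "s * N < min d1 d2"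
      proof -
        have "s * (N + 1) < min d1 d2" using s N0 by (simp add: s0_def field_simps)
        moreover have "s * N \<le> s * (N + 1)" using s by simp
        ultimately show ?thesis by linarith
      qed
      have vN: "norm v \<le> N" using uv norm_ge_zero[of u] by linarith
      have R: "(f has_derivative (\<lambda>h. G (x + z) \<bullet> h)) (at (x + z))"
          "norm (G (x + z) - G x - H z) \<le> e * (s * N)" if z: "norm z \<le> s * N" for z
      proof -
        show "(f has_derivative (\<lambda>h. G (x + z) \<bullet> h)) (at (x + z))"
          using d1(2)[of "x + z"] z sN by simp
        have "norm (G (x + z) - G x - H z) \<le> e * norm z"
          using d2(2)[of "x + z"] z sN by simp
        also have "\<dots> \<le> e * (s * N)" using z e by simp
        finally show "norm (G (x + z) - G x - H z) \<le> e * (s * N)" .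
      qed
      define g where "g = (\<lambda>t. f (x + s *\<^sub>R u + t *\<^sub>R v) - f (x + t *\<^sub>R v))"
      define g' where "g' = (\<lambda>t. G (x + s *\<^sub>R u + t *\<^sub>R v) \<bullet> v - G (x + t *\<^sub>R v) \<bullet> v)"
      have "\<bar>g s - g 0 - (s * (H u \<bullet> v)) * s\<bar> \<le> (2 * (e * (s * N)) * N) * s"
      proof (rule mvt_linear_error[where g' = g'])
        fix t assume t: "0 \<le> t" "t \<le> s"
        have tv: "norm (t *\<^sub>R v) \<le> s * norm v" using t by (simp add: mult_right_mono)
        have z1: "norm (s *\<^sub>R u + t *\<^sub>R v) \<le> s * N"
        proof -
          have "norm (s *\<^sub>R u + t *\<^sub>R v) \<le> norm (s *\<^sub>R u) + norm (t *\<^sub>R v)" by (rule norm_triangle_ineq)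
          also have "\<dots> \<le> s * norm u + s * norm v" using tv s by simp
          also have "\<dots> = s * N" by (simp add: uv flip: distrib_left)
          finally show ?thesis .
        qed
        have z2: "norm (t *\<^sub>R v) \<le> s * N"
        proof -
          have "s * norm v \<le> s * N" using s vN by (intro mult_left_mono) auto
          then show ?thesis using tv by linarith
        qed
        show "(g has_real_derivative g' t) (at t)"
          unfolding g_def g'_def
        proof (rule DERIV_diff)
          show "((\<lambda>t. f (x + s *\<^sub>R u + t *\<^sub>R v)) has_real_derivative G (x + s *\<^sub>R u + t *\<^sub>R v) \<bullet> v) (at t)"
            using R(1)[OF z1] by (intro has_derivative_along_line) (simp add: add.assoc)
          show "((\<lambda>t. f (x + t *\<^sub>R v)) has_real_derivative G (x + t *\<^sub>R v) \<bullet> v) (at t)"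
            using R(1)[OF z2] by (intro has_derivative_along_line)
        qed
        have eq: "g' t - s * (H u \<bullet> v) = (G (x + (s *\<^sub>R u + t *\<^sub>R v)) - G x - H (s *\<^sub>R u + t *\<^sub>R v)) \<bullet> v
            - (G (x + t *\<^sub>R v) - G x - H (t *\<^sub>R v)) \<bullet> v"
          by (simp add: g'_def inner_diff_left inner_add_left linear_add[OF lin] linear_scale[OF lin] add.assoc)
        have B: "\<bar>(G (x + z) - G x - H z) \<bullet> v\<bar> \<le> (e * (s * N)) * N" if "norm z \<le> s * N" for z
        proof -
          have "\<bar>(G (x + z) - G x - H z) \<bullet> v\<bar> \<le> norm (G (x + z) - G x - H z) * norm v"
            by (rule Cauchy_Schwarz_ineq2)
          also have "\<dots> \<le> (e * (s * N)) * N"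
            using R(2)[OF that] vN e s N0 by (intro mult_mono) auto
          finally show ?thesis .
        qed
        show "\<bar>g' t - s * (H u \<bullet> v)\<bar> \<le> 2 * (e * (s * N)) * N"
          using B[OF z1] B[OF z2] unfolding eq by linarith
      qed (use s in simp)
      then show ?thesis by (simp add: g_def power2_eq_square algebra_simps)
    qed
    ultimately show ?thesis by blast
  qed
  have "\<bar>H u \<bullet> v - H v \<bullet> u\<bar> \<le> 0 + e * (4 * N\<^sup>2)" if e: "e > 0" for e
  proof -
    obtain s0 where s0: "s0 > 0" and A: "\<And>s u v. 0 < s \<Longrightarrow> s < s0 \<Longrightarrow> norm u + norm v = N \<Longrightarrow>
      \<bar>f (x + s *\<^sub>R u + s *\<^sub>R v) - f (x + s *\<^sub>R v) - f (x + s *\<^sub>R u) + f x - s\<^sup>2 * (H u \<bullet> v)\<bar> \<le> e * s\<^sup>2 * (2 * N\<^sup>2)"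
      using key[OF e] by blast
    define s where "s = s0 / 2"
    have s: "0 < s" "s < s0" using s0 by (auto simp: s_def)
    have "s\<^sup>2 * \<bar>H u \<bullet> v - H v \<bullet> u\<bar> = \<bar>s\<^sup>2 * (H u \<bullet> v) - s\<^sup>2 * (H v \<bullet> u)\<bar>"
      by (simp add: abs_mult flip: right_diff_distrib)
    also have "\<dots> \<le> 2 * (e * s\<^sup>2 * (2 * N\<^sup>2))"
      using A[OF s, of u v] A[OF s, of v u] by (simp add: N_def add.commute add.left_commute abs_le_iff)
    finally have "s\<^sup>2 * \<bar>H u \<bullet> v - H v \<bullet> u\<bar> \<le> s\<^sup>2 * (e * (4 * N\<^sup>2))" by (simp add: algebra_simps)
    then show ?thesis using s(1) by simp
  qed
  then have "\<bar>H u \<bullet> v - H v \<bullet> u\<bar> \<le> 0"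
  proof -
    assume h: "\<And>e. e > 0 \<Longrightarrow> \<bar>H u \<bullet> v - H v \<bullet> u\<bar> \<le> 0 + e * (4 * N\<^sup>2)"
    show ?thesis
    proof (rule field_le_epsilon)
      fix e :: real assume "e > 0"
      then have "\<bar>H u \<bullet> v - H v \<bullet> u\<bar> \<le> e / (4 * N\<^sup>2 + 1) * (4 * N\<^sup>2)"
        using h[of "e / (4 * N\<^sup>2 + 1)"] by (simp add: add_pos_nonneg add_nonneg_pos)
      also have "\<dots> \<le> e / (4 * N\<^sup>2 + 1) * (4 * N\<^sup>2 + 1)"
        using \<open>e > 0\<close> by (intro mult_left_mono) auto
      also have "\<dots> = e" by (simp add: add_nonneg_pos less_imp_neq[THEN not_sym])
      finally show "\<bar>H u \<bullet> v - H v \<bullet> u\<bar> \<le> 0 + e" by simp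
    qed
  qed
  then show ?thesis by simp
qed

section \<open>The largest eigenvalue of a symmetric matrix\<close>

definition symmetric_matrix :: "real^'n^'n \<Rightarrow> bool" where
  "symmetric_matrix A \<longleftrightarrow> (\<forall>v w. v \<bullet> (A *v w) = (A *v v) \<bullet> w)"

lemma symmetric_matrixD: "symmetric_matrix A \<Longrightarrow> v \<bullet> (A *v w) = (A *v v) \<bullet> w"
  by (simp add: symmetric_matrix_def)

text \<open>A maximiser \<open>v\<close> of the quadratic form on the unit sphere is an eigenvector: otherwise moving \<open>v\<close> along the
residual \<open>r = A v - l v\<close> increases the Rayleigh quotient to first order.\<close>

lemma symmetric_matrix_eigenvalue_exists:
  fixes A :: "real^'n^'n"
  assumes "symmetric_matrix A"
  shows "\<exists>l. is_eigenvalue A l"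
proof -
  have ne: "sphere (0::real^'n) 1 \<noteq> {}" by simp
  have cont: "continuous_on (sphere (0::real^'n) 1) (\<lambda>v. v \<bullet> (A *v v))"
    by (intro continuous_intros)
  obtain v where v: "v \<in> sphere 0 1" and max: "\<And>w. w \<in> sphere 0 1 \<Longrightarrow> w \<bullet> (A *v w) \<le> v \<bullet> (A *v v)"
    using continuous_attains_sup[OF compact_sphere ne cont] by blast
  define l where "l = v \<bullet> (A *v v)"
  have nv: "norm v = 1" using v by simp
  have le: "w \<bullet> (A *v w) \<le> l * (w \<bullet> w)" for w
  proof (cases "w = 0")
    case False
    have "(w /\<^sub>R norm w) \<bullet> (A *v (w /\<^sub>R norm w)) \<le> l"
      unfolding l_def using False by (intro max) simp
    then have "w \<bullet> (A *v w) / (norm w * norm w) \<le> l"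
      by (simp add: matrix_vector_mult_scaleR divide_inverse mult_ac)
    then show ?thesis using False by (simp add: field_simps dot_square_norm power2_eq_square)
  qed simp
  define r where "r = A *v v - l *\<^sub>R v"
  have "r = 0"
  proof (rule ccontr)
    assume "r \<noteq> 0"
    \<comment> \<open>The gain is \<open>2 * t * (r \<bullet> r) + t\<^sup>2 * c\<close>; the step \<open>t\<close> is chosen so that the first term dominates.\<close>
    define c where "c = r \<bullet> (A *v r) - l * (r \<bullet> r)"
    define t where "t = (r \<bullet> r) / (\<bar>c\<bar> + 1)"
    have t0: "t > 0" using \<open>r \<noteq> 0\<close> by (simp add: t_def)
    have "(v + t *\<^sub>R r) \<bullet> (A *v (v + t *\<^sub>R r)) - l * ((v + t *\<^sub>R r) \<bullet> (v + t *\<^sub>R r))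
       = (v \<bullet> (A *v v) - l * (v \<bullet> v)) + 2 * t * ((A *v v - l *\<^sub>R v) \<bullet> r) + t\<^sup>2 * c"
    proof -
      have sym: "(A *v v) \<bullet> r = v \<bullet> (A *v r)" "r \<bullet> (A *v v) = v \<bullet> (A *v r)" "r \<bullet> v = v \<bullet> r"
        using symmetric_matrixD[OF assms, of v r] by (simp_all add: inner_commute)
      show ?thesis
        by (simp add: c_def matrix_vector_right_distrib matrix_vector_mult_scaleR inner_add_left
            inner_add_right inner_diff_left sym) (simp add: field_simps power2_eq_square)
    qed
    also have "\<dots> = 2 * t * (r \<bullet> r) + t\<^sup>2 * c"
      using nv by (simp add: l_def[symmetric] r_def[symmetric] dot_square_norm)
    finally have "2 * t * (r \<bullet> r) + t\<^sup>2 * c \<le> 0" using le[of "v + t *\<^sub>R r"] by simp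
    then have "t * (2 * (r \<bullet> r) + t * c) \<le> 0" by (simp add: algebra_simps power2_eq_square)
    then have "2 * (r \<bullet> r) \<le> - (t * c)" using t0 by (simp add: mult_le_0_iff)
    also have "\<dots> = t * (- c)" by simp
    also have "\<dots> \<le> t * (\<bar>c\<bar> + 1)" using t0 by (intro mult_left_mono) auto
    also have "\<dots> = r \<bullet> r" by (simp add: t_def add_nonneg_pos less_imp_neq[THEN not_sym])
    finally show False using \<open>r \<noteq> 0\<close> by simp
  qed
  then show ?thesis unfolding is_eigenvalue_def r_def using nv by (intro exI[of _ l] exI[of _ v]) auto
qed

text \<open>Eigenvectors of distinct eigenvalues are orthogonal, and orthogonal families are finite.\<close>

lemma symmetric_matrix_finite_eigenvalues:
  fixes A :: "real^'n^'n"
  assumes "symmetric_matrix A"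
  shows "finite {l. is_eigenvalue A l}"
proof -
  define e where "e l = (SOME v. v \<noteq> 0 \<and> A *v v = l *\<^sub>R v)" for l
  have e: "e l \<noteq> 0" "A *v e l = l *\<^sub>R e l" if "is_eigenvalue A l" for l
    using someI_ex[of "\<lambda>v. v \<noteq> 0 \<and> A *v v = l *\<^sub>R v"] that
    unfolding e_def is_eigenvalue_def by blast+
  have orth: "e l \<bullet> e m = 0" if "is_eigenvalue A l" "is_eigenvalue A m" "l \<noteq> m" for l m
  proof -
    have "m * (e l \<bullet> e m) = l * (e l \<bullet> e m)"
      using symmetric_matrixD[OF assms, of "e l" "e m"] e that by simp
    then show ?thesis using that by simp
  qed
  have inj: "inj_on e {l. is_eigenvalue A l}"
    using orth e(1) by (fastforce simp: inj_on_def)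
  have "pairwise orthogonal (e ` {l. is_eigenvalue A l})"
    unfolding pairwise_def orthogonal_def using orth by blast
  then have "finite (e ` {l. is_eigenvalue A l})"
    by (rule pairwise_orthogonal_imp_finite)
  then show ?thesis using inj by (rule finite_imageD)
qed

lemma max_eigenvalue_ge:
  assumes "symmetric_matrix A" "v \<noteq> 0" "A *v v = l *\<^sub>R v"
  shows "l \<le> max_eigenvalue A"
  unfolding max_eigenvalue_def
  using assms by (intro Max_ge symmetric_matrix_finite_eigenvalues) (auto simp: is_eigenvalue_def)

lemma max_eigenvalue_le:
  assumes "symmetric_matrix A" "\<And>l v. v \<noteq> 0 \<Longrightarrow> A *v v = l *\<^sub>R v \<Longrightarrow> l \<le> B"
  shows "max_eigenvalue A \<le> B"
  unfolding max_eigenvalue_def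
proof (rule Max.boundedI)
  show "finite {l. is_eigenvalue A l}" by (rule symmetric_matrix_finite_eigenvalues[OF assms(1)])
  show "{l. is_eigenvalue A l} \<noteq> {}" using symmetric_matrix_eigenvalue_exists[OF assms(1)] by blast
  show "l \<le> B" if "l \<in> {l. is_eigenvalue A l}" for l
    using that assms(2) unfolding is_eigenvalue_def by blast
qed

lemma mat_mult_vector: "mat c *v v = c *\<^sub>R (v::real^'n)"
  by (simp add: matrix_vector_mult_def mat_def vec_eq_iff if_distrib[of "\<lambda>x. x * _"] cong: if_cong)

lemma symmetric_matrix_add_mat: "symmetric_matrix A \<Longrightarrow> symmetric_matrix (A + mat c)"
  by (simp add: symmetric_matrix_def matrix_vector_mult_add_rdistrib mat_mult_vector inner_add_left inner_add_right)

text \<open>Adding a multiple of the identity moves the largest eigenvalue by exactly that amount. This turns the error terms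
\<open>\<epsilon> * (norm (y - x))\<^sup>2\<close> of Taylor's formula into an arbitrarily small perturbation of the equation.\<close>

lemma max_eigenvalue_add_mat:
  fixes A :: "real^'n^'n"
  assumes "symmetric_matrix A"
  shows "max_eigenvalue (A + mat c) = max_eigenvalue A + c"
proof -
  have "{l. is_eigenvalue (A + mat c) l} = (\<lambda>l. l + c) ` {l. is_eigenvalue A l}"
  proof -
    have "is_eigenvalue (A + mat c) l \<longleftrightarrow> is_eigenvalue A (l - c)" for l
    proof -
      have "(A + mat c) *v v = l *\<^sub>R v \<longleftrightarrow> A *v v = (l - c) *\<^sub>R v" for v
        by (simp add: matrix_vector_mult_add_rdistrib mat_mult_vector scaleR_left_diff_distrib eq_diff_eq)
      then show ?thesis by (simp add: is_eigenvalue_def)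
    qed
    then have "{l. is_eigenvalue (A + mat c) l} = {l. is_eigenvalue A (l - c)}" by simp
    also have "\<dots> = (\<lambda>l. l + c) ` {l. is_eigenvalue A l}"
    proof (intro equalityI subsetI)
      fix l assume "l \<in> {l. is_eigenvalue A (l - c)}"
      then show "l \<in> (\<lambda>l. l + c) ` {l. is_eigenvalue A l}"
        by (intro image_eqI[of _ _ "l - c"]) auto
    qed auto
    finally show ?thesis .
  qed
  then show ?thesis
    unfolding max_eigenvalue_def
    using symmetric_matrix_finite_eigenvalues[OF assms] symmetric_matrix_eigenvalue_exists[OF assms]
    by (simp add: Max_add_commute)
qed

text \<open>The matrix \<open>\<alpha> I + \<beta> b b\<^sup>T\<close>, the general form of the Hessian of a radial function.\<close>

definition radial_matrix :: "real \<Rightarrow> real \<Rightarrow> real^'n \<Rightarrow> real^'n^'n" where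
  "radial_matrix \<alpha> \<beta> b = (\<chi> i j. \<beta> * b $ i * b $ j) + mat \<alpha>"

lemma radial_matrix_mult: "radial_matrix \<alpha> \<beta> b *v v = \<alpha> *\<^sub>R v + (\<beta> * (b \<bullet> v)) *\<^sub>R b"
  by (simp add: radial_matrix_def matrix_vector_mult_add_rdistrib mat_mult_vector)
    (simp add: matrix_vector_mult_def vec_eq_iff inner_vec_def sum_distrib_left sum_distrib_right algebra_simps)

lemma symmetric_radial_matrix: "symmetric_matrix (radial_matrix \<alpha> \<beta> b)"
  by (simp add: symmetric_matrix_def radial_matrix_mult inner_add_left inner_add_right inner_commute)

lemma max_eigenvalue_radial_ge:
  assumes "b \<noteq> 0"
  shows "\<alpha> + \<beta> * (norm b)\<^sup>2 \<le> max_eigenvalue (radial_matrix \<alpha> \<beta> b)"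
  by (rule max_eigenvalue_ge[OF symmetric_radial_matrix assms])
    (simp add: radial_matrix_mult dot_square_norm scaleR_add_left)

lemma max_eigenvalue_radial_le:
  fixes b :: "real^'n"
  shows "max_eigenvalue (radial_matrix \<alpha> \<beta> b) \<le> max \<alpha> (\<alpha> + \<beta> * (norm b)\<^sup>2)"
proof (rule max_eigenvalue_le[OF symmetric_radial_matrix])
  fix l and v :: "real^'n" assume v: "v \<noteq> 0" "radial_matrix \<alpha> \<beta> b *v v = l *\<^sub>R v"
  then have eq: "(l - \<alpha>) *\<^sub>R v = (\<beta> * (b \<bullet> v)) *\<^sub>R b"
    by (simp add: radial_matrix_mult algebra_simps)
  show "l \<le> max \<alpha> (\<alpha> + \<beta> * (norm b)\<^sup>2)"
  proof (cases "b \<bullet> v = 0")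
    case True
    then show ?thesis using eq v by simp
  next
    case False
    have "(l - \<alpha>) * (b \<bullet> v) = (\<beta> * (norm b)\<^sup>2) * (b \<bullet> v)"
      using arg_cong[OF eq, of "\<lambda>w. b \<bullet> w"] by (simp add: dot_square_norm mult_ac)
    then show ?thesis using False by simp
  qed
qed

lemma max_eigenvalue_0: "max_eigenvalue (0::real^'n^'n) = 0"
proof -
  have "symmetric_matrix (0::real^'n^'n)" by (simp add: symmetric_matrix_def)
  moreover obtain v :: "real^'n" where "v \<noteq> 0" using vector_choose_size[of 1] by force
  ultimately show ?thesis
    using max_eigenvalue_ge[of 0 v 0] by (intro antisym max_eigenvalue_le) auto
qed

text \<open>The second-order Taylor polynomial at \<open>x\<close> with gradient \<open>a\<close> and Hessian \<open>A\<close>, without constant term. Such polynomials are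
\<open>C\<^sup>2\<close> on the whole space, so they are admissible test functions even where a barrier itself is
smooth only locally.\<close>

section \<open>Quadratic test functions\<close>

definition quad :: "real^'n \<Rightarrow> real^'n \<Rightarrow> real^'n^'n \<Rightarrow> real^'n \<Rightarrow> real" where
  "quad x a A y = a \<bullet> (y - x) + 1/2 * ((y - x) \<bullet> (A *v (y - x)))"

lemma quad_self [simp]: "quad x a A x = 0"
  by (simp add: quad_def)

lemma quad_has_derivative:
  assumes "symmetric_matrix A"
  shows "(quad x a A has_derivative (\<lambda>h. (a + A *v (y - x)) \<bullet> h)) (at y)"
proof -
  have d1: "((\<lambda>y. y - x) has_derivative (\<lambda>h. h)) (at y)"
    by (auto intro!: derivative_eq_intros)
  have d2: "((\<lambda>y. A *v (y - x)) has_derivative (\<lambda>h. A *v h)) (at y)"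
    by (rule bounded_linear.has_derivative[OF matrix_vector_mul_bounded_linear d1])
  have "(quad x a A has_derivative
      (\<lambda>h. a \<bullet> h + 1/2 * ((y - x) \<bullet> (A *v h) + h \<bullet> (A *v (y - x))))) (at y)"
    unfolding quad_def
    by (rule has_derivative_add[OF has_derivative_inner_right[OF d1]
          has_derivative_mult_right[OF has_derivative_inner[OF d1 d2]]])
  moreover have "a \<bullet> h + 1/2 * ((y - x) \<bullet> (A *v h) + h \<bullet> (A *v (y - x))) = (a + A *v (y - x)) \<bullet> h" for h
    using symmetric_matrixD[OF assms, of "y - x" h] inner_commute[of h "A *v (y - x)"]
    by (simp add: inner_add_left)
  ultimately show ?thesis by simp
qed

lemma gradient_eq:
  assumes "(f has_derivative (\<lambda>h. G \<bullet> h)) (at x)"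
  shows "gradient f x = G"
  using frechet_derivative_at[OF assms, symmetric]
  by (simp add: gradient_def vec_eq_iff inner_axis)

lemma gradient_has_derivative:
  assumes "f differentiable (at x)"
  shows "(f has_derivative (\<lambda>h. gradient f x \<bullet> h)) (at x)"
proof -
  have D: "(f has_derivative frechet_derivative f (at x)) (at x)"
    using assms by (simp add: frechet_derivative_works)
  then have lin: "linear (frechet_derivative f (at x))" by (rule has_derivative_linear)
  have "frechet_derivative f (at x) h = gradient f x \<bullet> h" for h
  proof -
    have "frechet_derivative f (at x) h = frechet_derivative f (at x) (\<Sum>i\<in>UNIV. h $ i *\<^sub>R axis i 1)"
      by (simp add: basis_expansion flip: scalar_mult_eq_scaleR)
    also have "\<dots> = (\<Sum>i\<in>UNIV. h $ i * frechet_derivative f (at x) (axis i 1))"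
      by (simp add: linear_sum[OF lin] linear_scale[OF lin])
    finally show ?thesis by (simp add: gradient_def inner_vec_def mult.commute)
  qed
  then show ?thesis using D by presburger
qed

lemma gradient_quad:
  assumes "symmetric_matrix A"
  shows "gradient (quad x a A) = (\<lambda>y. a + A *v (y - x))"
  by (rule ext) (rule gradient_eq[OF quad_has_derivative[OF assms]])

lemma hessian_quad:
  assumes "symmetric_matrix A"
  shows "hessian (quad x a A) = (\<lambda>y. A)"
proof
  fix y
  have "((\<lambda>y. a + A *v (y - x)) has_derivative (\<lambda>h. A *v h)) (at y)"
    by (rule derivative_eq_intros bounded_linear.has_derivative[OF matrix_vector_mul_bounded_linear] refl)+ simp
  then show "hessian (quad x a A) y = A"
    unfolding hessian_def jacobian_def gradient_quad[OF assms]
    by (simp only: frechet_derivative_at[symmetric] matrix_of_matrix_vector_mul)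
qed

lemma C2_on_quad:
  assumes "symmetric_matrix A"
  shows "C2_on U (quad x a A)"
  unfolding C2_on_def hessian_quad[OF assms]
proof (intro conjI, unfold differentiable_on_def, safe)
  fix y
  show "quad x a A differentiable at y within U"
    by (rule differentiable_at_withinI[OF differentiableI[OF quad_has_derivative[OF assms]]])
  have "((\<lambda>y. a + A *v (y - x)) has_derivative (\<lambda>h. A *v h)) (at y)"
    by (rule derivative_eq_intros bounded_linear.has_derivative[OF matrix_vector_mul_bounded_linear] refl)+ simp
  then show "gradient (quad x a A) differentiable at y within U"
    unfolding gradient_quad[OF assms] by (rule differentiable_at_withinI[OF differentiableI])
qed auto

lemma C2_on_derivatives:
  assumes "C2_on U \<phi>" "open U" "x \<in> U"
  shows "\<forall>\<^sub>F y in nhds x. (\<phi> has_derivative (\<lambda>h. gradient \<phi> y \<bullet> h)) (at y)"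
    and "(gradient \<phi> has_derivative (\<lambda>h. hessian \<phi> x *v h)) (at x)"
proof -
  have 1: "\<phi> differentiable (at y)" "gradient \<phi> differentiable (at y)" if "y \<in> U" for y
    using assms that by (auto simp: C2_on_def differentiable_on_eq_differentiable_at)
  show "\<forall>\<^sub>F y in nhds x. (\<phi> has_derivative (\<lambda>h. gradient \<phi> y \<bullet> h)) (at y)"
    using eventually_nhds_in_open[OF assms(2,3)]
    by (rule eventually_mono) (intro gradient_has_derivative 1)
  show "(gradient \<phi> has_derivative (\<lambda>h. hessian \<phi> x *v h)) (at x)"
    using 1(2)[OF assms(3)] by (simp add: hessian_def jacobian_works)
qed

lemma C2_on_Taylor:
  assumes "C2_on U \<phi>" "open U" "x \<in> U" "0 < \<epsilon>"
  shows "\<forall>\<^sub>F y in nhds x.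
    \<bar>\<phi> y - \<phi> x - quad x (gradient \<phi> x) (hessian \<phi> x) y\<bar> \<le> \<epsilon> * (norm (y - x))\<^sup>2"
  using second_order_Taylor[OF C2_on_derivatives[OF assms(1-3)] assms(4)]
  by (simp add: quad_def inner_commute[of "_ - x" "hessian \<phi> x *v _"] diff_diff_eq add.assoc)

lemma symmetric_hessian:
  assumes "C2_on U \<phi>" "open U" "x \<in> U"
  shows "symmetric_matrix (hessian \<phi> x)"
  unfolding symmetric_matrix_def
proof (intro allI)
  fix v w
  show "v \<bullet> (hessian \<phi> x *v w) = (hessian \<phi> x *v v) \<bullet> w"
    using second_derivative_symmetric[OF C2_on_derivatives[OF assms], of v w]
    by (simp add: inner_commute[of v])
qed

lemma quad_add_mat: "quad x a (A + mat c) y = quad x a A y + c / 2 * (norm (y - x))\<^sup>2"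
  by (simp add: quad_def matrix_vector_mult_add_rdistrib mat_mult_vector inner_add_right dot_square_norm
      distrib_left del: scaleR_diff_right)

section \<open>Second-order jets and radial functions\<close>

lemma viscosity_subsolution_quad:
  assumes "viscosity_subsolution \<Omega> p \<gamma> g u" "x \<in> \<Omega>" "symmetric_matrix A"
    and "local_max_at (\<lambda>y. u y - quad z a A y) x"
  shows "- max_eigenvalue A + norm (a + A *v (x - z)) powr p + \<gamma> * u x \<le> g x"
  using assms(1)[unfolded viscosity_subsolution_def, rule_format, OF assms(2) C2_on_quad[OF assms(3)] assms(4)]
  by (simp add: gradient_quad[OF assms(3)] hessian_quad[OF assms(3)])

lemma viscosity_supersolution_quad:
  assumes "viscosity_supersolution \<Omega> p \<gamma> g u" "x \<in> \<Omega>" "symmetric_matrix A"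
    and "local_min_at (\<lambda>y. u y - quad z a A y) x"
  shows "- max_eigenvalue A + norm (a + A *v (x - z)) powr p + \<gamma> * u x \<ge> g x"
  using assms(1)[unfolded viscosity_supersolution_def, rule_format, OF assms(2) C2_on_quad[OF assms(3)] assms(4)]
  by (simp add: gradient_quad[OF assms(3)] hessian_quad[OF assms(3)])

text \<open>These two predicates are the differential inequalities
\<open>\<bar>Du\<bar> powr p \<le> \<lambda>\<^sub>N(D\<^sup>2u) + K\<close> and \<open>\<lambda>\<^sub>N(D\<^sup>2u) \<le> \<bar>Du\<bar> powr p + K\<close> in terms of second-order jets. They are what
remains of the equation once \<open>f\<close> and \<open>\<gamma> u\<close> are bounded, and unlike the equation they do not see
additive constants.\<close>

definition sub_jets :: "(real^'n) set \<Rightarrow> real \<Rightarrow> real \<Rightarrow> (real^'n \<Rightarrow> real) \<Rightarrow> bool" where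
  "sub_jets \<Omega> p K u \<longleftrightarrow> (\<forall>x\<in>\<Omega>. \<forall>a A. symmetric_matrix A \<longrightarrow>
     (\<forall>\<^sub>F y in nhds x. u y \<le> u x + quad x a A y) \<longrightarrow> norm a powr p \<le> max_eigenvalue A + K)"

definition super_jets :: "(real^'n) set \<Rightarrow> real \<Rightarrow> real \<Rightarrow> (real^'n \<Rightarrow> real) \<Rightarrow> bool" where
  "super_jets \<Omega> p K u \<longleftrightarrow> (\<forall>x\<in>\<Omega>. \<forall>a A. symmetric_matrix A \<longrightarrow>
     (\<forall>\<^sub>F y in nhds x. u x + quad x a A y \<le> u y) \<longrightarrow> max_eigenvalue A \<le> norm a powr p + K)"

lemma sub_jets_add_const: "sub_jets \<Omega> p K u \<Longrightarrow> sub_jets \<Omega> p K (\<lambda>x. u x + c)"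
  by (simp add: sub_jets_def)

lemma super_jets_add_const: "super_jets \<Omega> p K u \<Longrightarrow> super_jets \<Omega> p K (\<lambda>x. u x + c)"
  by (simp add: super_jets_def)

text \<open>The gradient of \<open>h (norm (y - c))\<close> is the field \<open>G y = (h' t / t) (y - c)\<close>, and differentiating \<open>G\<close> gives
the eigenvalue \<open>h''\<close> in the direction \<open>x - c\<close> and \<open>h' t / t\<close> orthogonally to it.\<close>

lemma radial_Taylor:
  fixes c x :: "real^'n"
  assumes "x \<noteq> c" and t: "t = norm (x - c)"
    and h: "\<forall>\<^sub>F s in nhds t. (h has_real_derivative h1 s) (at s)"
    and h1: "(h1 has_real_derivative h2) (at t)" and "0 < \<epsilon>"
  shows "\<forall>\<^sub>F y in nhds x.
    \<bar>h (norm (y - c)) - h t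
      - quad x ((h1 t / t) *\<^sub>R (x - c)) (radial_matrix (h1 t / t) ((h2 - h1 t / t) / t\<^sup>2) (x - c)) y\<bar>
    \<le> \<epsilon> * (norm (y - x))\<^sup>2"
proof -
  have tpos: "t > 0" using assms(1) t by simp
  define G where "G y = (h1 (norm (y - c)) / norm (y - c)) *\<^sub>R (y - c)" for y
  define R where "R = radial_matrix (h1 t / t) ((h2 - h1 t / t) / t\<^sup>2) (x - c)"
  have norm_deriv: "((\<lambda>y. norm (y - c)) has_derivative (\<lambda>k. ((y - c) \<bullet> k) / norm (y - c))) (at y)"
    if "y \<noteq> c" for y
  proof -
    have "((\<lambda>y. y - c) has_derivative (\<lambda>k. k)) (at y)" by (auto intro!: derivative_eq_intros)
    from diff_chain_at[OF this has_derivative_norm] that show ?thesis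
      by (simp add: o_def sgn_div_norm inner_commute divide_inverse mult.commute)
  qed
  have lim: "filterlim (\<lambda>y. norm (y - c)) (nhds t) (nhds x)"
    unfolding t by (intro tendsto_intros filterlim_ident)
  have "\<forall>\<^sub>F y in nhds x. (h has_real_derivative h1 (norm (y - c))) (at (norm (y - c)))"
    using filterlim_iff[THEN iffD1, OF lim, rule_format, OF h] .
  moreover have "\<forall>\<^sub>F y in nhds x. y \<noteq> c"
    by (rule t1_space_nhds[OF assms(1)])
  ultimately have f: "\<forall>\<^sub>F y in nhds x. ((\<lambda>y. h (norm (y - c))) has_derivative (\<lambda>k. G y \<bullet> k)) (at y)"
  proof eventually_elim
    case (elim y)
    have "((\<lambda>y. h (norm (y - c))) has_derivative
        (\<lambda>k. h1 (norm (y - c)) * (((y - c) \<bullet> k) / norm (y - c)))) (at y)"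
      using diff_chain_at[OF norm_deriv[OF elim(2)] elim(1)[unfolded has_field_derivative_def]]
      by (simp add: o_def)
    then show ?case by (simp add: G_def)
  qed
  have G: "(G has_derivative (\<lambda>k. R *v k)) (at x)"
  proof -
    have q: "((\<lambda>s. h1 s / s) has_real_derivative (h2 * t - h1 t) / t\<^sup>2) (at t)"
      using h1 tpos by (auto intro!: derivative_eq_intros simp: power2_eq_square)
    have a1: "((\<lambda>y. h1 (norm (y - c)) / norm (y - c)) has_derivative
        (\<lambda>k. (h2 * t - h1 t) / t\<^sup>2 * (((x - c) \<bullet> k) / t))) (at x)"
      using diff_chain_at[OF norm_deriv[OF assms(1)], of "\<lambda>s. h1 s / s", folded t,
          OF q[unfolded has_field_derivative_def]]
      by (simp only: o_def)
    have a2: "((\<lambda>y. y - c) has_derivative (\<lambda>k. k)) (at x)"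
      by (auto intro!: derivative_eq_intros)
    have "(G has_derivative (\<lambda>k. (h1 t / t) *\<^sub>R k
        + ((h2 * t - h1 t) / t\<^sup>2 * (((x - c) \<bullet> k) / t)) *\<^sub>R (x - c))) (at x)"
      unfolding G_def using has_derivative_scaleR[OF a1 a2, folded t] .
    moreover have "(h2 * t - h1 t) / t\<^sup>2 * (((x - c) \<bullet> k) / t) = (h2 - h1 t / t) / t\<^sup>2 * ((x - c) \<bullet> k)" for k
      using tpos by (simp add: field_simps)
    ultimately show ?thesis by (simp add: R_def radial_matrix_mult)
  qed
  have "G x = (h1 t / t) *\<^sub>R (x - c)" by (simp add: G_def t)
  moreover have "(R *v (y - x)) \<bullet> (y - x) = (y - x) \<bullet> (R *v (y - x))" for y by (rule inner_commute)
  ultimately show ?thesis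
    using second_order_Taylor[OF f G \<open>0 < \<epsilon>\<close>] by (simp add: quad_def R_def t diff_diff_eq add.assoc)
qed

text \<open>The largest eigenvalue dominates the one in the radial direction, so touching from below by a radial
function yields a one-dimensional inequality without any contribution of the tangential
directions.\<close>

lemma super_jets_radial:
  fixes c x :: "real^'n"
  assumes u: "super_jets \<Omega> p K u" "x \<in> \<Omega>" and "x \<noteq> c" and t: "t = norm (x - c)"
    and h: "\<forall>\<^sub>F s in nhds t. (h has_real_derivative h1 s) (at s)"
    and h1: "(h1 has_real_derivative h2) (at t)"
    and touch: "\<forall>\<^sub>F y in nhds x. u x + h (norm (y - c)) - h t \<le> u y"
  shows "h2 \<le> \<bar>h1 t\<bar> powr p + K"
proof (rule field_le_epsilon)
  fix e :: real assume e: "0 < e"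
  have tpos: "t > 0" using assms(3) t by simp
  define a where "a = (h1 t / t) *\<^sub>R (x - c)"
  define A where "A = radial_matrix (h1 t / t) ((h2 - h1 t / t) / t\<^sup>2) (x - c)"
  have sym: "symmetric_matrix A" unfolding A_def by (rule symmetric_radial_matrix)
  have ev: "h2 \<le> max_eigenvalue A"
    using max_eigenvalue_radial_ge[of "x - c" "h1 t / t" "(h2 - h1 t / t) / t\<^sup>2"] assms(3) tpos
    by (simp add: A_def flip: t)
  have na: "norm a = \<bar>h1 t\<bar>" using tpos by (simp add: a_def flip: t)
  have "\<forall>\<^sub>F y in nhds x. \<bar>h (norm (y - c)) - h t - quad x a A y\<bar> \<le> e / 2 * (norm (y - x))\<^sup>2"
    unfolding a_def A_def using e by (intro radial_Taylor[OF assms(3) t h h1]) simp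
  with touch have "\<forall>\<^sub>F y in nhds x. u x + quad x a (A + mat (- e)) y \<le> u y"
  proof eventually_elim
    case (elim y)
    then show ?case by (simp only: quad_add_mat abs_le_iff minus_divide_left[symmetric] mult_minus_left) linarith
  qed
  then have "max_eigenvalue (A + mat (- e)) \<le> norm a powr p + K"
    using u symmetric_matrix_add_mat[OF sym] unfolding super_jets_def by blast
  then show "h2 \<le> \<bar>h1 t\<bar> powr p + K + e"
    using ev by (simp add: max_eigenvalue_add_mat[OF sym] na)
qed

text \<open>For touching from above both eigenvalues enter, since only the larger of the two is controlled from below.\<close>

lemma sub_jets_radial:
  fixes c x :: "real^'n"
  assumes u: "sub_jets \<Omega> p K u" "x \<in> \<Omega>" and "x \<noteq> c" and t: "t = norm (x - c)"
    and h: "\<forall>\<^sub>F s in nhds t. (h has_real_derivative h1 s) (at s)"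
    and h1: "(h1 has_real_derivative h2) (at t)"
    and touch: "\<forall>\<^sub>F y in nhds x. u y \<le> u x + h (norm (y - c)) - h t"
  shows "\<bar>h1 t\<bar> powr p \<le> max (h1 t / t) h2 + K"
proof (rule field_le_epsilon)
  fix e :: real assume e: "0 < e"
  have tpos: "t > 0" using assms(3) t by simp
  define a where "a = (h1 t / t) *\<^sub>R (x - c)"
  define A where "A = radial_matrix (h1 t / t) ((h2 - h1 t / t) / t\<^sup>2) (x - c)"
  have sym: "symmetric_matrix A" unfolding A_def by (rule symmetric_radial_matrix)
  have ev: "max_eigenvalue A \<le> max (h1 t / t) h2"
    using max_eigenvalue_radial_le[of "h1 t / t" "(h2 - h1 t / t) / t\<^sup>2" "x - c"] tpos
    by (simp add: A_def flip: t)
  have na: "norm a = \<bar>h1 t\<bar>" using tpos by (simp add: a_def flip: t)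
  have "\<forall>\<^sub>F y in nhds x. \<bar>h (norm (y - c)) - h t - quad x a A y\<bar> \<le> e / 2 * (norm (y - x))\<^sup>2"
    unfolding a_def A_def using e by (intro radial_Taylor[OF assms(3) t h h1]) simp
  with touch have "\<forall>\<^sub>F y in nhds x. u y \<le> u x + quad x a (A + mat e) y"
  proof eventually_elim
    case (elim y)
    then show ?case by (simp only: quad_add_mat abs_le_iff minus_divide_left[symmetric] mult_minus_left) linarith
  qed
  then have "norm a powr p \<le> max_eigenvalue (A + mat e) + K"
    using u symmetric_matrix_add_mat[OF sym] unfolding sub_jets_def by blast
  then show "\<bar>h1 t\<bar> powr p \<le> max (h1 t / t) h2 + K + e"
    using ev by (simp add: max_eigenvalue_add_mat[OF sym] na)
qed

text \<open>Wherever the minimum of \<open>u - h\<close> over \<open>D\<close> is negative, the second alternative of the case hypothesis holds,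
and it contradicts the one-dimensional inequality. The first alternative covers the boundary of \<open>D\<close>, and
also the centre \<open>c\<close> in case the profile has a corner there.\<close>

section \<open>Radial barriers\<close>

lemma radial_barrier_below:
  fixes c :: "real^'n"
  assumes u: "super_jets \<Omega> p K u"
    and D: "compact D" "continuous_on D u"
    and cont: "continuous_on D (\<lambda>x. h (norm (x - c)))"
    and cases: "\<And>x. x \<in> D \<Longrightarrow> h (norm (x - c)) \<le> u x \<or>
      (x \<in> \<Omega> \<and> x \<in> interior D \<and> x \<noteq> c \<and>
       (\<forall>\<^sub>F s in nhds (norm (x - c)). (h has_real_derivative h1 s) (at s)) \<and>
       (h1 has_real_derivative h2 (norm (x - c))) (at (norm (x - c))) \<and>
       \<bar>h1 (norm (x - c))\<bar> powr p + K < h2 (norm (x - c)))"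
    and "x \<in> D"
  shows "h (norm (x - c)) \<le> u x"
proof (rule ccontr)
  assume neg: "\<not> h (norm (x - c)) \<le> u x"
  obtain z where z: "z \<in> D" and min: "\<And>y. y \<in> D \<Longrightarrow> u z - h (norm (z - c)) \<le> u y - h (norm (y - c))"
    using continuous_attains_inf[of D "\<lambda>y. u y - h (norm (y - c))"] D cont \<open>x \<in> D\<close>
    by (fastforce intro: continuous_on_diff)
  have "\<not> h (norm (z - c)) \<le> u z" using min[OF \<open>x \<in> D\<close>] neg by simp
  with cases[OF z] have *: "z \<in> \<Omega>" "z \<in> interior D" "z \<noteq> c"
       "\<forall>\<^sub>F s in nhds (norm (z - c)). (h has_real_derivative h1 s) (at s)"
       "(h1 has_real_derivative h2 (norm (z - c))) (at (norm (z - c)))"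
       "\<bar>h1 (norm (z - c))\<bar> powr p + K < h2 (norm (z - c))"
    by auto
  have "\<forall>\<^sub>F y in nhds z. y \<in> interior D"
    using *(2) by (intro eventually_nhds_in_open) auto
  then have "\<forall>\<^sub>F y in nhds z. u z + h (norm (y - c)) - h (norm (z - c)) \<le> u y"
  proof eventually_elim
    case (elim y)
    then show ?case using min[of y] interior_subset by force
  qed
  from super_jets_radial[OF u *(1) *(3) refl *(4) *(5) this] *(6) show False by simp
qed

lemma radial_barrier_above:
  fixes c :: "real^'n"
  assumes u: "sub_jets \<Omega> p K u"
    and D: "compact D" "continuous_on D u"
    and cont: "continuous_on D (\<lambda>x. h (norm (x - c)))"
    and cases: "\<And>x. x \<in> D \<Longrightarrow> u x \<le> h (norm (x - c)) \<or>
      (x \<in> \<Omega> \<and> x \<in> interior D \<and> x \<noteq> c \<and>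
       (\<forall>\<^sub>F s in nhds (norm (x - c)). (h has_real_derivative h1 s) (at s)) \<and>
       (h1 has_real_derivative h2 (norm (x - c))) (at (norm (x - c))) \<and>
       max (h1 (norm (x - c)) / norm (x - c)) (h2 (norm (x - c))) + K < \<bar>h1 (norm (x - c))\<bar> powr p)"
    and "x \<in> D"
  shows "u x \<le> h (norm (x - c))"
proof (rule ccontr)
  assume neg: "\<not> u x \<le> h (norm (x - c))"
  obtain z where z: "z \<in> D" and max: "\<And>y. y \<in> D \<Longrightarrow> u y - h (norm (y - c)) \<le> u z - h (norm (z - c))"
    using continuous_attains_sup[of D "\<lambda>y. u y - h (norm (y - c))"] D cont \<open>x \<in> D\<close>
    by (fastforce intro: continuous_on_diff)
  have "\<not> u z \<le> h (norm (z - c))" using max[OF \<open>x \<in> D\<close>] neg by simp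
  with cases[OF z] have *: "z \<in> \<Omega>" "z \<in> interior D" "z \<noteq> c"
       "\<forall>\<^sub>F s in nhds (norm (z - c)). (h has_real_derivative h1 s) (at s)"
       "(h1 has_real_derivative h2 (norm (z - c))) (at (norm (z - c)))"
       "max (h1 (norm (z - c)) / norm (z - c)) (h2 (norm (z - c))) + K < \<bar>h1 (norm (z - c))\<bar> powr p"
    by auto
  have "\<forall>\<^sub>F y in nhds z. y \<in> interior D"
    using *(2) by (intro eventually_nhds_in_open) auto
  then have "\<forall>\<^sub>F y in nhds z. u y \<le> u z + h (norm (y - c)) - h (norm (z - c))"
  proof eventually_elim
    case (elim y)
    then show ?case using max[of y] interior_subset by force
  qed
  from sub_jets_radial[OF u *(1) *(3) refl *(4) *(5) this] *(6) show False by simp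
qed

text \<open>A concave parabola, positive and increasing on the interval from \<open>0\<close> to \<open>1 / (2 * k)\<close>.\<close>

section \<open>The logarithmic barrier for supersolutions\<close>

definition hump :: "real \<Rightarrow> real \<Rightarrow> real" where
  "hump k s = s - k * s\<^sup>2"

lemma hump_pos: "0 < k \<Longrightarrow> 0 < s \<Longrightarrow> s \<le> 1 / (2 * k) \<Longrightarrow> 0 < hump k s"
  by (simp add: hump_def power2_eq_square field_simps)

lemma hump_le: "0 < k \<Longrightarrow> hump k s \<le> s"
  by (simp add: hump_def)

lemma hump_strict_mono: "0 < k \<Longrightarrow> s < t \<Longrightarrow> t \<le> 1 / (2 * k) \<Longrightarrow> hump k s < hump k t"
proof -
  assume k: "0 < k" and st: "s < t" "t \<le> 1 / (2 * k)"
  have "k * (s + t) < k * (2 * t)" using k st by (intro mult_strict_left_mono) auto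
  also have "\<dots> \<le> 1" using k st by (simp add: field_simps)
  finally have "(t - s) * (1 - k * (s + t)) > 0" using st by simp
  then show ?thesis by (simp add: hump_def power2_eq_square algebra_simps)
qed

text \<open>By the substitution \<open>\<psi> = - ln w\<close> the expression \<open>\<psi>'' - (\<psi>')\<^sup>2\<close> becomes \<open>- w'' / w\<close>, which is \<open>2 * k / w\<close> for
the parabola \<open>w = hump k\<close> and hence as large as desired on short intervals.\<close>

definition log_profile :: "real \<Rightarrow> real \<Rightarrow> real \<Rightarrow> real" where
  "log_profile k \<sigma> t = - ln (hump k (t + \<sigma>))"

definition log_profile_deriv :: "real \<Rightarrow> real \<Rightarrow> real \<Rightarrow> real" where
  "log_profile_deriv k \<sigma> t = - (1 - 2 * k * (t + \<sigma>)) / hump k (t + \<sigma>)"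

definition log_profile_deriv2 :: "real \<Rightarrow> real \<Rightarrow> real \<Rightarrow> real" where
  "log_profile_deriv2 k \<sigma> t = 2 * k / hump k (t + \<sigma>) + (log_profile_deriv k \<sigma> t)\<^sup>2"

lemma DERIV_log_profile:
  assumes "hump k (t + \<sigma>) > 0"
  shows "(log_profile k \<sigma> has_real_derivative log_profile_deriv k \<sigma> t) (at t)"
  unfolding log_profile_def[abs_def] log_profile_deriv_def using assms unfolding hump_def
  by (auto intro!: derivative_eq_intros simp: field_simps)

lemma DERIV_log_profile_deriv:
  assumes "hump k (t + \<sigma>) > 0"
  shows "(log_profile_deriv k \<sigma> has_real_derivative log_profile_deriv2 k \<sigma> t) (at t)"
proof -
  have *: "((\<lambda>t. hump k (t + \<sigma>)) has_real_derivative 1 - 2 * k * (t + \<sigma>)) (at t)"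
    unfolding hump_def by (auto intro!: derivative_eq_intros)
  show ?thesis
    unfolding log_profile_deriv_def[abs_def] log_profile_deriv2_def using assms
    by (auto intro!: derivative_eq_intros * simp: field_simps power2_eq_square)
qed

text \<open>This comparison with the quadratic case is where \<open>p \<le> 2\<close> enters.\<close>

lemma powr_le_square_add_1:
  fixes s p :: real
  assumes "0 \<le> s" "0 \<le> p" "p \<le> 2"
  shows "s powr p \<le> s\<^sup>2 + 1"
proof (cases "s \<le> 1")
  case True
  then have "s powr p \<le> 1" using assms by (intro powr_le1) auto
  then show ?thesis using zero_le_power2[of s] by linarith
next
  case False
  then have "s powr p \<le> s powr 2" using assms by (intro powr_mono) auto
  then show ?thesis using False by simp
qed

lemma log_profile_strict:
  assumes p: "0 \<le> p" "p \<le> 2" and k: "1 \<le> k" "K + 1 \<le> k" and s: "0 < t + \<sigma>" "t + \<sigma> \<le> 1 / (2 * k)"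
  shows "\<bar>log_profile_deriv k \<sigma> t\<bar> powr p + K < log_profile_deriv2 k \<sigma> t"
proof -
  have pos: "hump k (t + \<sigma>) > 0" using s k by (intro hump_pos) auto
  have "hump k (t + \<sigma>) \<le> 1 / (2 * k)" using hump_le[of k "t + \<sigma>"] s k by linarith
  also have "\<dots> \<le> 1 / 2" using k by (simp add: field_simps)
  finally have "2 * k * 2 \<le> 2 * k / hump k (t + \<sigma>)" using pos k by (simp add: field_simps)
  moreover have "\<bar>log_profile_deriv k \<sigma> t\<bar> powr p \<le> \<bar>log_profile_deriv k \<sigma> t\<bar>\<^sup>2 + 1"
    using p by (intro powr_le_square_add_1) auto
  ultimately show ?thesis using k unfolding log_profile_deriv2_def by simp
qed

lemma log_profile_strict_antimono:
  assumes "0 < k" "0 < s + \<sigma>" "s < t" "t + \<sigma> \<le> 1 / (2 * k)"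
  shows "log_profile k \<sigma> t < log_profile k \<sigma> s"
proof -
  have "hump k (s + \<sigma>) < hump k (t + \<sigma>)" using assms by (intro hump_strict_mono) auto
  moreover have "hump k (s + \<sigma>) > 0" using assms by (intro hump_pos) auto
  ultimately show ?thesis by (simp add: log_profile_def)
qed

lemma log_profile_antimono:
  assumes "0 < k" "0 < s + \<sigma>" "s \<le> t" "t + \<sigma> \<le> 1 / (2 * k)"
  shows "log_profile k \<sigma> t \<le> log_profile k \<sigma> s"
  using log_profile_strict_antimono[of k s \<sigma> t] assms by (cases "s = t") auto

lemma log_barrier:
  fixes c :: "real^'n"
  assumes u: "super_jets \<Omega> p K u"
    and p: "0 \<le> p" "p \<le> 2" and k: "1 \<le> k" "K + 1 \<le> k"
    and D: "compact D" "continuous_on D u"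
    and range: "\<And>x. x \<in> D \<Longrightarrow> 0 < norm (x - c) + \<sigma> \<and> norm (x - c) + \<sigma> \<le> 1 / (2 * k)"
    and bdry: "\<And>x. x \<in> D \<Longrightarrow> b + log_profile k \<sigma> (norm (x - c)) \<le> u x \<or>
      (x \<in> \<Omega> \<and> x \<in> interior D \<and> x \<noteq> c)"
    and "x \<in> D"
  shows "b + log_profile k \<sigma> (norm (x - c)) \<le> u x"
proof (rule radial_barrier_below[OF u D, where h = "\<lambda>t. b + log_profile k \<sigma> t"
      and ?h1.0 = "log_profile_deriv k \<sigma>" and ?h2.0 = "log_profile_deriv2 k \<sigma>"])
  have pos: "hump k (norm (x - c) + \<sigma>) > 0" if "x \<in> D" for x
    using range[OF that] k by (intro hump_pos) auto
  show "continuous_on D (\<lambda>x. b + log_profile k \<sigma> (norm (x - c)))"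
    unfolding log_profile_def using pos
    by (intro continuous_intros) (auto simp: hump_def intro!: continuous_intros dest!: pos)
  fix x assume x: "x \<in> D"
  have op: "open {t. hump k (t + \<sigma>) > 0}"
    unfolding hump_def by (intro open_Collect_less continuous_intros)
  have ev: "\<forall>\<^sub>F s in nhds (norm (x - c)). ((\<lambda>t. b + log_profile k \<sigma> t) has_real_derivative log_profile_deriv k \<sigma> s) (at s)"
    using eventually_nhds_in_open[OF op, of "norm (x - c)"] pos[OF x]
  proof (simp, elim eventually_mono)
    fix s assume "hump k (s + \<sigma>) > 0"
    from DERIV_log_profile[OF this] 
    show "((\<lambda>t. b + log_profile k \<sigma> t) has_real_derivative log_profile_deriv k \<sigma> s) (at s)"
      by (auto intro!: derivative_eq_intros)
  qed
  show "b + log_profile k \<sigma> (norm (x - c)) \<le> u x \<or>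
      (x \<in> \<Omega> \<and> x \<in> interior D \<and> x \<noteq> c \<and>
       (\<forall>\<^sub>F s in nhds (norm (x - c)). ((\<lambda>t. b + log_profile k \<sigma> t) has_real_derivative log_profile_deriv k \<sigma> s) (at s)) \<and>
       (log_profile_deriv k \<sigma> has_real_derivative log_profile_deriv2 k \<sigma> (norm (x - c))) (at (norm (x - c))) \<and>
       \<bar>log_profile_deriv k \<sigma> (norm (x - c))\<bar> powr p + K < log_profile_deriv2 k \<sigma> (norm (x - c)))"
    using bdry[OF x] ev DERIV_log_profile_deriv[OF pos[OF x]] log_profile_strict[OF p k] range[OF x] by blast
qed (rule \<open>x \<in> D\<close>)

text \<open>The barrier peaks in a corner at the centre, which is exempt from the interior test because there the
comparison is a hypothesis. This is how the value of \<open>u\<close> at the centre propagates to the ball.\<close>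

lemma log_barrier_ball:
  fixes c :: "real^'n"
  assumes u: "super_jets \<Omega> p K u"
    and p: "0 \<le> p" "p \<le> 2" and k: "1 \<le> k" "K + 1 \<le> k"
    and D: "cball c r \<subseteq> \<Omega>" "continuous_on (cball c r) u"
    and \<sigma>: "0 < \<sigma>" "r + \<sigma> \<le> 1 / (2 * k)"
    and bdry: "\<And>x. norm (x - c) = r \<Longrightarrow> b + log_profile k \<sigma> r \<le> u x"
    and centre: "b + log_profile k \<sigma> 0 \<le> u c"
    and x: "norm (x - c) \<le> r"
  shows "b + log_profile k \<sigma> (norm (x - c)) \<le> u x"
proof (rule log_barrier[OF u p k compact_cball D(2)])
  fix y assume "y \<in> cball c r"
  then have ny: "norm (y - c) \<le> r" by (simp add: dist_norm norm_minus_commute)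
  then show "0 < norm (y - c) + \<sigma> \<and> norm (y - c) + \<sigma> \<le> 1 / (2 * k)"
    using \<sigma> by (auto simp: add_nonneg_pos)
  show "b + log_profile k \<sigma> (norm (y - c)) \<le> u y \<or> (y \<in> \<Omega> \<and> y \<in> interior (cball c r) \<and> y \<noteq> c)"
  proof (cases "norm (y - c) = r \<or> y = c")
    case True
    then show ?thesis using bdry centre by auto
  next
    case False
    then have "y \<in> ball c r" using ny by (simp add: dist_norm norm_minus_commute)
    moreover from this have "y \<in> \<Omega>" using D(1) ball_subset_cball by blast
    ultimately show ?thesis using False by (simp add: interior_cball)
  qed
qed (use x in \<open>simp add: dist_norm norm_minus_commute\<close>)

text \<open>The profile falls by an arbitrarily large amount over a fixed interval, because \<open>ln (hump k \<sigma>)\<close> tends to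
\<open>- \<infinity>\<close> as \<open>\<sigma>\<close> tends to \<open>0\<close> while the value at \<open>r\<close> stays bounded.\<close>

lemma log_profile_gap:
  assumes "0 < k" "0 < r" "r \<le> 1 / (4 * k)"
  obtains \<sigma> where "0 < \<sigma>" "\<sigma> \<le> 1 / (4 * k)" "M \<le> log_profile k \<sigma> 0 - log_profile k \<sigma> r"
proof -
  have hr: "0 < hump k r" using assms by (intro hump_pos) (auto simp: field_simps)
  \<comment> \<open>The second bound gives \<open>hump k \<sigma> \<le> hump k r * exp (- M)\<close>.\<close>
  define \<sigma> where "\<sigma> = min (1 / (4 * k)) (hump k r * exp (- M))"
  have \<sigma>: "0 < \<sigma>" "\<sigma> \<le> 1 / (4 * k)" "\<sigma> \<le> hump k r * exp (- M)" using assms hr by (auto simp: \<sigma>_def)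
  have sum: "r + \<sigma> \<le> 1 / (2 * k)" using \<sigma> assms by (simp add: field_simps)
  have h\<sigma>: "0 < hump k \<sigma>" using assms \<sigma> by (intro hump_pos) (auto simp: field_simps)
  have "hump k r \<le> hump k (r + \<sigma>)" using hump_strict_mono[of k r "r + \<sigma>"] assms \<sigma> sum by simp
  moreover have "hump k \<sigma> \<le> hump k r * exp (- M)" using hump_le[of k \<sigma>] assms \<sigma> by simp
  ultimately have "hump k \<sigma> * exp M \<le> hump k (r + \<sigma>)"
  proof -
    assume a: "hump k r \<le> hump k (r + \<sigma>)" "hump k \<sigma> \<le> hump k r * exp (- M)"
    have "hump k \<sigma> * exp M \<le> hump k r * exp (- M) * exp M" using a by (intro mult_right_mono) auto
    also have "\<dots> = hump k r" by (simp add: exp_minus)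
    finally show ?thesis using a by simp
  qed
  then have "ln (hump k \<sigma> * exp M) \<le> ln (hump k (r + \<sigma>))" using h\<sigma> by (intro ln_mono) auto
  then have "M \<le> log_profile k \<sigma> 0 - log_profile k \<sigma> r"
    using h\<sigma> by (simp add: log_profile_def ln_mult)
  then show ?thesis using \<sigma> that by blast
qed

lemma log_profile_drop_le:
  assumes "0 < k" "0 < \<sigma>" "0 \<le> t" "t + \<sigma> \<le> 1 / (2 * k)"
  shows "log_profile k \<sigma> 0 - log_profile k \<sigma> t \<le> t / hump k \<sigma>"
proof -
  have h\<sigma>: "0 < hump k \<sigma>" and ht: "0 < hump k (t + \<sigma>)" using assms by (auto intro!: hump_pos)
  have "log_profile k \<sigma> 0 - log_profile k \<sigma> t = ln (hump k (t + \<sigma>) / hump k \<sigma>)"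
    using h\<sigma> ht by (simp add: log_profile_def ln_div)
  also have "\<dots> \<le> hump k (t + \<sigma>) / hump k \<sigma> - 1" using h\<sigma> ht by (intro ln_le_minus_one) simp
  also have "\<dots> = (hump k (t + \<sigma>) - hump k \<sigma>) / hump k \<sigma>" using h\<sigma> by (simp add: field_simps)
  also have "\<dots> \<le> t / hump k \<sigma>"
  proof (intro divide_right_mono)
    have "k * \<sigma>\<^sup>2 \<le> k * (t + \<sigma>)\<^sup>2" using assms by (intro mult_left_mono power_mono) auto
    then show "hump k (t + \<sigma>) - hump k \<sigma> \<le> t" by (simp add: hump_def)
  qed (use h\<sigma> in simp)
  finally show ?thesis .
qed

text \<open>If \<open>u\<close> oscillates by at most \<open>M\<close>, a log barrier centred at \<open>c\<close> whose drop exceeds \<open>M\<close> lies below \<open>u\<close> on the sphere and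
at \<open>c\<close>, hence below \<open>u\<close> in the ball, and its slope at \<open>c\<close> is finite. The constant depends on \<open>M\<close> and \<open>r\<close>
but not on the function or the domain.\<close>

lemma super_jets_lipschitz:
  fixes p K k r M :: real
  assumes p: "0 \<le> p" "p \<le> 2" and k: "1 \<le> k" "K + 1 \<le> k" and r: "0 < r" "r \<le> 1 / (4 * k)"
  obtains L where "0 < L"
    "\<And>\<Omega> u c x. super_jets \<Omega> p K u \<Longrightarrow> cball c r \<subseteq> \<Omega> \<Longrightarrow> continuous_on (cball c r) u \<Longrightarrow>
      (\<And>y. y \<in> cball c r \<Longrightarrow> u c - M \<le> u y) \<Longrightarrow> x \<in> cball c r \<Longrightarrow> u c - L * norm (x - c) \<le> u (x::real^'n)"
proof -
  obtain \<sigma> where \<sigma>: "0 < \<sigma>" "\<sigma> \<le> 1 / (4 * k)" "M \<le> log_profile k \<sigma> 0 - log_profile k \<sigma> r"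
    using log_profile_gap[of k r M] k r by auto
  have sum: "r + \<sigma> \<le> 1 / (2 * k)" using \<sigma> r k by (simp add: field_simps)
  have h\<sigma>: "0 < hump k \<sigma>" using k \<sigma> by (intro hump_pos) (auto simp: field_simps)
  show ?thesis
  proof (rule that[of "1 / hump k \<sigma>"])
    fix \<Omega> u and c x :: "real^'n"
    assume u: "super_jets \<Omega> p K u" "cball c r \<subseteq> \<Omega>" "continuous_on (cball c r) u"
      and M: "\<And>y. y \<in> cball c r \<Longrightarrow> u c - M \<le> u y" and x: "x \<in> cball c r"
    have nx: "norm (x - c) \<le> r" using x by (simp add: dist_norm norm_minus_commute)
    have "(u c - log_profile k \<sigma> 0) + log_profile k \<sigma> (norm (x - c)) \<le> u x"
    proof (rule log_barrier_ball[OF u(1) p k u(2,3) \<sigma>(1) sum])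
      fix y assume "norm (y - c) = r"
      then show "(u c - log_profile k \<sigma> 0) + log_profile k \<sigma> r \<le> u y"
        using M[of y] \<sigma>(3) by (simp add: dist_norm norm_minus_commute)
    qed (use nx in auto)
    moreover have "log_profile k \<sigma> 0 - log_profile k \<sigma> (norm (x - c)) \<le> norm (x - c) / hump k \<sigma>"
      using k \<sigma> sum nx by (intro log_profile_drop_le) auto
    ultimately show "u c - 1 / hump k \<sigma> * norm (x - c) \<le> u x" by simp
  qed (use h\<sigma> in simp)
qed

text \<open>If \<open>u c\<close> exceeded the total drop of the profile, the barrier vanishing on the sphere of radius \<open>r\<close> would lie below \<open>u\<close> in
the whole ball; it is positive inside, which contradicts the zero at \<open>x\<close>.\<close>

lemma super_jets_peak_bound:
  fixes c x :: "real^'n"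
  assumes p: "0 \<le> p" "p \<le> 2" and k: "1 \<le> k" "K + 1 \<le> k" and r: "0 < r" "r \<le> 1 / (4 * k)"
    and u: "super_jets \<Omega> p K u" "cball c r \<subseteq> \<Omega>" "continuous_on (cball c r) u"
    and nonneg: "\<And>y. y \<in> cball c r \<Longrightarrow> 0 \<le> u y" and x: "norm (x - c) < r" "u x \<le> 0"
  shows "u c \<le> log_profile k r 0 - log_profile k r r"
proof (rule ccontr)
  assume big: "\<not> u c \<le> log_profile k r 0 - log_profile k r r"
  have sum: "r + r \<le> 1 / (2 * k)" using r k by (simp add: field_simps)
  have "- log_profile k r r + log_profile k r (norm (x - c)) \<le> u x"
    by (rule log_barrier_ball[OF u(1) p k u(2,3) r(1) sum])
      (use big nonneg x in \<open>auto simp: dist_norm norm_minus_commute\<close>)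
  moreover have "log_profile k r r < log_profile k r (norm (x - c))"
    using k r x sum by (intro log_profile_strict_antimono) (auto simp: add_nonneg_pos)
  ultimately show False using x by simp
qed

text \<open>Here the profile starts on the surface of an exterior ball of radius \<open>r\<close>, so its argument is
\<open>norm (x - z) - r\<close>. Only the part of the annulus inside \<open>\<Omega>\<close> is used; there the barrier is compared with the lower
bound of \<open>u\<close> on the outer sphere and with the boundary values on the rest.\<close>

lemma super_jets_boundary_barrier:
  fixes z :: "real^'n"
  assumes p: "0 \<le> p" "p \<le> 2" and k: "1 \<le> k" "K + 1 \<le> k" and r: "0 < r"
    and \<delta>: "0 < \<delta>" "\<delta> \<le> 1 / (4 * k)" and \<sigma>: "0 < \<sigma>" "\<sigma> \<le> 1 / (4 * k)"
    and \<Omega>: "open \<Omega>" "bounded \<Omega>" and ext: "\<And>x. x \<in> \<Omega> \<Longrightarrow> r \<le> norm (x - z)"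
    and u: "super_jets \<Omega> p K u" "continuous_on (closure \<Omega>) u"
    and low: "\<And>x. x \<in> closure \<Omega> \<Longrightarrow> b + log_profile k \<sigma> \<delta> \<le> u x"
    and bdry: "\<And>x. x \<in> frontier \<Omega> \<Longrightarrow> b + log_profile k \<sigma> 0 \<le> u x"
    and x: "x \<in> closure \<Omega>" "norm (x - z) \<le> r + \<delta>"
  shows "b + log_profile k \<sigma> (norm (x - z) - r) \<le> u x"
proof -
  have shift: "log_profile k (\<sigma> - r) t = log_profile k \<sigma> (t - r)" for t
    by (simp add: log_profile_def algebra_simps)
  have sum: "\<delta> + \<sigma> \<le> 1 / (2 * k)" using \<delta> \<sigma> k by (simp add: field_simps)
  define D where "D = closure \<Omega> \<inter> cball z (r + \<delta>)"
  have ext': "r \<le> norm (y - z)" if "y \<in> closure \<Omega>" for y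
  proof -
    have "closed {y. r \<le> norm (y - z)}" by (intro closed_Collect_le continuous_intros)
    then have "closure \<Omega> \<subseteq> {y. r \<le> norm (y - z)}" using ext by (intro closure_minimal) auto
    then show ?thesis using that by auto
  qed
  have inD: "y \<in> interior D" if "y \<in> \<Omega>" "norm (y - z) < r + \<delta>" for y
  proof (rule interiorI[of "\<Omega> \<inter> ball z (r + \<delta>)"])
    show "\<Omega> \<inter> ball z (r + \<delta>) \<subseteq> D" using closure_subset[of \<Omega>] ball_subset_cball[of z "r + \<delta>"] unfolding D_def by blast
  qed (use that \<Omega> in \<open>auto simp: dist_norm norm_minus_commute\<close>)
  have "b + log_profile k (\<sigma> - r) (norm (x - z)) \<le> u x"
  proof (rule log_barrier[OF u(1) p k])
    show "compact D" unfolding D_def using \<Omega> by (intro compact_Int_closed) auto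
    show "continuous_on D u" using u(2) by (rule continuous_on_subset) (auto simp: D_def)
    show "x \<in> D" using x by (simp add: D_def dist_norm norm_minus_commute)
    fix y assume "y \<in> D"
    then have y: "y \<in> closure \<Omega>" "norm (y - z) \<le> r + \<delta>" "r \<le> norm (y - z)"
      using ext' by (auto simp: D_def dist_norm norm_minus_commute)
    show "0 < norm (y - z) + (\<sigma> - r) \<and> norm (y - z) + (\<sigma> - r) \<le> 1 / (2 * k)"
      using y \<sigma> sum by auto
    consider "norm (y - z) = r + \<delta>" | "y \<in> frontier \<Omega>" | "norm (y - z) < r + \<delta>" "y \<in> \<Omega>"
      using y \<Omega>(1) by (fastforce simp: frontier_def interior_open)
    then show "b + log_profile k (\<sigma> - r) (norm (y - z)) \<le> u y \<or> (y \<in> \<Omega> \<and> y \<in> interior D \<and> y \<noteq> z)"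
    proof cases
      case 1
      then show ?thesis using low[OF y(1)] by (simp add: shift)
    next
      case 2
      have "log_profile k \<sigma> (norm (y - z) - r) \<le> log_profile k \<sigma> 0"
        using k y \<sigma> sum by (intro log_profile_antimono) auto
      then show ?thesis using bdry[OF 2] by (simp add: shift)
    next
      case 3
      then show ?thesis using inD[of y] y r by auto
    qed
  qed
  then show ?thesis by (simp add: shift)
qed

text \<open>For \<open>p > 1\<close> a large slope makes the gradient term win over every curvature term that is
linear in the slope.\<close>

section \<open>Barriers for subsolutions\<close>

lemma superlinear_slope_exists:
  fixes p :: real
  assumes "1 < p"
  obtains B where "1 \<le> B" "B * c + K < B powr p"
proof
  define B where "B = max 1 ((\<bar>c\<bar> + \<bar>K\<bar> + 1) powr (1 / (p - 1)))"
  show B1: "1 \<le> B" by (simp add: B_def)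
  have "\<bar>c\<bar> + \<bar>K\<bar> + 1 = ((\<bar>c\<bar> + \<bar>K\<bar> + 1) powr (1 / (p - 1))) powr (p - 1)"
    using assms by (simp add: powr_powr)
  also have "\<dots> \<le> B powr (p - 1)" using assms by (intro powr_mono2) (auto simp: B_def)
  finally have "B * (\<bar>c\<bar> + \<bar>K\<bar> + 1) \<le> B * B powr (p - 1)" using B1 by (intro mult_left_mono) auto
  also have "B * B powr (p - 1) = B powr p" using B1 by (simp add: powr_diff)
  finally have "B * \<bar>c\<bar> + B * \<bar>K\<bar> + B \<le> B powr p" by (simp add: algebra_simps)
  moreover have "B * c \<le> B * \<bar>c\<bar>" using B1 by (intro mult_left_mono) auto
  moreover have "K \<le> B * \<bar>K\<bar>" using B1 mult_right_mono[of 1 B "\<bar>K\<bar>"] by auto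
  ultimately show "B * c + K < B powr p" using B1 by linarith
qed

text \<open>For \<open>L * (norm (x - z) - r)\<close> the tangential curvature is at most \<open>L / r\<close>, which the gradient term beats for
steep slopes.\<close>

lemma sub_jets_boundary_barrier:
  fixes z :: "real^'n"
  assumes L: "0 < L" "L / r + K < L powr p" and r: "0 < r"
    and \<Omega>: "open \<Omega>" "bounded \<Omega>" and ext: "\<And>x. x \<in> \<Omega> \<Longrightarrow> r \<le> norm (x - z)"
    and u: "sub_jets \<Omega> p K u" "continuous_on (closure \<Omega>) u"
    and bdry: "\<And>x. x \<in> frontier \<Omega> \<Longrightarrow> u x \<le> 0"
    and x: "x \<in> closure \<Omega>"
  shows "u x \<le> L * (norm (x - z) - r)"
proof (rule radial_barrier_above[OF u(1) _ u(2), where ?h1.0 = "\<lambda>_. L" and ?h2.0 = "\<lambda>_. 0"])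
  have ext': "r \<le> norm (y - z)" if "y \<in> closure \<Omega>" for y
  proof -
    have "closed {y. r \<le> norm (y - z)}" by (intro closed_Collect_le continuous_intros)
    then have "closure \<Omega> \<subseteq> {y. r \<le> norm (y - z)}" using ext by (intro closure_minimal) auto
    then show ?thesis using that by auto
  qed
  show "compact (closure \<Omega>)" using \<Omega> by simp
  show "continuous_on (closure \<Omega>) (\<lambda>x. L * (norm (x - z) - r))" by (intro continuous_intros)
  fix y assume y: "y \<in> closure \<Omega>"
  show "u y \<le> L * (norm (y - z) - r) \<or>
    (y \<in> \<Omega> \<and> y \<in> interior (closure \<Omega>) \<and> y \<noteq> z \<and>
     (\<forall>\<^sub>F s in nhds (norm (y - z)). ((\<lambda>t. L * (t - r)) has_real_derivative L) (at s)) \<and>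
     ((\<lambda>_. L) has_real_derivative 0) (at (norm (y - z))) \<and>
     max (L / norm (y - z)) 0 + K < \<bar>L\<bar> powr p)"
  proof (cases "y \<in> \<Omega>")
    case True
    have "0 < norm (y - z) * r" using ext[OF True] r by (intro mult_pos_pos) linarith+
    then have "L / norm (y - z) \<le> L / r" using ext[OF True] L by (intro divide_left_mono) auto
    moreover have "0 < L / r" using L r by simp
    ultimately have "max (L / norm (y - z)) 0 + K < \<bar>L\<bar> powr p" using L by simp
    moreover have "\<forall>\<^sub>F s in nhds (norm (y - z)). ((\<lambda>t. L * (t - r)) has_real_derivative L) (at s)"
      by (intro always_eventually allI) (auto intro!: derivative_eq_intros)
    moreover have "y \<in> interior (closure \<Omega>)"
      using True \<Omega>(1) closure_subset by (meson interiorI)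
    ultimately show ?thesis using True ext[OF True] r by auto
  next
    case False
    then have "y \<in> frontier \<Omega>" using y \<Omega>(1) by (simp add: frontier_def interior_open)
    then show ?thesis using bdry[of y] ext'[OF y] L by (simp add: order_trans[of "u y" 0])
  qed
qed (rule x)

text \<open>With \<open>a = 1 / (p - 1)\<close> the \<open>p\<close>-th power of the first derivative of \<open>\<tau> powr (- a)\<close> blows up at least as fast
as its second derivative.\<close>

lemma blowup_powr_ge:
  fixes \<tau> p :: real
  assumes "1 < p" "0 < \<tau>" "\<tau> \<le> 1"
  shows "\<tau> powr (- 1 / (p - 1) - 2) \<le> (\<tau> powr (- 1 / (p - 1) - 1)) powr p"
proof -
  have "(- 1 / (p - 1) - 1) * p \<le> - 1 / (p - 1) - 2"
  proof -
    define q where "q = p - 1"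
    have q: "p = q + 1" "0 < q" using assms(1) by (auto simp: q_def)
    have "(- 1 / q - 2) - (- 1 / q - 1) * (q + 1) = q"
      using q(2) by (simp add: field_simps)
    then have "(- 1 / (p - 1) - 2) - (- 1 / (p - 1) - 1) * p = p - 1" by (simp add: q(1))
    then show ?thesis using assms(1) by linarith
  qed
  then have "\<tau> powr (- 1 / (p - 1) - 2) \<le> \<tau> powr ((- 1 / (p - 1) - 1) * p)"
    using assms by (intro powr_mono') auto
  then show ?thesis by (simp add: powr_powr)
qed

text \<open>The barrier is infinite on the sphere of radius \<open>R\<close>, so no information about \<open>u\<close> near that sphere enters
the bound: an upper bound on a small sphere alone controls \<open>u\<close> in the larger ball, uniformly over all
subsolutions.\<close>

lemma sub_jets_interior_barrier:
  fixes c :: "real^'n"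
  assumes p: "1 < p" and K: "0 \<le> K" and s: "0 < s" and R: "R \<le> 1"
    and a: "a = 1 / (p - 1)"
    and B: "1 \<le> B" "B * (1 / s + a + 1) + K < B powr p"
    and u: "sub_jets \<Omega> p K u" "cball c R \<subseteq> \<Omega>" "continuous_on (cball c R) u"
    and M: "\<And>y. norm (y - c) = s \<Longrightarrow> u y \<le> M"
    and x: "s \<le> norm (x - c)" "norm (x - c) < R"
  shows "u x \<le> M + B / a * (R - norm (x - c)) powr (- a)"
proof -
  have a0: "a > 0" using a p by simp
  obtain W where W: "\<And>y. y \<in> cball c R \<Longrightarrow> u y \<le> W"
  proof -
    have "bounded (u ` cball c R)" using u(3) by (intro compact_imp_bounded compact_continuous_image) auto
    then obtain W where "\<forall>v\<in>u ` cball c R. \<bar>v\<bar> \<le> W" unfolding bounded_iff real_norm_def ..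
    then show ?thesis using that[of W] by (meson abs_le_D1 imageI)
  qed
  define V where "V = max 1 (a * (W - M) / B)"
  have V1: "1 \<le> V" by (simp add: V_def)
  \<comment> \<open>The comparison is made on the ball of radius \<open>R - \<tau>\<close>, with \<open>\<tau>\<close> so small that the barrier exceeds
    the maximum \<open>W\<close> of \<open>u\<close> on its boundary. The conclusion does not involve \<open>W\<close>.\<close>
  define \<tau> where "\<tau> = min ((R - norm (x - c)) / 2) (V powr (- 1 / a))"
  have \<tau>: "0 < \<tau>" "\<tau> < R - norm (x - c)" using x V1 by (auto simp: \<tau>_def min_def)
  have "V = (V powr (- 1 / a)) powr (- a)" using V1 a0 by (simp add: powr_powr)
  also have "\<dots> \<le> \<tau> powr (- a)" using \<tau> a0 by (intro powr_mono2') (auto simp: \<tau>_def)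
  finally have "a * (W - M) / B \<le> \<tau> powr (- a)" by (simp add: V_def)
  then have top: "W \<le> M + B / a * \<tau> powr (- a)" using a0 B by (simp add: field_simps)
  define D where "D = cball c (R - \<tau>) - ball c s"
  define h where "h t = M + B / a * (R - t) powr (- a)" for t
  define h1 where "h1 t = B * (R - t) powr (- a - 1)" for t
  define h2 where "h2 t = B * (a + 1) * (R - t) powr (- a - 2)" for t
  have inR: "norm (y - c) < R" "s \<le> norm (y - c)" "y \<in> cball c R" if "y \<in> D" for y
    using that \<tau> by (auto simp: D_def dist_norm norm_minus_commute)
  have "u x \<le> h (norm (x - c))"
  proof (rule radial_barrier_above[OF u(1)])
    show "compact D" unfolding D_def by (intro compact_diff) auto
    show "continuous_on D u" by (rule continuous_on_subset[OF u(3)]) (use inR(3) in blast)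
    show "continuous_on D (\<lambda>x. h (norm (x - c)))"
      unfolding h_def using inR(1) by (intro continuous_intros) force+
    show "x \<in> D" using x \<tau> by (auto simp: D_def dist_norm norm_minus_commute)
    fix y assume y: "y \<in> D"
    let ?t = "norm (y - c)"
    consider "?t = R - \<tau>" | "?t = s" | "s < ?t" "?t < R - \<tau>"
      using y by (fastforce simp: D_def dist_norm norm_minus_commute)
    then show "u y \<le> h ?t \<or> (y \<in> \<Omega> \<and> y \<in> interior D \<and> y \<noteq> c \<and>
       (\<forall>\<^sub>F s in nhds ?t. (h has_real_derivative h1 s) (at s)) \<and>
       (h1 has_real_derivative h2 ?t) (at ?t) \<and> max (h1 ?t / ?t) (h2 ?t) + K < \<bar>h1 ?t\<bar> powr p)"
    proof cases
      case 1
      then show ?thesis using W[OF inR(3)[OF y]] top by (simp add: h_def)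
    next
      case 2
      have "0 \<le> B / a * (R - ?t) powr (- a)" using a0 B by simp
      then show ?thesis using M[OF 2] by (simp add: h_def)
    next
      case 3
      define \<rho> where "\<rho> = R - ?t"
      have \<rho>: "0 < \<rho>" "\<rho> \<le> 1" using inR[OF y] R s by (auto simp: \<rho>_def)
      have "y \<in> \<Omega>" using inR(3)[OF y] u(2) by auto
      moreover have "y \<in> interior D"
      proof (rule interiorI[of "ball c (R - \<tau>) - cball c s"])
        show "ball c (R - \<tau>) - cball c s \<subseteq> D" by (auto simp: D_def)
      qed (use 3 in \<open>auto simp: dist_norm norm_minus_commute\<close>)
      moreover have "y \<noteq> c" using 3 s by auto
      moreover have "\<forall>\<^sub>F s in nhds ?t. (h has_real_derivative h1 s) (at s)"
      proof -
        have "\<forall>\<^sub>F t in nhds ?t. t < R"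
          using eventually_nhds_in_open[of "{..<R}" ?t] inR(1)[OF y] by simp
        then show ?thesis
        proof eventually_elim
          case (elim t)
          then show ?case unfolding h_def h1_def using a0
            by (auto intro!: derivative_eq_intros simp: field_simps)
        qed
      qed
      moreover have "(h1 has_real_derivative h2 ?t) (at ?t)"
        unfolding h1_def h2_def using inR(1)[OF y]
        by (auto intro!: derivative_eq_intros simp: algebra_simps)
      moreover have "max (h1 ?t / ?t) (h2 ?t) + K < \<bar>h1 ?t\<bar> powr p"
      proof -
        define q where "q = \<rho> powr (- a - 2)"
        have q1: "1 \<le> q"
          using \<rho> a0 powr_mono2'[of "- a - 2" \<rho> 1] by (simp add: q_def)
        have "\<rho> powr (- a - 1) \<le> q" unfolding q_def using \<rho> by (intro powr_mono') auto
        moreover have "0 \<le> B * q" using B q1 by simp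
        ultimately have "h1 ?t / ?t \<le> B * q / s"
          using B 3 s unfolding h1_def \<rho>_def[symmetric] by (intro frac_le mult_left_mono) auto
        moreover have "h2 ?t = B * (a + 1) * q" by (simp add: h2_def q_def \<rho>_def)
        moreover have "0 \<le> B * q / s" "0 \<le> B * (a + 1) * q" using B q1 s a0 by auto
        ultimately have "max (h1 ?t / ?t) (h2 ?t) + K \<le> B * q / s + B * (a + 1) * q + K * q"
          using mult_left_mono[OF q1 K] by (simp add: max_def)
        also have "\<dots> = (B * (1 / s + a + 1) + K) * q" by (simp add: algebra_simps)
        also have "\<dots> < B powr p * q" using B q1 by (intro mult_strict_right_mono) auto
        also have "\<dots> \<le> B powr p * (\<rho> powr (- a - 1)) powr p"
          using blowup_powr_ge[OF p \<rho>] unfolding q_def a by (intro mult_left_mono) auto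
        also have "\<dots> = \<bar>h1 ?t\<bar> powr p"
          using B by (simp add: h1_def \<rho>_def powr_mult)
        finally show ?thesis .
      qed
      ultimately show ?thesis by blast
    qed
  qed
  then show ?thesis by (simp add: h_def)
qed

text \<open>Near \<open>x1\<close> the domain lies above the graph of \<open>g\<close>, hence above a downward paraboloid touching it at \<open>x1\<close>. A ball whose
curvature exceeds that of the paraboloid, and which is small enough to see only the local
description of \<open>\<Omega>\<close>, stays outside.\<close>

section \<open>Exterior balls\<close>

lemma exterior_ball:
  fixes \<Omega> :: "(real^'n) set"
  assumes \<Omega>: "C2_boundary \<Omega>" "open \<Omega>" and x1: "x1 \<in> frontier \<Omega>"
  obtains z r where "0 < r" "norm (x1 - z) = r" "\<And>x. x \<in> \<Omega> \<Longrightarrow> r \<le> norm (x - z)"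
proof -
  obtain R k s g where R: "R > 0" and s: "s \<in> {-1, 1::real}" and g: "C2_on UNIV g"
    and inv: "\<And>x t. g (x + t *\<^sub>R axis k 1) = g x"
    and loc: "\<Omega> \<inter> ball x1 R = {x \<in> ball x1 R. s * x $ k > g x}"
    using \<Omega>(1) x1 unfolding C2_boundary_def by meson
  define G where "G = gradient g x1"
  define H where "H = hessian g x1"
  have "((\<lambda>t. g (x1 + t *\<^sub>R axis k 1)) has_real_derivative G \<bullet> axis k 1) (at 0)"
    using eventually_nhds_x_imp_x[OF C2_on_derivatives(1)[OF g, of x1]]
    by (intro has_derivative_along_line) (simp add: G_def)
  then have "((\<lambda>t. g x1) has_real_derivative G \<bullet> axis k 1) (at 0)" by (simp add: inv)
  then have Gk: "G $ k = 0" using DERIV_unique[OF _ DERIV_const] by (metis cart_eq_inner_axis)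
  define n where "n = s *\<^sub>R axis k 1 - G"
  have "n $ k = s" by (simp add: n_def Gk)
  then have n0: "0 < norm n" using s by auto
  have nd: "n \<bullet> d = s * d $ k - G \<bullet> d" for d
    by (simp add: n_def inner_diff_left cart_eq_inner_axis inner_commute[of "axis k 1"])
  define C where "C = onorm (\<lambda>h. H *v h) + 1"
  have C1: "1 \<le> C" using onorm_pos_le[OF matrix_vector_mul_bounded_linear[of H]] by (simp add: C_def)
  have "\<forall>\<^sub>F y in nhds x1. \<bar>g y - g x1 - quad x1 G H y\<bar> \<le> 1 * (norm (y - x1))\<^sup>2"
    unfolding G_def H_def by (rule C2_on_Taylor[OF g]) auto
  then obtain \<eta>0 where \<eta>0: "\<eta>0 > 0"
    "\<And>y. dist y x1 < \<eta>0 \<Longrightarrow> \<bar>g y - g x1 - quad x1 G H y\<bar> \<le> (norm (y - x1))\<^sup>2"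
    by (auto simp: eventually_nhds_metric)
  define \<eta> where "\<eta> = min \<eta>0 R"
  have \<eta>: "\<eta> > 0" using \<eta>0 R by (simp add: \<eta>_def)
  have "x1 \<notin> \<Omega>" using x1 \<Omega>(2) by (simp add: frontier_def interior_open)
  then have gx1: "s * x1 $ k \<le> g x1" using loc R by fastforce
  have below: "- C * (norm (x - x1))\<^sup>2 \<le> n \<bullet> (x - x1)" if x: "x \<in> \<Omega>" "norm (x - x1) < \<eta>" for x
  proof -
    have "dist x x1 < \<eta>0" "x \<in> ball x1 R" using x by (auto simp: \<eta>_def dist_norm norm_minus_commute)
    then have 1: "g x < s * x $ k" and 2: "\<bar>g x - g x1 - quad x1 G H x\<bar> \<le> (norm (x - x1))\<^sup>2"
      using loc x(1) \<eta>0(2) by blast+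
    have "\<bar>(x - x1) \<bullet> (H *v (x - x1))\<bar> \<le> norm (x - x1) * norm (H *v (x - x1))"
      by (rule Cauchy_Schwarz_ineq2)
    also have "\<dots> \<le> norm (x - x1) * (onorm (\<lambda>h. H *v h) * norm (x - x1))"
      by (intro mult_left_mono onorm matrix_vector_mul_bounded_linear) auto
    also have "\<dots> = (C - 1) * (norm (x - x1))\<^sup>2" by (simp add: C_def power2_eq_square)
    finally have 3: "\<bar>(x - x1) \<bullet> (H *v (x - x1))\<bar> \<le> (C - 1) * (norm (x - x1))\<^sup>2" .
    have "0 \<le> (C - 1) * (norm (x - x1))\<^sup>2" using C1 by simp
    moreover have "C * (norm (x - x1))\<^sup>2 = (C - 1) * (norm (x - x1))\<^sup>2 + (norm (x - x1))\<^sup>2"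
      by (simp add: algebra_simps)
    ultimately have "g x1 + G \<bullet> (x - x1) - C * (norm (x - x1))\<^sup>2 \<le> g x"
      using 2 3 unfolding quad_def by linarith
    then have "- C * (norm (x - x1))\<^sup>2 \<le> (s * x $ k - s * x1 $ k) - G \<bullet> (x - x1)"
      using 1 gx1 by linarith
    then show ?thesis by (simp add: nd right_diff_distrib)
  qed
  \<comment> \<open>The first bound makes the ball more curved than the paraboloid, the second keeps points outside
    the local description at distance at least \<open>r\<close> from \<open>z\<close>.\<close>
  define r where "r = min (norm n / (2 * C)) (\<eta> / 2)"
  have r: "0 < r" "2 * r * C \<le> norm n" "2 * r \<le> \<eta>"
  proof -
    show "0 < r" using n0 C1 \<eta> by (simp add: r_def)
    have "r \<le> norm n / (2 * C)" by (simp add: r_def)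
    then show "2 * r * C \<le> norm n" using C1 by (simp add: field_simps)
    show "2 * r \<le> \<eta>" by (simp add: r_def)
  qed
  define \<nu> where "\<nu> = n /\<^sub>R norm n"
  have \<nu>: "norm \<nu> = 1" using n0 by (simp add: \<nu>_def)
  define z where "z = x1 - r *\<^sub>R \<nu>"
  have "norm (x1 - z) = r" using \<nu> r by (simp add: z_def)
  moreover have "r \<le> norm (x - z)" if x: "x \<in> \<Omega>" for x
  proof (cases "norm (x - x1) < \<eta>")
    case True
    define d where "d = x - x1"
    have xz: "x - z = d + r *\<^sub>R \<nu>" by (simp add: z_def d_def)
    have expand: "(d + r *\<^sub>R \<nu>) \<bullet> (d + r *\<^sub>R \<nu>) = d \<bullet> d + 2 * r * (\<nu> \<bullet> d) + r * (r * (\<nu> \<bullet> \<nu>))"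
      by (simp add: inner_add_left inner_add_right inner_commute[of d \<nu>] distrib_left)
    have "(norm (x - z))\<^sup>2 = (norm d)\<^sup>2 + 2 * r * (\<nu> \<bullet> d) + r\<^sup>2 * (norm \<nu>)\<^sup>2"
      unfolding xz power2_norm_eq_inner expand by (simp add: power2_eq_square)
    moreover have "0 \<le> (norm d)\<^sup>2 + 2 * r * (\<nu> \<bullet> d)"
    proof -
      have "2 * r * (- C * (norm d)\<^sup>2) \<le> 2 * r * (n \<bullet> d)"
        using below[OF x True] r by (intro mult_left_mono) (auto simp: d_def)
      moreover have "(2 * r * C) * (norm d)\<^sup>2 \<le> norm n * (norm d)\<^sup>2"
        using r by (intro mult_right_mono) auto
      moreover have "2 * r * (- C * (norm d)\<^sup>2) = - ((2 * r * C) * (norm d)\<^sup>2)" by (simp add: mult.assoc)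
      ultimately have "0 \<le> norm n * (norm d)\<^sup>2 + 2 * r * (n \<bullet> d)" by linarith
      also have "\<dots> = norm n * ((norm d)\<^sup>2 + 2 * r * (\<nu> \<bullet> d))"
        using n0 by (simp add: \<nu>_def algebra_simps)
      finally show ?thesis using n0 by (simp add: zero_le_mult_iff)
    qed
    ultimately have "r\<^sup>2 \<le> (norm (x - z))\<^sup>2" using \<nu> by simp
    then show ?thesis by (rule power2_le_imp_le) simp
  next
    case False
    have "x - z = (x - x1) + r *\<^sub>R \<nu>" by (simp add: z_def)
    then have "norm (x - x1) - norm (r *\<^sub>R \<nu>) \<le> norm (x - z)" by (metis norm_diff_ineq)
    then show ?thesis using False r \<nu> by simp
  qed
  ultimately show ?thesis using r(1) that by blast
qed

section \<open>Compactness and stability\<close>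

text \<open>A diagonal argument makes a subsequence converge on a countable dense set; the local Lipschitz bounds extend
this to locally uniform convergence. Bounds are required only eventually, because they come from asymptotic
arguments.\<close>

lemma locally_lipschitz_subsequence:
  fixes F :: "nat \<Rightarrow> 'a::euclidean_space \<Rightarrow> real"
  assumes "open \<Omega>"
    and loc: "\<And>y. y \<in> \<Omega> \<Longrightarrow> \<exists>\<rho>>0. \<exists>M L. ball y \<rho> \<subseteq> \<Omega> \<and>
      (\<forall>\<^sub>F n in sequentially. (\<forall>x\<in>ball y \<rho>. \<bar>F n x\<bar> \<le> M) \<and>
        (\<forall>x\<in>ball y \<rho>. \<forall>x'\<in>ball y \<rho>. \<bar>F n x - F n x'\<bar> \<le> L * norm (x - x')))"
  obtains k v where "strict_mono (k :: nat \<Rightarrow> nat)" "continuous_on \<Omega> v"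
    "locally_uniform_limit \<Omega> (\<lambda>n. F (k n)) v"
proof -
  obtain D :: "'a set" where D: "countable D" "\<And>X. open X \<Longrightarrow> X \<noteq> {} \<Longrightarrow> \<exists>d\<in>D. d \<in> X"
    using countable_dense_setE by blast
  define S where "S = D \<inter> \<Omega>"
  have "\<exists>M. \<forall>n. \<bar>F n x\<bar> \<le> M" if xin: "x \<in> \<Omega>" for x
  proof -
    obtain \<rho> M where \<rho>: "\<rho> > 0" and "\<forall>\<^sub>F n in sequentially. \<forall>x\<in>ball x \<rho>. \<bar>F n x\<bar> \<le> M"
      using loc[OF xin] by (fastforce simp: eventually_conj_iff)
    then have "\<forall>\<^sub>F n in sequentially. \<bar>F n x\<bar> \<le> M" by (auto elim: eventually_mono)
    then have "bounded (range (\<lambda>n. F n x))"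
      by (intro Bseq_eq_bounded[THEN iffD1] BfunI[of _ M]) auto
    then show ?thesis by (auto simp: bounded_iff)
  qed
  then obtain M where M: "\<And>x n. x \<in> \<Omega> \<Longrightarrow> \<bar>F n x\<bar> \<le> M x" by metis
  have M0: "0 \<le> M x" if "x \<in> \<Omega>" for x using M[OF that, of 0] by linarith
  \<comment> \<open>Dividing by a bound that depends on the point makes the family uniformly bounded.\<close>
  have "norm (F n x / (1 + M x)) \<le> 1" if "x \<in> S" for n x
    using M[of x n] M0[of x] that by (simp add: S_def abs_le_iff field_simps)
  then obtain k where k: "strict_mono (k :: nat \<Rightarrow> nat)"
      and kl: "\<And>x. x \<in> S \<Longrightarrow> \<exists>l. (\<lambda>n. F (k n) x / (1 + M x)) \<longlonglongrightarrow> l"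
    using function_convergent_subsequence[of S "\<lambda>n x. F n x / (1 + M x)" 1] D(1)
    unfolding S_def by (metis countable_Int1)
  have convS: "convergent (\<lambda>n. F (k n) x)" if xS: "x \<in> S" for x
  proof -
    obtain l where "(\<lambda>n. F (k n) x / (1 + M x)) \<longlonglongrightarrow> l" using kl[OF xS] ..
    from tendsto_mult_left[OF this, of "1 + M x"] show ?thesis
      using M0[of x] xS by (auto simp: S_def convergent_def)
  qed
  have klim: "filterlim k at_top sequentially" using k by (rule filterlim_subseq)
  have loc': "\<exists>\<rho>>0. \<exists>L\<ge>0. ball y \<rho> \<subseteq> \<Omega> \<and> (\<forall>\<^sub>F n in sequentially.
        (\<forall>x\<in>ball y \<rho>. \<forall>x'\<in>ball y \<rho>. \<bar>F (k n) x - F (k n) x'\<bar> \<le> L * norm (x - x')))" if yin: "y \<in> \<Omega>" for y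
  proof -
    obtain \<rho> L where \<rho>: "\<rho> > 0" "ball y \<rho> \<subseteq> \<Omega>" and lipF: "\<forall>\<^sub>F n in sequentially.
        (\<forall>x\<in>ball y \<rho>. \<forall>x'\<in>ball y \<rho>. \<bar>F n x - F n x'\<bar> \<le> L * norm (x - x'))"
      using loc[OF yin] by (fastforce simp: eventually_conj_iff)
    from eventually_compose_filterlim[OF lipF klim]
    have "\<forall>\<^sub>F n in sequentially.
        (\<forall>x\<in>ball y \<rho>. \<forall>x'\<in>ball y \<rho>. \<bar>F (k n) x - F (k n) x'\<bar> \<le> \<bar>L\<bar> * norm (x - x'))"
    proof eventually_elim
      case (elim n)
      have "L * norm (x - x') \<le> \<bar>L\<bar> * norm (x - x')" for x x' :: 'a by (intro mult_right_mono) auto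
      then show ?case using elim by (meson order_trans)
    qed
    then show ?thesis using \<rho> by (intro exI[of _ \<rho>] conjI exI[of _ "\<bar>L\<bar>"]) auto
  qed
  have conv: "convergent (\<lambda>n. F (k n) x)" if xin: "x \<in> \<Omega>" for x
  proof (rule Cauchy_convergent, rule metric_CauchyI)
    fix e :: real assume e: "0 < e"
    obtain \<rho> L where \<rho>: "\<rho> > 0" and L: "L \<ge> 0" and sub: "ball x \<rho> \<subseteq> \<Omega>" and
      lip: "\<forall>\<^sub>F n in sequentially.
        (\<forall>y\<in>ball x \<rho>. \<forall>x'\<in>ball x \<rho>. \<bar>F (k n) y - F (k n) x'\<bar> \<le> L * norm (y - x'))"
      using loc'[OF xin] by blast
    define \<delta> where "\<delta> = min \<rho> (e / (4 * (L + 1)))"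
    have \<delta>: "\<delta> > 0" "L * \<delta> \<le> e / 4"
    proof -
      show "\<delta> > 0" using \<rho> L e by (simp add: \<delta>_def)
      then have "L * \<delta> \<le> (L + 1) * \<delta>" by simp
      also have "\<dots> \<le> (L + 1) * (e / (4 * (L + 1)))" using L by (intro mult_left_mono) (auto simp: \<delta>_def)
      also have "\<dots> = e / 4" using L by (simp add: field_simps)
      finally show "L * \<delta> \<le> e / 4" .
    qed
    obtain d where d: "d \<in> D" "d \<in> ball x \<delta>" using D(2)[of "ball x \<delta>"] \<delta> by auto
    then have d\<rho>: "d \<in> ball x \<rho>" by (auto simp: \<delta>_def)
    then have "d \<in> S" using d sub by (auto simp: S_def)
    then have "Cauchy (\<lambda>n. F (k n) d)" using convS convergent_Cauchy by blast
    then obtain N1 where N1: "\<And>m n. N1 \<le> m \<Longrightarrow> N1 \<le> n \<Longrightarrow> dist (F (k m) d) (F (k n) d) < e / 4"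
      using e unfolding Cauchy_def by (metis zero_less_divide_iff zero_less_numeral)
    obtain N2 where N2: "\<And>n. N2 \<le> n \<Longrightarrow> \<bar>F (k n) x - F (k n) d\<bar> \<le> L * norm (x - d)"
    proof -
      obtain N where "\<forall>n\<ge>N. \<forall>y\<in>ball x \<rho>. \<forall>x'\<in>ball x \<rho>. \<bar>F (k n) y - F (k n) x'\<bar> \<le> L * norm (y - x')"
        using lip unfolding eventually_sequentially ..
      then show ?thesis using that[of N] d\<rho> centre_in_ball[THEN iffD2, OF \<rho>] by blast
    qed
    have "L * norm (x - d) \<le> e / 4"
      using d(2) \<delta> L mult_left_mono[of "norm (x - d)" \<delta> L] by (simp add: dist_norm)
    then have "dist (F (k m) x) (F (k n) x) < e" if "max N1 N2 \<le> m" "max N1 N2 \<le> n" for m n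
      using N1[of m n] N2[of m] N2[of n] that e unfolding dist_real_def by linarith
    then show "\<exists>N. \<forall>m\<ge>N. \<forall>n\<ge>N. dist (F (k m) x) (F (k n) x) < e" by blast
  qed
  define v where "v x = lim (\<lambda>n. F (k n) x)" for x
  have v: "(\<lambda>n. F (k n) x) \<longlonglongrightarrow> v x" if "x \<in> \<Omega>" for x
    using conv[OF that] unfolding v_def by (simp add: convergent_LIMSEQ_iff)
  have near: "\<exists>\<delta>>0. ball y \<delta> \<subseteq> \<Omega> \<and> (\<forall>x\<in>ball y \<delta>. \<bar>v x - v y\<bar> \<le> e) \<and>
      (\<forall>\<^sub>F n in sequentially. \<forall>x\<in>ball y \<delta>. \<bar>F (k n) x - v x\<bar> < 4 * e)" if y: "y \<in> \<Omega>" and e: "0 < e" for y e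
  proof -
    obtain \<rho> L where \<rho>: "\<rho> > 0" and L: "L \<ge> 0" and sub: "ball y \<rho> \<subseteq> \<Omega>" and
      lip: "\<forall>\<^sub>F n in sequentially.
        (\<forall>x\<in>ball y \<rho>. \<forall>x'\<in>ball y \<rho>. \<bar>F (k n) x - F (k n) x'\<bar> \<le> L * norm (x - x'))"
      using loc'[OF y] by blast
    define \<delta> where "\<delta> = min \<rho> (e / (L + 1))"
    have \<delta>: "\<delta> > 0" "L * \<delta> \<le> e"
    proof -
      show "\<delta> > 0" using \<rho> L e by (simp add: \<delta>_def)
      then have "L * \<delta> \<le> (L + 1) * \<delta>" by simp
      also have "\<dots> \<le> (L + 1) * (e / (L + 1))" using L by (intro mult_left_mono) (auto simp: \<delta>_def)
      also have "\<dots> = e" using L by (simp add: field_simps)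
      finally show "L * \<delta> \<le> e" .
    qed
    have sub': "ball y \<delta> \<subseteq> ball y \<rho>" by (auto simp: \<delta>_def)
    have lip': "\<forall>\<^sub>F n in sequentially. \<forall>x\<in>ball y \<delta>. \<bar>F (k n) x - F (k n) y\<bar> \<le> e"
      using lip
    proof eventually_elim
      case (elim n)
      show ?case
      proof
        fix x assume x: "x \<in> ball y \<delta>"
        have "\<bar>F (k n) x - F (k n) y\<bar> \<le> L * norm (x - y)" using elim x sub' \<rho> by auto
        also have "\<dots> \<le> L * \<delta>" using x L by (intro mult_left_mono) (auto simp: dist_norm norm_minus_commute)
        finally show "\<bar>F (k n) x - F (k n) y\<bar> \<le> e" using \<delta> by simp
      qed
    qed
    have vx: "\<bar>v x - v y\<bar> \<le> e" if x: "x \<in> ball y \<delta>" for x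
    proof (rule tendsto_upperbound)
      show "(\<lambda>n. \<bar>F (k n) x - F (k n) y\<bar>) \<longlonglongrightarrow> \<bar>v x - v y\<bar>"
      proof -
        have "x \<in> \<Omega>" using x sub sub' by blast
        then show ?thesis by (intro tendsto_intros v y)
      qed
      show "\<forall>\<^sub>F n in sequentially. \<bar>F (k n) x - F (k n) y\<bar> \<le> e" using lip' x by (auto elim: eventually_mono)
    qed simp
    have "\<forall>\<^sub>F n in sequentially. \<bar>F (k n) y - v y\<bar> < e"
      using tendstoD[OF v[OF y] e] by (simp add: dist_real_def)
    with lip' have "\<forall>\<^sub>F n in sequentially. \<forall>x\<in>ball y \<delta>. \<bar>F (k n) x - v x\<bar> < 4 * e"
    proof eventually_elim
      case (elim n)
      show ?case
      proof
        fix x assume x: "x \<in> ball y \<delta>"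
        show "\<bar>F (k n) x - v x\<bar> < 4 * e" using elim(1)[rule_format, OF x] elim(2) vx[OF x] e by linarith
      qed
    qed
    then show ?thesis using \<delta>(1) vx sub sub' by (intro exI[of _ \<delta>]) blast
  qed
  have contv: "continuous_on \<Omega> v"
    unfolding continuous_on_iff
  proof (intro ballI allI impI)
    fix y and e :: real assume y: "y \<in> \<Omega>" and e: "0 < e"
    from near[OF y, of "e / 2"] e obtain \<delta> where \<delta>: "\<delta> > 0" "\<forall>x\<in>ball y \<delta>. \<bar>v x - v y\<bar> \<le> e / 2" by auto
    have "dist (v x) (v y) < e" if "dist x y < \<delta>" for x
      using \<delta>(2)[rule_format, of x] that e by (simp add: dist_real_def dist_commute)
    then show "\<exists>d>0. \<forall>x'\<in>\<Omega>. dist x' y < d \<longrightarrow> dist (v x') (v y) < e" using \<delta>(1) by blast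
  qed
  have "locally_uniform_limit \<Omega> (\<lambda>n. F (k n)) v"
    unfolding locally_uniform_limit_def
  proof (intro allI impI uniform_limitI)
    fix K e assume K: "compact K \<and> K \<subseteq> \<Omega>" and e: "(0::real) < e"
    have "\<forall>y\<in>K. \<exists>\<delta>>0. \<forall>\<^sub>F n in sequentially. \<forall>x\<in>ball y \<delta>. \<bar>F (k n) x - v x\<bar> < e"
    proof
      fix y assume "y \<in> K"
      then have "y \<in> \<Omega>" using K by blast
      from near[OF this, of "e / 4"] e
      show "\<exists>\<delta>>0. \<forall>\<^sub>F n in sequentially. \<forall>x\<in>ball y \<delta>. \<bar>F (k n) x - v x\<bar> < e" by auto
    qed
    from bchoice[OF this] obtain \<delta> where \<delta>: "\<And>y. y \<in> K \<Longrightarrow> 0 < \<delta> y"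
      "\<And>y. y \<in> K \<Longrightarrow> \<forall>\<^sub>F n in sequentially. \<forall>x\<in>ball y (\<delta> y). \<bar>F (k n) x - v x\<bar> < e" by blast
    obtain T where T: "T \<subseteq> K" "finite T" "K \<subseteq> (\<Union>y\<in>T. ball y (\<delta> y))"
    proof (rule compactE_image[of K K "\<lambda>y. ball y (\<delta> y)"])
      show "K \<subseteq> (\<Union>y\<in>K. ball y (\<delta> y))" using \<delta>(1) by force
    qed (use K in auto)
    have "\<forall>\<^sub>F n in sequentially. \<forall>y\<in>T. \<forall>x\<in>ball y (\<delta> y). \<bar>F (k n) x - v x\<bar> < e"
      using T \<delta>(2) by (intro eventually_ball_finite) auto
    then show "\<forall>\<^sub>F n in sequentially. \<forall>x\<in>K. dist (F (k n) x) (v x) < e"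
      using T(3) by (auto simp: dist_real_def elim!: eventually_mono)
  qed
  then show ?thesis using k contv that by blast
qed

text \<open>A quadratically strict maximum survives uniform perturbations: the maximisers of the perturbed functions
converge to it.\<close>

lemma perturbed_strict_maximum:
  fixes x :: "'a::euclidean_space"
  assumes G: "\<And>n. continuous_on (cball x \<rho>) (G n)" "uniform_limit (cball x \<rho>) G g sequentially"
    and \<rho>: "0 < \<rho>" and \<eta>: "0 < \<eta>" and strict: "\<And>y. y \<in> cball x \<rho> \<Longrightarrow> g y \<le> g x - \<eta> * (norm (y - x))\<^sup>2"
  obtains xs where "xs \<longlonglongrightarrow> x" "\<And>n. xs n \<in> cball x \<rho>" "\<forall>\<^sub>F n in sequentially. local_max_at (G n) (xs n)"
proof -
  have "\<exists>z. z \<in> cball x \<rho> \<and> (\<forall>y\<in>cball x \<rho>. G n y \<le> G n z)" for n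
    using continuous_attains_sup[OF compact_cball _ G(1)[of n]] \<rho> by (auto simp: cball_eq_empty)
  then obtain xs where xs: "\<And>n. xs n \<in> cball x \<rho>" and max: "\<And>n y. y \<in> cball x \<rho> \<Longrightarrow> G n y \<le> G n (xs n)"
    by metis
  have lim: "xs \<longlonglongrightarrow> x"
  proof (rule tendstoI)
    fix e :: real assume e: "0 < e"
    define \<epsilon> where "\<epsilon> = \<eta> * e\<^sup>2 / 4"
    have "\<epsilon> > 0" using e \<eta> by (simp add: \<epsilon>_def)
    from uniform_limitD[OF G(2) this]
    show "\<forall>\<^sub>F n in sequentially. dist (xs n) x < e"
    proof eventually_elim
      case (elim n)
      have "x \<in> cball x \<rho>" using \<rho> by simp
      have "\<bar>G n x - g x\<bar> < \<epsilon>" "\<bar>G n (xs n) - g (xs n)\<bar> < \<epsilon>"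
        using elim xs[of n] \<open>x \<in> cball x \<rho>\<close> by (auto simp: dist_real_def)
      then have "\<eta> * (norm (xs n - x))\<^sup>2 < 2 * \<epsilon>"
        using max[OF \<open>x \<in> cball x \<rho>\<close>, of n] strict[OF xs[of n]] by linarith
      also have "\<dots> \<le> \<eta> * e\<^sup>2" using \<eta> by (simp add: \<epsilon>_def)
      finally have "(norm (xs n - x))\<^sup>2 < e\<^sup>2" using \<eta> by simp
      then show ?case using e by (simp add: dist_norm power2_less_imp_less)
    qed
  qed
  have "\<forall>\<^sub>F n in sequentially. local_max_at (G n) (xs n)"
    using tendstoD[OF lim \<rho>]
  proof eventually_elim
    case (elim n)
    then have "\<forall>\<^sub>F y in nhds (xs n). y \<in> ball x \<rho>"
      by (intro eventually_nhds_in_open) (auto simp: dist_commute)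
    then show ?case unfolding local_max_at_def
      by eventually_elim (use max ball_subset_cball in blast)
  qed
  then show ?thesis using lim xs that by blast
qed

text \<open>Stability of subsolutions when the zero-order term converges to a constant, which then moves to the right-hand side. The test
function is replaced by its Taylor polynomial with Hessian \<open>A + e I\<close>: the Hessian is then constant along the
approximating points, and only \<open>e \<rightarrow> 0\<close> remains.\<close>

lemma viscosity_subsolution_limit:
  fixes \<Omega> :: "(real^'n) set"
  assumes "open \<Omega>" "0 < p" and f: "continuous_on \<Omega> f"
    and U: "\<And>n. viscosity_subsolution \<Omega> p (\<gamma> n) f (U n)" "\<And>n. continuous_on \<Omega> (U n)"
    and lim: "locally_uniform_limit \<Omega> (\<lambda>n x. U n x + c n) w"
    and zero: "locally_uniform_limit \<Omega> (\<lambda>n x. \<gamma> n * U n x) (\<lambda>_. - C)"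
  shows "viscosity_subsolution \<Omega> p 0 (\<lambda>x. f x + C) w"
  unfolding viscosity_subsolution_def
proof (intro allI ballI impI)
  fix \<phi> x assume x: "x \<in> \<Omega>" and \<phi>: "C2_on \<Omega> \<phi>" and max: "local_max_at (\<lambda>y. w y - \<phi> y) x"
  define a where "a = gradient \<phi> x"
  define A where "A = hessian \<phi> x"
  have A: "symmetric_matrix A" unfolding A_def by (rule symmetric_hessian[OF \<phi> assms(1) x])
  have "norm a powr p \<le> max_eigenvalue A + f x + C + e" if e: "0 < e" for e
  proof -
    define B where "B = A + mat e"
    have B: "symmetric_matrix B" unfolding B_def by (rule symmetric_matrix_add_mat[OF A])
    define Q where "Q = quad x a B"
    have "\<forall>\<^sub>F y in nhds x. \<bar>\<phi> y - \<phi> x - quad x a A y\<bar> \<le> e / 4 * (norm (y - x))\<^sup>2"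
      unfolding a_def A_def using e by (intro C2_on_Taylor[OF \<phi> assms(1) x]) auto
    with max[unfolded local_max_at_def] eventually_nhds_in_open[OF assms(1) x]
    have "\<forall>\<^sub>F y in nhds x. y \<in> \<Omega> \<and> w y - Q y \<le> w x - Q x - e / 4 * (norm (y - x))\<^sup>2"
    proof eventually_elim
      case (elim y)
      have "Q y = quad x a A y + 2 * (e / 4 * (norm (y - x))\<^sup>2)" "Q x = 0"
        by (simp_all add: Q_def B_def quad_add_mat)
      with elim show ?case by linarith
    qed
    then obtain \<rho>0 where \<rho>0: "\<rho>0 > 0"
      "\<And>y. dist y x < \<rho>0 \<Longrightarrow> y \<in> \<Omega> \<and> w y - Q y \<le> w x - Q x - e / 4 * (norm (y - x))\<^sup>2"
      by (auto simp: eventually_nhds_metric)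
    define \<rho> where "\<rho> = \<rho>0 / 2"
    have \<rho>: "\<rho> > 0" using \<rho>0 by (simp add: \<rho>_def)
    have near: "y \<in> \<Omega> \<and> w y - Q y \<le> w x - Q x - e / 4 * (norm (y - x))\<^sup>2" if "y \<in> cball x \<rho>" for y
      using \<rho>0(2)[of y] that \<rho>0(1) by (auto simp: \<rho>_def dist_commute)
    have sub: "cball x \<rho> \<subseteq> \<Omega>" using near by blast
    have contQ: "continuous_on S Q" for S
      unfolding Q_def
      by (intro continuous_at_imp_continuous_on ballI has_derivative_continuous[OF quad_has_derivative[OF B]])
    obtain xs where xs: "xs \<longlonglongrightarrow> x" "\<And>n. xs n \<in> cball x \<rho>"
      and mx: "\<forall>\<^sub>F n in sequentially. local_max_at (\<lambda>y. (U n y + c n) - Q y) (xs n)"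
    proof (rule perturbed_strict_maximum[of x \<rho> "\<lambda>n y. (U n y + c n) - Q y" "\<lambda>y. w y - Q y" "e / 4"])
      show "continuous_on (cball x \<rho>) (\<lambda>y. (U n y + c n) - Q y)" for n
        using continuous_on_subset[OF U(2) sub] by (intro continuous_intros contQ)
      have "uniform_limit (cball x \<rho>) (\<lambda>n y. U n y + c n) w sequentially"
        using lim sub unfolding locally_uniform_limit_def by auto
      then show "uniform_limit (cball x \<rho>) (\<lambda>n y. (U n y + c n) - Q y) (\<lambda>y. w y - Q y) sequentially"
        by (intro uniform_limit_intros)
    qed (use \<rho> e near in auto)
    have xs\<Omega>: "xs n \<in> \<Omega>" for n using xs(2) sub by blast
    have ineq: "\<forall>\<^sub>F n in sequentially. norm (a + B *v (xs n - x)) powr p + \<gamma> n * U n (xs n)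
        \<le> max_eigenvalue B + f (xs n)"
      using mx
    proof eventually_elim
      case (elim n)
      then have "local_max_at (\<lambda>y. U n y - quad x a B y) (xs n)"
        unfolding local_max_at_def Q_def by (rule eventually_mono) simp
      from viscosity_subsolution_quad[OF U(1) xs\<Omega> B this] show ?case by simp
    qed
    have f': "(\<lambda>n. f (xs n)) \<longlonglongrightarrow> f x"
      using continuous_on_tendsto_compose[OF f xs(1) x] xs\<Omega> by simp
    have z: "(\<lambda>n. \<gamma> n * U n (xs n)) \<longlonglongrightarrow> - C"
    proof (rule tendstoI)
      fix \<epsilon> :: real assume "\<epsilon> > 0"
      have "uniform_limit (cball x \<rho>) (\<lambda>n x. \<gamma> n * U n x) (\<lambda>_. - C) sequentially"
        using zero sub unfolding locally_uniform_limit_def by auto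
      from uniform_limitD[OF this \<open>\<epsilon> > 0\<close>]
      show "\<forall>\<^sub>F n in sequentially. dist (\<gamma> n * U n (xs n)) (- C) < \<epsilon>"
        by (rule eventually_mono) (use xs(2) in blast)
    qed
    have "(\<lambda>n. a + B *v (xs n - x)) \<longlonglongrightarrow> a + B *v (x - x)"
      by (intro tendsto_intros bounded_linear.tendsto[OF matrix_vector_mul_bounded_linear] xs(1))
    then have "(\<lambda>n. norm (a + B *v (xs n - x)) powr p) \<longlonglongrightarrow> norm (a + B *v (x - x)) powr p"
      using \<open>0 < p\<close> by (intro tendsto_powr2 tendsto_norm) auto
    from tendsto_add[OF this z] have l: "(\<lambda>n. norm (a + B *v (xs n - x)) powr p + \<gamma> n * U n (xs n))
        \<longlonglongrightarrow> norm a powr p + - C" by simp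
    have r: "(\<lambda>n. max_eigenvalue B + f (xs n)) \<longlonglongrightarrow> max_eigenvalue B + f x"
      by (intro tendsto_intros f')
    have "norm a powr p + - C \<le> max_eigenvalue B + f x"
      by (rule tendsto_le[OF _ r l ineq]) simp
    then show ?thesis by (simp add: B_def max_eigenvalue_add_mat[OF A])
  qed
  then have "norm a powr p \<le> max_eigenvalue A + f x + C" by (rule field_le_epsilon)
  then show "- max_eigenvalue (hessian \<phi> x) + norm (gradient \<phi> x) powr p + 0 * w x \<le> f x + C"
    by (simp add: a_def A_def)
qed

text \<open>The argument for subsolutions with the Hessian lowered to \<open>A - e I\<close>. Negation does not exchange the two cases, as it would turn
the largest eigenvalue into the smallest.\<close>

lemma viscosity_supersolution_limit:
  fixes \<Omega> :: "(real^'n) set"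
  assumes "open \<Omega>" "0 < p" and f: "continuous_on \<Omega> f"
    and U: "\<And>n. viscosity_supersolution \<Omega> p (\<gamma> n) f (U n)" "\<And>n. continuous_on \<Omega> (U n)"
    and lim: "locally_uniform_limit \<Omega> (\<lambda>n x. U n x + c n) w"
    and zero: "locally_uniform_limit \<Omega> (\<lambda>n x. \<gamma> n * U n x) (\<lambda>_. - C)"
  shows "viscosity_supersolution \<Omega> p 0 (\<lambda>x. f x + C) w"
  unfolding viscosity_supersolution_def
proof (intro allI ballI impI)
  fix \<phi> x assume x: "x \<in> \<Omega>" and \<phi>: "C2_on \<Omega> \<phi>" and min: "local_min_at (\<lambda>y. w y - \<phi> y) x"
  define a where "a = gradient \<phi> x"
  define A where "A = hessian \<phi> x"
  have A: "symmetric_matrix A" unfolding A_def by (rule symmetric_hessian[OF \<phi> assms(1) x])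
  have "max_eigenvalue A + f x + C \<le> norm a powr p + e" if e: "0 < e" for e
  proof -
    define B where "B = A + mat (- e)"
    have B: "symmetric_matrix B" unfolding B_def by (rule symmetric_matrix_add_mat[OF A])
    define Q where "Q = quad x a B"
    have "\<forall>\<^sub>F y in nhds x. \<bar>\<phi> y - \<phi> x - quad x a A y\<bar> \<le> e / 4 * (norm (y - x))\<^sup>2"
      unfolding a_def A_def using e by (intro C2_on_Taylor[OF \<phi> assms(1) x]) auto
    with min[unfolded local_min_at_def] eventually_nhds_in_open[OF assms(1) x]
    have "\<forall>\<^sub>F y in nhds x. y \<in> \<Omega> \<and> Q y - w y \<le> Q x - w x - e / 4 * (norm (y - x))\<^sup>2"
    proof eventually_elim
      case (elim y)
      have "Q y = quad x a A y - 2 * (e / 4 * (norm (y - x))\<^sup>2)" "Q x = 0"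
        by (simp_all add: Q_def B_def quad_add_mat)
      with elim show ?case by linarith
    qed
    then obtain \<rho>0 where \<rho>0: "\<rho>0 > 0"
      "\<And>y. dist y x < \<rho>0 \<Longrightarrow> y \<in> \<Omega> \<and> Q y - w y \<le> Q x - w x - e / 4 * (norm (y - x))\<^sup>2"
      by (auto simp: eventually_nhds_metric)
    define \<rho> where "\<rho> = \<rho>0 / 2"
    have \<rho>: "\<rho> > 0" using \<rho>0 by (simp add: \<rho>_def)
    have near: "y \<in> \<Omega> \<and> Q y - w y \<le> Q x - w x - e / 4 * (norm (y - x))\<^sup>2" if "y \<in> cball x \<rho>" for y
      using \<rho>0(2)[of y] that \<rho>0(1) by (auto simp: \<rho>_def dist_commute)
    have sub: "cball x \<rho> \<subseteq> \<Omega>" using near by blast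
    have contQ: "continuous_on S Q" for S
      unfolding Q_def
      by (intro continuous_at_imp_continuous_on ballI has_derivative_continuous[OF quad_has_derivative[OF B]])
    obtain xs where xs: "xs \<longlonglongrightarrow> x" "\<And>n. xs n \<in> cball x \<rho>"
      and mx: "\<forall>\<^sub>F n in sequentially. local_max_at (\<lambda>y. Q y - (U n y + c n)) (xs n)"
    proof (rule perturbed_strict_maximum[of x \<rho> "\<lambda>n y. Q y - (U n y + c n)" "\<lambda>y. Q y - w y" "e / 4"])
      show "continuous_on (cball x \<rho>) (\<lambda>y. Q y - (U n y + c n))" for n
        using continuous_on_subset[OF U(2) sub] by (intro continuous_intros contQ)
      have "uniform_limit (cball x \<rho>) (\<lambda>n y. U n y + c n) w sequentially"
        using lim sub unfolding locally_uniform_limit_def by auto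
      then show "uniform_limit (cball x \<rho>) (\<lambda>n y. Q y - (U n y + c n)) (\<lambda>y. Q y - w y) sequentially"
        by (intro uniform_limit_intros)
    qed (use \<rho> e near in auto)
    have xs\<Omega>: "xs n \<in> \<Omega>" for n using xs(2) sub by blast
    have ineq: "\<forall>\<^sub>F n in sequentially. max_eigenvalue B + f (xs n)
        \<le> norm (a + B *v (xs n - x)) powr p + \<gamma> n * U n (xs n)"
      using mx
    proof eventually_elim
      case (elim n)
      then have "local_min_at (\<lambda>y. U n y - quad x a B y) (xs n)"
        unfolding local_max_at_def local_min_at_def Q_def by (rule eventually_mono) simp
      from viscosity_supersolution_quad[OF U(1) xs\<Omega> B this] show ?case by simp
    qed
    have f': "(\<lambda>n. f (xs n)) \<longlonglongrightarrow> f x"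
      using continuous_on_tendsto_compose[OF f xs(1) x] xs\<Omega> by simp
    have z: "(\<lambda>n. \<gamma> n * U n (xs n)) \<longlonglongrightarrow> - C"
    proof (rule tendstoI)
      fix \<epsilon> :: real assume "\<epsilon> > 0"
      have "uniform_limit (cball x \<rho>) (\<lambda>n x. \<gamma> n * U n x) (\<lambda>_. - C) sequentially"
        using zero sub unfolding locally_uniform_limit_def by auto
      from uniform_limitD[OF this \<open>\<epsilon> > 0\<close>]
      show "\<forall>\<^sub>F n in sequentially. dist (\<gamma> n * U n (xs n)) (- C) < \<epsilon>"
        by (rule eventually_mono) (use xs(2) in blast)
    qed
    have "(\<lambda>n. a + B *v (xs n - x)) \<longlonglongrightarrow> a + B *v (x - x)"
      by (intro tendsto_intros bounded_linear.tendsto[OF matrix_vector_mul_bounded_linear] xs(1))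
    then have "(\<lambda>n. norm (a + B *v (xs n - x)) powr p) \<longlonglongrightarrow> norm (a + B *v (x - x)) powr p"
      using \<open>0 < p\<close> by (intro tendsto_powr2 tendsto_norm) auto
    from tendsto_add[OF this z] have l: "(\<lambda>n. norm (a + B *v (xs n - x)) powr p + \<gamma> n * U n (xs n))
        \<longlonglongrightarrow> norm a powr p + - C" by simp
    have r: "(\<lambda>n. max_eigenvalue B + f (xs n)) \<longlonglongrightarrow> max_eigenvalue B + f x"
      by (intro tendsto_intros f')
    have "max_eigenvalue B + f x \<le> norm a powr p + - C"
      by (rule tendsto_le[OF _ l r ineq]) simp
    then show ?thesis by (simp add: B_def max_eigenvalue_add_mat[OF A])
  qed
  then have "max_eigenvalue A + f x + C \<le> norm a powr p" by (rule field_le_epsilon)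
  then show "- max_eigenvalue (hessian \<phi> x) + norm (gradient \<phi> x) powr p + 0 * w x \<ge> f x + C"
    by (simp add: a_def A_def)
qed

section \<open>A priori bounds for the Dirichlet problem\<close>

text \<open>Testing with constants at an interior extremum, where gradient and Hessian of the test function vanish.\<close>

lemma dirichlet_solution_bound:
  fixes \<Omega> :: "(real^'n) set"
  assumes \<Omega>: "open \<Omega>" "bounded \<Omega>" and \<gamma>: "0 < \<gamma>" and u: "dirichlet_solution \<Omega> p \<gamma> f u"
    and F: "\<And>x. x \<in> \<Omega> \<Longrightarrow> \<bar>f x\<bar> \<le> F" "0 \<le> F" and x: "x \<in> closure \<Omega>"
  shows "\<bar>\<gamma> * u x\<bar> \<le> F"
proof -
  have cont: "continuous_on (closure \<Omega>) u" and bd: "\<And>x. x \<in> frontier \<Omega> \<Longrightarrow> u x = 0"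
    and sub: "viscosity_subsolution \<Omega> p \<gamma> f u" and super: "viscosity_supersolution \<Omega> p \<gamma> f u"
    using u unfolding dirichlet_solution_def viscosity_solution_def by auto
  have sym: "symmetric_matrix (0 :: real^'n^'n)" by (simp add: symmetric_matrix_def)
  have q0: "quad z 0 0 = (\<lambda>y. 0)" for z :: "real^'n" by (simp add: quad_def fun_eq_iff)
  have comp: "compact (closure \<Omega>)" "closure \<Omega> \<noteq> {}" using \<Omega> x by auto
  have split: "y \<in> \<Omega> \<or> y \<in> frontier \<Omega>" if "y \<in> closure \<Omega>" for y
    using that \<Omega>(1) by (simp add: frontier_def interior_open)
  obtain y where y: "y \<in> closure \<Omega>" "\<And>z. z \<in> closure \<Omega> \<Longrightarrow> u z \<le> u y"
    using continuous_attains_sup[OF comp cont] by blast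
  have "\<gamma> * u y \<le> F"
  proof (cases "y \<in> \<Omega>")
    case True
    have "\<forall>\<^sub>F z in nhds y. u z \<le> u y"
      using eventually_nhds_in_open[OF \<Omega>(1) True] y(2) closure_subset
      by (auto elim!: eventually_mono)
    then have "local_max_at (\<lambda>z. u z - quad y 0 0 z) y" by (simp add: local_max_at_def q0)
    from viscosity_subsolution_quad[OF sub True sym this] F(1)[OF True]
    show ?thesis by (simp add: max_eigenvalue_0)
  next
    case False
    then have "u y = 0" using split[OF y(1)] bd by blast
    then show ?thesis using F by simp
  qed
  moreover have "\<gamma> * u x \<le> \<gamma> * u y" using y(2)[OF x] \<gamma> by simp
  moreover obtain y' where y': "y' \<in> closure \<Omega>" "\<And>z. z \<in> closure \<Omega> \<Longrightarrow> u y' \<le> u z"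
    using continuous_attains_inf[OF comp cont] by blast
  have "- F \<le> \<gamma> * u y'"
  proof (cases "y' \<in> \<Omega>")
    case True
    have "\<forall>\<^sub>F z in nhds y'. u y' \<le> u z"
      using eventually_nhds_in_open[OF \<Omega>(1) True] y'(2) closure_subset
      by (auto elim!: eventually_mono)
    then have "local_min_at (\<lambda>z. u z - quad y' 0 0 z) y'" by (simp add: local_min_at_def q0)
    from viscosity_supersolution_quad[OF super True sym this] F(1)[OF True]
    show ?thesis by (simp add: max_eigenvalue_0)
  next
    case False
    then have "u y' = 0" using split[OF y'(1)] bd by blast
    then show ?thesis using F by simp
  qed
  moreover have "\<gamma> * u y' \<le> \<gamma> * u x" using y'(2)[OF x] \<gamma> by simp
  ultimately show ?thesis by linarith
qed

lemma dirichlet_solution_jets: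
  fixes \<Omega> :: "(real^'n) set"
  assumes \<Omega>: "open \<Omega>" "bounded \<Omega>" and \<gamma>: "0 < \<gamma>" and u: "dirichlet_solution \<Omega> p \<gamma> f u"
    and F: "\<And>x. x \<in> \<Omega> \<Longrightarrow> \<bar>f x\<bar> \<le> F" "0 \<le> F"
  shows "sub_jets \<Omega> p (2 * F) u" "super_jets \<Omega> p (2 * F) u"
proof -
  have sub: "viscosity_subsolution \<Omega> p \<gamma> f u" and super: "viscosity_supersolution \<Omega> p \<gamma> f u"
    using u unfolding dirichlet_solution_def viscosity_solution_def by auto
  have b: "\<bar>\<gamma> * u x\<bar> \<le> F" if "x \<in> \<Omega>" for x
    using dirichlet_solution_bound[OF \<Omega> \<gamma> u F] that closure_subset by blast
  show "sub_jets \<Omega> p (2 * F) u"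
    unfolding sub_jets_def
  proof (intro ballI allI impI)
    fix x a and A :: "real^'n^'n" assume x: "x \<in> \<Omega>" and A: "symmetric_matrix A"
      and "\<forall>\<^sub>F y in nhds x. u y \<le> u x + quad x a A y"
    then have "local_max_at (\<lambda>y. u y - quad x a A y) x"
      unfolding local_max_at_def by (auto elim!: eventually_mono)
    from viscosity_subsolution_quad[OF sub x A this] F(1)[OF x] b[OF x]
    show "norm a powr p \<le> max_eigenvalue A + 2 * F" by (simp add: abs_le_iff)
  qed
  show "super_jets \<Omega> p (2 * F) u"
    unfolding super_jets_def
  proof (intro ballI allI impI)
    fix x a and A :: "real^'n^'n" assume x: "x \<in> \<Omega>" and A: "symmetric_matrix A"
      and "\<forall>\<^sub>F y in nhds x. u x + quad x a A y \<le> u y"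
    then have "local_min_at (\<lambda>y. u y - quad x a A y) x"
      unfolding local_min_at_def by (auto elim!: eventually_mono)
    from viscosity_supersolution_quad[OF super x A this] F(1)[OF x] b[OF x]
    show "max_eigenvalue A \<le> norm a powr p + 2 * F" by (simp add: abs_le_iff)
  qed
qed

text \<open>As \<open>u\<close> vanishes on the boundary, \<open>- \<parallel>u\<^sup>-\<parallel>\<^sub>\<infinity>\<close> is the minimum of \<open>u\<close>, and a negative minimum is attained inside.\<close>

lemma sup_norm_neg_part:
  fixes \<Omega> :: "(real^'n) set"
  assumes \<Omega>: "open \<Omega>" "bounded \<Omega>" "\<Omega> \<noteq> {}" and cont: "continuous_on (closure \<Omega>) u"
    and bd: "\<And>x. x \<in> frontier \<Omega> \<Longrightarrow> u x = 0" and m: "m = sup_norm_on \<Omega> (neg_part u)"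
  shows "0 \<le> m" and "\<And>x. x \<in> closure \<Omega> \<Longrightarrow> - m \<le> u x" and "0 < m \<Longrightarrow> \<exists>x\<in>\<Omega>. u x = - m"
proof -
  have split: "y \<in> \<Omega> \<or> y \<in> frontier \<Omega>" if "y \<in> closure \<Omega>" for y
    using that \<Omega>(1) by (simp add: frontier_def interior_open)
  have comp: "compact (closure \<Omega>)" "closure \<Omega> \<noteq> {}" using \<Omega> by auto
  obtain y where y: "y \<in> closure \<Omega>" "\<And>z. z \<in> closure \<Omega> \<Longrightarrow> u y \<le> u z"
    using continuous_attains_inf[OF comp cont] by blast
  have abs: "\<bar>neg_part u x\<bar> = neg_part u x" "0 \<le> neg_part u x" "- u x \<le> neg_part u x" for x
    by (auto simp: neg_part_def)
  have upper: "neg_part u x \<le> neg_part u y" if "x \<in> \<Omega>" for x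
    using y(2)[of x] that closure_subset by (force simp: neg_part_def)
  then have bdd: "bdd_above ((\<lambda>x. \<bar>neg_part u x\<bar>) ` \<Omega>)" by (auto simp: abs bdd_above_def)
  have le: "neg_part u x \<le> m" if "x \<in> \<Omega>" for x
    using cSUP_upper[OF that bdd] unfolding m sup_norm_on_def by (simp add: abs)
  obtain x0 where "x0 \<in> \<Omega>" using \<Omega>(3) by blast
  show m0: "0 \<le> m" using le[OF \<open>x0 \<in> \<Omega>\<close>] abs(2)[of x0] by linarith
  show "- m \<le> u x" if "x \<in> closure \<Omega>" for x
  proof (cases "x \<in> \<Omega>")
    case True
    then show ?thesis using le[OF True] abs(3)[of x] by linarith
  next
    case False
    then show ?thesis using split[OF that] bd m0 by auto
  qed
  have "m \<le> neg_part u y"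
    unfolding m sup_norm_on_def using \<Omega>(3) upper by (intro cSUP_least) (auto simp: abs)
  then show "\<exists>x\<in>\<Omega>. u x = - m" if "0 < m"
  proof -
    assume mle: "m \<le> neg_part u y"
    then have uy: "u y < 0" "m \<le> - u y" using that by (auto simp: neg_part_def max_def split: if_splits)
    then have "y \<in> \<Omega>" using split[OF y(1)] bd by fastforce
    moreover have "- u y \<le> m" using le[OF \<open>y \<in> \<Omega>\<close>] abs(3)[of y] by linarith
    ultimately show ?thesis using uy by (intro bexI[of _ y]) auto
  qed
qed

text \<open>The oscillation estimate applied with every point of a small ball as centre, which makes it a two-sided bound.\<close>

lemma local_lipschitz_of_bounded:
  fixes \<Omega> :: "(real^'n) set" and V :: "nat \<Rightarrow> real^'n \<Rightarrow> real"
  assumes p: "0 \<le> p" "p \<le> 2" and V: "\<And>n. super_jets \<Omega> p K (V n)" "\<And>n. continuous_on \<Omega> (V n)"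
    and R: "0 < R" "ball y R \<subseteq> \<Omega>"
    and M: "\<forall>\<^sub>F n in sequentially. \<forall>x\<in>ball y R. \<bar>V n x\<bar> \<le> M"
  shows "\<exists>\<rho>>0. \<exists>M L. ball y \<rho> \<subseteq> \<Omega> \<and>
      (\<forall>\<^sub>F n in sequentially. (\<forall>x\<in>ball y \<rho>. \<bar>V n x\<bar> \<le> M) \<and>
        (\<forall>x\<in>ball y \<rho>. \<forall>x'\<in>ball y \<rho>. \<bar>V n x - V n x'\<bar> \<le> L * norm (x - x')))"
proof -
  define k where "k = max 1 (K + 1)"
  have k: "1 \<le> k" "K + 1 \<le> k" by (auto simp: k_def)
  \<comment> \<open>Any two points of \<open>ball y \<rho>\<close> are within \<open>2 * \<rho>\<close> of each other, and the balls of that radius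
    about them stay in \<open>ball y R\<close>.\<close>
  define \<rho> where "\<rho> = min (R / 4) (1 / (8 * k))"
  have \<rho>: "0 < \<rho>" "4 * \<rho> \<le> R" using R k by (auto simp: \<rho>_def)
  have "\<rho> \<le> 1 / (8 * k)" by (simp add: \<rho>_def)
  then have r: "0 < 2 * \<rho>" "2 * \<rho> \<le> 1 / (4 * k)" using \<rho> k by (auto simp: field_simps)
  obtain L where L: "0 < L"
    "\<And>\<Omega> u c x. super_jets \<Omega> p K u \<Longrightarrow> cball c (2 * \<rho>) \<subseteq> \<Omega> \<Longrightarrow> continuous_on (cball c (2 * \<rho>)) u \<Longrightarrow>
      (\<And>y. y \<in> cball c (2 * \<rho>) \<Longrightarrow> u c - 2 * M \<le> u y) \<Longrightarrow> x \<in> cball c (2 * \<rho>) \<Longrightarrow>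
      u c - L * norm (x - c) \<le> u (x::real^'n)"
    using super_jets_lipschitz[OF p k r, of "2 * M"] by metis
  have sub: "cball c (2 * \<rho>) \<subseteq> ball y R" if "c \<in> ball y \<rho>" for c
  proof
    fix z assume "z \<in> cball c (2 * \<rho>)"
    then show "z \<in> ball y R" using that \<rho> dist_triangle[of y z c] by auto
  qed
  have "\<forall>\<^sub>F n in sequentially. (\<forall>x\<in>ball y \<rho>. \<bar>V n x\<bar> \<le> M) \<and>
        (\<forall>x\<in>ball y \<rho>. \<forall>x'\<in>ball y \<rho>. \<bar>V n x - V n x'\<bar> \<le> L * norm (x - x'))"
    using M
  proof eventually_elim
    case (elim n)
    have one: "V n c - L * norm (x - c) \<le> V n x" if c: "c \<in> ball y \<rho>" and x: "x \<in> ball y \<rho>" for c x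
    proof (rule L(2)[OF V(1)[of n]])
      show "cball c (2 * \<rho>) \<subseteq> \<Omega>" using sub[OF c] R by blast
      then show "continuous_on (cball c (2 * \<rho>)) (V n)" using V(2) continuous_on_subset by blast
      show "x \<in> cball c (2 * \<rho>)" using c x dist_triangle[of c x y] by (auto simp: dist_commute)
      fix z assume "z \<in> cball c (2 * \<rho>)"
      then have "z \<in> ball y R" "c \<in> ball y R" using sub[OF c] c \<rho> by auto
      then have "\<bar>V n z\<bar> \<le> M" "\<bar>V n c\<bar> \<le> M" using elim by blast+
      then show "V n c - 2 * M \<le> V n z" by linarith
    qed
    have "ball y \<rho> \<subseteq> ball y R" using \<rho> by auto
    moreover have "\<bar>V n x - V n x'\<bar> \<le> L * norm (x - x')" if "x \<in> ball y \<rho>" "x' \<in> ball y \<rho>" for x x'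
      using one[OF that] one[OF that(2,1)] by (auto simp: norm_minus_commute)
    ultimately show ?case using elim by blast
  qed
  moreover have "ball y \<rho> \<subseteq> \<Omega>" using \<rho> R by auto
  ultimately show ?thesis using \<rho>(1) by blast
qed

text \<open>The points near which the sequence is bounded form an open set. It contains \<open>x0\<close> by the peak bound, and it is
relatively closed because the interior barrier, centred at a good point, reaches every point of \<open>\<Omega>\<close> that is
close enough to it. Connectedness finishes the argument.\<close>

section \<open>Propagation of bounds and boundary behaviour\<close>

lemma bounded_near_all_points:
  fixes \<Omega> :: "(real^'n) set" and V :: "nat \<Rightarrow> real^'n \<Rightarrow> real"
  assumes \<Omega>: "open \<Omega>" "connected \<Omega>" and p: "1 < p" "p \<le> 2" and K: "0 \<le> K"
    and V: "\<And>n. sub_jets \<Omega> p K (V n)" "\<And>n. super_jets \<Omega> p K (V n)" "\<And>n. continuous_on \<Omega> (V n)"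
    and nonneg: "\<And>n x. x \<in> \<Omega> \<Longrightarrow> 0 \<le> V n x"
    and xs: "xs \<longlonglongrightarrow> x0" "x0 \<in> \<Omega>" "\<forall>\<^sub>F n in sequentially. V n (xs n) = 0"
    and y: "y \<in> \<Omega>"
  shows "\<exists>R>0. \<exists>M. ball y R \<subseteq> \<Omega> \<and> (\<forall>\<^sub>F n in sequentially. \<forall>x\<in>ball y R. V n x \<le> M)"
proof -
  define good where "good y R M \<longleftrightarrow> R > 0 \<and> ball y R \<subseteq> \<Omega> \<and> (\<forall>\<^sub>F n in sequentially. \<forall>x\<in>ball y R. V n x \<le> M)" for y R M
  define G where "G = {y. \<exists>R M. good y R M}"
  have G\<Omega>: "G \<subseteq> \<Omega>" by (force simp: G_def good_def)
  have openG: "open G"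
    unfolding open_contains_ball
  proof
    fix y assume "y \<in> G"
    then obtain R M where R: "good y R M" by (auto simp: G_def)
    have "ball y R \<subseteq> G"
    proof
      fix z assume z: "z \<in> ball y R"
      have sub: "ball z (R - dist y z) \<subseteq> ball y R"
      proof
        fix x assume "x \<in> ball z (R - dist y z)"
        then show "x \<in> ball y R" using dist_triangle[of y x z] by auto
      qed
      have "good z (R - dist y z) M" unfolding good_def
      proof (intro conjI)
        show "\<forall>\<^sub>F n in sequentially. \<forall>x\<in>ball z (R - dist y z). V n x \<le> M"
          using R sub unfolding good_def by (auto elim!: eventually_mono)
      qed (use z R sub in \<open>auto simp: good_def\<close>)
      then show "z \<in> G" by (auto simp: G_def)
    qed
    then show "\<exists>e>0. ball y e \<subseteq> G" using R by (auto simp: good_def)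
  qed
  have "x0 \<in> G"
  proof -
    define k where "k = max 1 (K + 1)"
    have k: "1 \<le> k" "K + 1 \<le> k" by (auto simp: k_def)
    obtain e where e: "e > 0" "cball x0 e \<subseteq> \<Omega>" using \<Omega>(1) xs(2) open_contains_cball by blast
    define r where "r = min (e / 2) (1 / (4 * k))"
    have r: "0 < r" "r \<le> 1 / (4 * k)" "2 * r \<le> e" using e k by (auto simp: r_def)
    have "\<forall>\<^sub>F n in sequentially. dist (xs n) x0 < r / 2"
      by (rule tendstoD[OF xs(1)]) (use r in simp)
    with xs(3) have "\<forall>\<^sub>F n in sequentially. \<forall>x\<in>ball x0 (r/2). V n x \<le> log_profile k r 0 - log_profile k r r"
    proof eventually_elim
      case (elim n)
      show ?case
      proof
        fix x assume x: "x \<in> ball x0 (r/2)"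
        have sub: "cball x r \<subseteq> \<Omega>"
        proof
          fix z assume "z \<in> cball x r"
          then have "z \<in> cball x0 e" using x r dist_triangle[of x0 z x] by auto
          then show "z \<in> \<Omega>" using e by blast
        qed
        show "V n x \<le> log_profile k r 0 - log_profile k r r"
        proof (rule super_jets_peak_bound[OF _ p(2) k r(1,2) V(2) sub])
          show "continuous_on (cball x r) (V n)" using V(3) sub by (rule continuous_on_subset)
          show "norm (xs n - x) < r"
            using elim(2) x dist_triangle[of "xs n" x x0] by (simp add: dist_norm norm_minus_commute)
          show "V n (xs n) \<le> 0" using elim(1) by simp
        qed (use p nonneg sub in auto)
      qed
    qed
    then have "good x0 (r/2) (log_profile k r 0 - log_profile k r r)"
      unfolding good_def using r e by auto
    then show ?thesis by (auto simp: G_def)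
  qed
  moreover have closedG: "y0 \<in> G" if y0: "y0 \<in> \<Omega>" "y0 \<in> closure G" for y0
  proof -
    obtain e0 where e0: "e0 > 0" "cball y0 e0 \<subseteq> \<Omega>" using \<Omega>(1) y0(1) open_contains_cball by blast
    define e where "e = min e0 1"
    have e: "0 < e" "e \<le> 1" "cball y0 e \<subseteq> \<Omega>" using e0 by (auto simp: e_def)
    obtain z where z: "z \<in> G" "dist z y0 < e / 4"
      using y0(2) e(1) unfolding closure_approachable by (meson zero_less_divide_iff zero_less_numeral)
    obtain \<rho> M where \<rho>: "good z \<rho> M" using z(1) by (auto simp: G_def)
    \<comment> \<open>The barrier is infinite at distance \<open>e / 2\<close> from \<open>z\<close>, and \<open>ball y0 (e / 8)\<close> lies within
      distance \<open>3 * e / 8\<close> of \<open>z\<close>; the margin \<open>e / 8\<close> bounds the barrier there.\<close>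
    define s where "s = min (\<rho> / 2) (e / 8)"
    have s: "0 < s" "s < \<rho>" "s \<le> e / 8" using \<rho> e by (auto simp: s_def good_def)
    define a where "a = 1 / (p - 1)"
    obtain B where B: "1 \<le> B" "B * (1 / s + a + 1) + K < B powr p"
      using superlinear_slope_exists[OF p(1)] by blast
    have a0: "a > 0" using p by (simp add: a_def)
    have sub: "cball z (e / 2) \<subseteq> \<Omega>"
    proof
      fix x assume "x \<in> cball z (e / 2)"
      then have "x \<in> cball y0 e" using z(2) e(1) dist_triangle[of y0 x z] by (auto simp: dist_commute)
      then show "x \<in> \<Omega>" using e by blast
    qed
    have "\<forall>\<^sub>F n in sequentially. \<forall>x\<in>ball z \<rho>. V n x \<le> M" using \<rho> by (simp add: good_def)
    then have "\<forall>\<^sub>F n in sequentially. \<forall>x\<in>ball y0 (e/8). V n x \<le> M + B / a * (e / 8) powr (- a)"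
    proof eventually_elim
      case (elim n)
      show ?case
      proof
        fix x assume "x \<in> ball y0 (e/8)"
        then have x: "norm (x - z) < 3 * e / 8"
          using z(2) dist_triangle[of x z y0] by (simp add: dist_norm norm_minus_commute)
        show "V n x \<le> M + B / a * (e / 8) powr (- a)"
        proof (cases "norm (x - z) \<le> s")
          case True
          then have "V n x \<le> M" using elim s by (simp add: dist_norm norm_minus_commute)
          moreover have "0 \<le> B / a * (e / 8) powr (- a)" using B a0 by simp
          ultimately show ?thesis by linarith
        next
          case False
          have "V n x \<le> M + B / a * (e / 2 - norm (x - z)) powr (- a)"
          proof (rule sub_jets_interior_barrier[OF p(1) K s(1) _ a_def B V(1) sub])
            show "continuous_on (cball z (e / 2)) (V n)" using V(3) sub by (rule continuous_on_subset)
            show "V n w \<le> M" if "norm (w - z) = s" for w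
              using elim s that by (simp add: dist_norm norm_minus_commute)
          qed (use e x False in auto)
          also have "\<dots> \<le> M + B / a * (e / 8) powr (- a)"
            using x e a0 B by (intro add_left_mono mult_left_mono powr_mono2') auto
          finally show ?thesis .
        qed
      qed
    qed
    moreover have "ball y0 (e/8) \<subseteq> \<Omega>"
    proof -
      have "ball y0 (e/8) \<subseteq> cball y0 e" using e by auto
      then show ?thesis using e by blast
    qed
    ultimately have "good y0 (e/8) (M + B / a * (e / 8) powr (- a))"
      unfolding good_def using e by auto
    then show ?thesis by (auto simp: G_def)
  qed
  have "G \<inter> \<Omega> = {} \<or> (\<Omega> - closure G) \<inter> \<Omega> = {}"
  proof (rule connectedD[OF \<Omega>(2) openG])
    show "open (\<Omega> - closure G)" using \<Omega>(1) by (simp add: open_Diff)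
    show "G \<inter> (\<Omega> - closure G) \<inter> \<Omega> = {}" using closure_subset by blast
    show "\<Omega> \<subseteq> G \<union> (\<Omega> - closure G)" using closedG by blast
  qed
  with \<open>x0 \<in> G\<close> G\<Omega> closedG y have "y \<in> G" by blast
  then show ?thesis unfolding G_def good_def by blast
qed

text \<open>The boundary barrier with its logarithm replaced by a linear lower bound: boundary values that exceed the global
lower bound \<open>b\<close> by \<open>M\<close> persist inside up to a linear error. The constants depend on \<open>M\<close>, but not on
\<open>u\<close> or \<open>b\<close>.\<close>

lemma boundary_lower_bound:
  fixes z :: "real^'n"
  assumes p: "0 \<le> p" "p \<le> 2" and r: "0 < r"
    and \<Omega>: "open \<Omega>" "bounded \<Omega>" and ext: "\<And>x. x \<in> \<Omega> \<Longrightarrow> r \<le> norm (x - z)"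
  obtains \<delta> \<Lambda> where "0 < \<delta>" "0 < \<Lambda>" "\<And>u x b. super_jets \<Omega> p K u \<Longrightarrow> continuous_on (closure \<Omega>) u \<Longrightarrow>
      (\<And>x. x \<in> closure \<Omega> \<Longrightarrow> b \<le> u x) \<Longrightarrow> (\<And>x. x \<in> frontier \<Omega> \<Longrightarrow> b + M \<le> u x) \<Longrightarrow>
      x \<in> \<Omega> \<Longrightarrow> norm (x - z) \<le> r + \<delta> \<Longrightarrow> b + M - \<Lambda> * (norm (x - z) - r) \<le> u x"
proof -
  define k where "k = max 1 (K + 1)"
  have k: "1 \<le> k" "K + 1 \<le> k" by (auto simp: k_def)
  define \<delta> where "\<delta> = 1 / (4 * k)"
  have \<delta>: "0 < \<delta>" "\<delta> \<le> 1 / (4 * k)" using k by (auto simp: \<delta>_def)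
  obtain \<sigma> where \<sigma>: "0 < \<sigma>" "\<sigma> \<le> 1 / (4 * k)" "M \<le> log_profile k \<sigma> 0 - log_profile k \<sigma> \<delta>"
    using log_profile_gap[of k \<delta> M] k \<delta> by auto
  have h\<sigma>: "0 < hump k \<sigma>" using k \<sigma> by (intro hump_pos) (auto simp: field_simps)
  have sum: "\<delta> + \<sigma> \<le> 1 / (2 * k)" using \<delta> \<sigma> k by (simp add: field_simps)
  show ?thesis
  proof (rule that[OF \<delta>(1), of "1 / hump k \<sigma>"])
    fix u x b assume u: "super_jets \<Omega> p K u" "continuous_on (closure \<Omega>) u"
      and b: "\<And>x. x \<in> closure \<Omega> \<Longrightarrow> b \<le> u x" "\<And>x. x \<in> frontier \<Omega> \<Longrightarrow> b + M \<le> u x"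
      and x: "x \<in> \<Omega>" "norm (x - z) \<le> r + \<delta>"
    have xc: "x \<in> closure \<Omega>" using x closure_subset by blast
    have "(b + M - log_profile k \<sigma> 0) + log_profile k \<sigma> (norm (x - z) - r) \<le> u x"
    proof (rule super_jets_boundary_barrier[OF p k r \<delta> \<sigma>(1,2) \<Omega> ext u _ _ xc x(2)])
      fix y assume "y \<in> closure \<Omega>"
      then show "(b + M - log_profile k \<sigma> 0) + log_profile k \<sigma> \<delta> \<le> u y"
        using b(1)[of y] \<sigma>(3) by linarith
    next
      fix y assume "y \<in> frontier \<Omega>"
      then show "(b + M - log_profile k \<sigma> 0) + log_profile k \<sigma> 0 \<le> u y"
        using b(2)[of y] by linarith
    qed
    moreover have "log_profile k \<sigma> 0 - log_profile k \<sigma> (norm (x - z) - r) \<le> (norm (x - z) - r) / hump k \<sigma>"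
      using k \<sigma> x sum ext[OF x(1)] by (intro log_profile_drop_le) auto
    ultimately show "b + M - 1 / hump k \<sigma> * (norm (x - z) - r) \<le> u x" by simp
  qed (use h\<sigma> in simp)
qed

text \<open>The boundary values eventually exceed \<open>T + 1\<close>, and the excess over \<open>T\<close> pays for the linear error near \<open>x1\<close>.\<close>

lemma boundary_blowup:
  fixes \<Omega> :: "(real^'n) set"
  assumes p: "0 \<le> p" "p \<le> 2" and \<Omega>: "open \<Omega>" "bounded \<Omega>" "C2_boundary \<Omega>"
    and V: "\<And>n. super_jets \<Omega> p K (V n)" "\<And>n. continuous_on (closure \<Omega>) (V n)"
    and nonneg: "\<And>n x. x \<in> closure \<Omega> \<Longrightarrow> 0 \<le> V n x"
    and bdry: "\<And>n x. x \<in> frontier \<Omega> \<Longrightarrow> V n x = m n" and m: "filterlim m at_top sequentially"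
    and x1: "x1 \<in> frontier \<Omega>"
  shows "\<exists>e>0. \<forall>\<^sub>F n in sequentially. \<forall>x\<in>\<Omega>. dist x x1 < e \<longrightarrow> T \<le> V n x"
proof -
  obtain z r where r: "0 < r" "norm (x1 - z) = r" and ext: "\<And>x. x \<in> \<Omega> \<Longrightarrow> r \<le> norm (x - z)"
    using exterior_ball[OF \<Omega>(3,1) x1] by blast
  obtain \<delta> \<Lambda> where \<delta>: "0 < \<delta>" "0 < \<Lambda>" and low: "\<And>u x b. super_jets \<Omega> p K u \<Longrightarrow> continuous_on (closure \<Omega>) u \<Longrightarrow>
      (\<And>x. x \<in> closure \<Omega> \<Longrightarrow> b \<le> u x) \<Longrightarrow> (\<And>x. x \<in> frontier \<Omega> \<Longrightarrow> b + (T + 1) \<le> u x) \<Longrightarrow>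
      x \<in> \<Omega> \<Longrightarrow> norm (x - z) \<le> r + \<delta> \<Longrightarrow> b + (T + 1) - \<Lambda> * (norm (x - z) - r) \<le> u x"
    using boundary_lower_bound[OF p r(1) \<Omega>(1,2) ext, where M = "T + 1" and K = K] by blast
  \<comment> \<open>With this choice the linear error is at most \<open>1\<close>.\<close>
  define e where "e = min \<delta> (1 / \<Lambda>)"
  have e: "0 < e" using \<delta> by (simp add: e_def)
  have "\<forall>\<^sub>F n in sequentially. T + 1 \<le> m n" using m by (simp add: filterlim_at_top)
  then have "\<forall>\<^sub>F n in sequentially. \<forall>x\<in>\<Omega>. dist x x1 < e \<longrightarrow> T \<le> V n x"
  proof eventually_elim
    case (elim n)
    show ?case
    proof (intro ballI impI)
      fix x assume x: "x \<in> \<Omega>" "dist x x1 < e"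
      have t: "norm (x - z) - r < e" 
        using norm_triangle_ineq[of "x - x1" "x1 - z"] r x by (simp add: dist_norm)
      have "0 + (T + 1) - \<Lambda> * (norm (x - z) - r) \<le> V n x"
        by (rule low[OF V]) (use nonneg bdry elim x t in \<open>auto simp: e_def\<close>)
      moreover have "\<Lambda> * (norm (x - z) - r) \<le> \<Lambda> * (1 / \<Lambda>)"
        using t \<delta> by (intro mult_left_mono) (auto simp: e_def)
      ultimately show "T \<le> V n x" using \<delta> by simp
    qed
  qed
  then show ?thesis using e by blast
qed

section \<open>The limit as the zero-order term vanishes\<close>

lemma locally_uniform_limit_pointwise:
  assumes "locally_uniform_limit \<Omega> F v" "x \<in> \<Omega>"
  shows "(\<lambda>n. F n x) \<longlonglongrightarrow> v x"
  using assms(1)[unfolded locally_uniform_limit_def, rule_format, of "{x}"] assms(2) by simp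

text \<open>A lower bound for \<open>U n\<close>, uniform in \<open>n\<close>, is all that is missing for compactness, since upper bounds hold anyway. Near a
boundary point the barriers on both sides are linear in the distance to an exterior ball, and they pass
to the limit.\<close>

lemma dirichlet_problem_limit:
  fixes \<Omega> :: "(real^'n) set" and U :: "nat \<Rightarrow> real^'n \<Rightarrow> real"
  assumes \<Omega>: "open \<Omega>" "bounded \<Omega>" "\<Omega> \<noteq> {}" "C2_boundary \<Omega>" and p: "1 < p" "p \<le> 2"
    and f: "continuous_on \<Omega> f" and F: "\<And>x. x \<in> \<Omega> \<Longrightarrow> \<bar>f x\<bar> \<le> F" "0 \<le> F"
    and \<gamma>: "\<And>n. 0 < \<gamma> n" "\<gamma> \<longlonglongrightarrow> 0"
    and U: "\<And>n. dirichlet_solution \<Omega> p (\<gamma> n) f (U n)"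
    and low: "\<And>n x. x \<in> closure \<Omega> \<Longrightarrow> - M \<le> U n x"
  shows "\<exists>w. dirichlet_solution \<Omega> p 0 f w"
proof -
  define K where "K = 2 * F"
  have cont: "continuous_on (closure \<Omega>) (U n)" and bd: "\<And>x. x \<in> frontier \<Omega> \<Longrightarrow> U n x = 0"
    and sub: "viscosity_subsolution \<Omega> p (\<gamma> n) f (U n)" 
    and super: "viscosity_supersolution \<Omega> p (\<gamma> n) f (U n)" 
    and cont\<Omega>: "continuous_on \<Omega> (U n)" for n
    using U[of n] unfolding dirichlet_solution_def viscosity_solution_def by auto
  have jets: "sub_jets \<Omega> p K (U n)" "super_jets \<Omega> p K (U n)" for n
    using dirichlet_solution_jets[OF \<Omega>(1,2) \<gamma>(1) U F] unfolding K_def by auto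
  have upper: "\<exists>z r L. 0 < r \<and> 0 < L \<and> norm (x1 - z) = r \<and> (\<forall>x\<in>\<Omega>. r \<le> norm (x - z)) \<and>
      (\<forall>n. \<forall>x\<in>closure \<Omega>. U n x \<le> L * (norm (x - z) - r))" if x1: "x1 \<in> frontier \<Omega>" for x1
  proof -
    obtain z r where r: "0 < r" "norm (x1 - z) = r" and ext: "\<And>x. x \<in> \<Omega> \<Longrightarrow> r \<le> norm (x - z)"
      using exterior_ball[OF \<Omega>(4,1) x1] by blast
    obtain L where L: "1 \<le> L" "L * (1 / r) + K < L powr p"
      using superlinear_slope_exists[OF p(1)] by blast
    have "U n x \<le> L * (norm (x - z) - r)" if "x \<in> closure \<Omega>" for n x
      by (rule sub_jets_boundary_barrier[OF _ _ r(1) \<Omega>(1,2) ext jets(1) cont _ that])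
        (use L bd in auto)
    then show ?thesis using r L ext by (intro exI[of _ z] exI[of _ r] exI[of _ L]) auto
  qed
  have "\<Omega> \<noteq> UNIV" using \<Omega>(2) not_bounded_UNIV by auto
  then obtain x1 where "x1 \<in> frontier \<Omega>" using \<Omega>(3) frontier_eq_empty by blast
  from upper[OF this] obtain z0 r0 L0 where L0: "0 < L0" "0 < r0"
      "\<And>n x. x \<in> closure \<Omega> \<Longrightarrow> U n x \<le> L0 * (norm (x - z0) - r0)" by blast
  obtain b where b: "\<And>x. x \<in> closure \<Omega> \<Longrightarrow> norm x \<le> b"
    using bounded_closure[OF \<Omega>(2)] unfolding bounded_iff by blast
  define W where "W = max \<bar>M\<bar> (L0 * (b + norm z0))"
  have W: "\<bar>U n x\<bar> \<le> W" if "x \<in> closure \<Omega>" for n x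
  proof -
    have "norm (x - z0) - r0 \<le> b + norm z0"
      using norm_triangle_ineq4[of x z0] b[OF that] L0(2) by linarith
    then have "L0 * (norm (x - z0) - r0) \<le> L0 * (b + norm z0)" using L0 by (intro mult_left_mono) auto
    then show ?thesis using L0(3)[OF that, of n] low[OF that, of n] by (auto simp: W_def abs_le_iff)
  qed
  have p0: "0 \<le> p" "0 < p" using p by auto
  have \<Omega>c: "x \<in> closure \<Omega>" if "x \<in> \<Omega>" for x using that closure_subset by blast
  obtain k v where k: "strict_mono (k :: nat \<Rightarrow> nat)" and v: "continuous_on \<Omega> v"
    "locally_uniform_limit \<Omega> (\<lambda>n. U (k n)) v"
  proof (rule locally_lipschitz_subsequence[OF \<Omega>(1)])
    fix y assume "y \<in> \<Omega>"
    then obtain R where R: "0 < R" "ball y R \<subseteq> \<Omega>" using \<Omega>(1) open_contains_ball by blast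
    have "\<forall>\<^sub>F n in sequentially. \<forall>x\<in>ball y R. \<bar>U n x\<bar> \<le> W"
      using W \<Omega>c R(2) by (intro always_eventually) blast
    from local_lipschitz_of_bounded[OF p0(1) p(2) jets(2) cont\<Omega> R this]
    show "\<exists>\<rho>>0. \<exists>M L. ball y \<rho> \<subseteq> \<Omega> \<and> (\<forall>\<^sub>F n in sequentially. (\<forall>x\<in>ball y \<rho>. \<bar>U n x\<bar> \<le> M) \<and>
        (\<forall>x\<in>ball y \<rho>. \<forall>x'\<in>ball y \<rho>. \<bar>U n x - U n x'\<bar> \<le> L * norm (x - x')))" .
  qed blast
  define w where "w x = (if x \<in> \<Omega> then v x else 0)" for x
  have lim: "locally_uniform_limit \<Omega> (\<lambda>n x. U (k n) x + 0) w"
    unfolding locally_uniform_limit_def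
  proof (intro allI impI)
    fix C assume C: "compact C \<and> C \<subseteq> \<Omega>"
    have "uniform_limit C (\<lambda>n. U (k n)) v sequentially" using v(2) C unfolding locally_uniform_limit_def by blast
    then show "uniform_limit C (\<lambda>n x. U (k n) x + 0) w sequentially"
      by (rule uniform_limit_cong'[THEN iffD1, rotated 2]) (use C in \<open>auto simp: w_def\<close>)
  qed
  have \<gamma>k: "(\<lambda>n. \<gamma> (k n)) \<longlonglongrightarrow> 0"
    using LIMSEQ_subseq_LIMSEQ[OF \<gamma>(2) k] by (simp add: o_def)
  have zero: "locally_uniform_limit \<Omega> (\<lambda>n x. \<gamma> (k n) * U (k n) x) (\<lambda>_. - 0)"
    unfolding locally_uniform_limit_def
  proof (intro allI impI uniform_limitI)
    fix C and e :: real assume C: "compact C \<and> C \<subseteq> \<Omega>" and e: "0 < e"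
    have "(\<lambda>n. \<gamma> (k n) * (W + 1)) \<longlonglongrightarrow> 0" using tendsto_mult_right[OF \<gamma>k] by simp
    from tendstoD[OF this e] have "\<forall>\<^sub>F n in sequentially. \<bar>\<gamma> (k n) * (W + 1)\<bar> < e" by simp
    then show "\<forall>\<^sub>F n in sequentially. \<forall>x\<in>C. dist (\<gamma> (k n) * U (k n) x) (- 0) < e"
    proof eventually_elim
      case (elim n)
      show ?case
      proof
        fix x assume "x \<in> C"
        then have "\<bar>U (k n) x\<bar> \<le> W + 1" using W[of x "k n"] \<Omega>c C by fastforce
        then have "\<gamma> (k n) * \<bar>U (k n) x\<bar> \<le> \<gamma> (k n) * (W + 1)"
          using \<gamma>(1)[of "k n"] by (intro mult_left_mono) auto
        moreover have "dist (\<gamma> (k n) * U (k n) x) (- 0) = \<gamma> (k n) * \<bar>U (k n) x\<bar>"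
          using \<gamma>(1)[of "k n"] by (simp add: abs_mult)
        ultimately show "dist (\<gamma> (k n) * U (k n) x) (- 0) < e" using elim by linarith
      qed
    qed
  qed
  have "viscosity_subsolution \<Omega> p 0 (\<lambda>x. f x + 0) w"
    by (rule viscosity_subsolution_limit[OF \<Omega>(1) p0(2) f sub cont\<Omega> lim zero])
  moreover have "viscosity_supersolution \<Omega> p 0 (\<lambda>x. f x + 0) w"
    by (rule viscosity_supersolution_limit[OF \<Omega>(1) p0(2) f super cont\<Omega> lim zero])
  moreover have w\<Omega>: "continuous_on \<Omega> w"
    using v(1) by (rule continuous_on_eq) (simp add: w_def)
  moreover have "continuous_on (closure \<Omega>) w"
  proof (unfold continuous_on_eq_continuous_within, intro ballI)
    fix y assume y: "y \<in> closure \<Omega>"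
    show "continuous (at y within closure \<Omega>) w"
    proof (cases "y \<in> \<Omega>")
      case True
      then have "isCont w y" using w\<Omega> \<Omega>(1) continuous_on_eq_continuous_at by blast
      then show ?thesis by (rule continuous_at_imp_continuous_at_within)
    next
      case False
      then have yf: "y \<in> frontier \<Omega>" using y \<Omega>(1) by (simp add: frontier_def interior_open)
      obtain z r L where r: "0 < r" "norm (y - z) = r" and ext: "\<And>x. x \<in> \<Omega> \<Longrightarrow> r \<le> norm (x - z)"
        and L: "0 < L" "\<And>n x. x \<in> closure \<Omega> \<Longrightarrow> U n x \<le> L * (norm (x - z) - r)"
        using upper[OF yf] by blast
      obtain \<delta> \<Lambda> where \<delta>: "0 < \<delta>" "0 < \<Lambda>" and low': "\<And>u x b. super_jets \<Omega> p K u \<Longrightarrow> continuous_on (closure \<Omega>) u \<Longrightarrow>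
        (\<And>x. x \<in> closure \<Omega> \<Longrightarrow> b \<le> u x) \<Longrightarrow> (\<And>x. x \<in> frontier \<Omega> \<Longrightarrow> b + M \<le> u x) \<Longrightarrow>
        x \<in> \<Omega> \<Longrightarrow> norm (x - z) \<le> r + \<delta> \<Longrightarrow> b + M - \<Lambda> * (norm (x - z) - r) \<le> u x"
        using boundary_lower_bound[OF p0(1) p(2) r(1) \<Omega>(1,2) ext, where M = M and K = K] by blast
      define B where "B = max L \<Lambda>"
      have B: "0 < B" "L \<le> B" "\<Lambda> \<le> B" using L by (auto simp: B_def)
      have bound: "\<bar>w x\<bar> \<le> B * dist x y" if x: "dist x y < \<delta>" for x
      proof (cases "x \<in> \<Omega>")
        case xin: True
        define t where "t = norm (x - z) - r"
        have t: "0 \<le> t" "t \<le> dist x y"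
          using ext[OF xin] norm_triangle_ineq[of "x - y" "y - z"] r by (auto simp: t_def dist_norm)
        have U1: "U n x \<le> L * t" for n using L(2)[OF \<Omega>c[OF xin]] by (simp add: t_def)
        have U2: "- (\<Lambda> * t) \<le> U n x" for n
        proof -
          have "- M + M - \<Lambda> * (norm (x - z) - r) \<le> U n x"
            by (rule low'[OF jets(2) cont]) (use low bd xin x t in \<open>auto simp: t_def\<close>)
          then show ?thesis by (simp add: t_def)
        qed
        have lw: "(\<lambda>n. U (k n) x) \<longlonglongrightarrow> w x"
          using locally_uniform_limit_pointwise[OF lim xin] by simp
        have "w x \<le> L * t" by (rule LIMSEQ_le_const2[OF lw]) (use U1 in auto)
        also have "\<dots> \<le> B * dist x y" using t B by (intro mult_mono) auto
        finally have 1: "w x \<le> B * dist x y" .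
        have "\<Lambda> * t \<le> B * dist x y" using t B \<delta> by (intro mult_mono) auto
        moreover have "- (\<Lambda> * t) \<le> w x" by (rule LIMSEQ_le_const[OF lw]) (use U2 in auto)
        ultimately show ?thesis using 1 by (simp add: abs_le_iff)
      qed (use B in \<open>simp add: w_def\<close>)
      show ?thesis
        unfolding continuous_within_eps_delta
      proof (intro allI impI)
        fix e :: real assume e: "0 < e"
        have "dist (w x) (w y) < e" if "dist x y < min \<delta> (e / B)" for x
        proof -
          have "\<bar>w x\<bar> \<le> B * dist x y" using bound that by simp
          also have "\<dots> < e" using that B by (simp add: field_simps)
          finally show ?thesis using False by (simp add: w_def[of y])
        qed
        then show "\<exists>d>0. \<forall>x'\<in>closure \<Omega>. dist x' y < d \<longrightarrow> dist (w x') (w y) < e"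
          using \<delta> B e by (intro exI[of _ "min \<delta> (e / B)"]) auto
      qed
    qed
  qed
  moreover have "w x = 0" if "x \<in> frontier \<Omega>" for x
    using that \<Omega>(1) by (simp add: w_def frontier_def interior_open)
  ultimately have "dirichlet_solution \<Omega> p 0 f w"
    unfolding dirichlet_solution_def viscosity_solution_def by simp
  then show ?thesis by blast
qed

lemma neg_part_norm_tendsto_infinity:
  fixes \<Omega> :: "(real^'n) set" and u :: "real \<Rightarrow> real^'n \<Rightarrow> real"
  assumes \<Omega>: "open \<Omega>" "bounded \<Omega>" "\<Omega> \<noteq> {}" "C2_boundary \<Omega>" and p: "1 < p" "p \<le> 2"
    and f: "continuous_on \<Omega> f" and F: "\<And>x. x \<in> \<Omega> \<Longrightarrow> \<bar>f x\<bar> \<le> F" "0 \<le> F"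
    and none: "\<not> (\<exists>w. dirichlet_solution \<Omega> p 0 f w)"
    and u: "\<And>\<gamma>. \<gamma> > 0 \<Longrightarrow> dirichlet_solution \<Omega> p \<gamma> f (u \<gamma>)"
  shows "filterlim (\<lambda>\<gamma>. sup_norm_on \<Omega> (neg_part (u \<gamma>))) at_top (at_right 0)"
  unfolding filterlim_at_top
proof (intro allI, rule ccontr)
  fix Z assume neg: "\<not> (\<forall>\<^sub>F \<gamma> in at_right 0. Z \<le> sup_norm_on \<Omega> (neg_part (u \<gamma>)))"
  have "\<exists>\<gamma>. 0 < \<gamma> \<and> \<gamma> < inverse (real (Suc n)) \<and> sup_norm_on \<Omega> (neg_part (u \<gamma>)) < Z" for n
  proof (rule ccontr)
    assume "\<not> (\<exists>\<gamma>. 0 < \<gamma> \<and> \<gamma> < inverse (real (Suc n)) \<and> sup_norm_on \<Omega> (neg_part (u \<gamma>)) < Z)"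
    then have "\<forall>\<^sub>F \<gamma> in at_right 0. Z \<le> sup_norm_on \<Omega> (neg_part (u \<gamma>))"
      unfolding eventually_at_right_field
      by (intro exI[of _ "inverse (real (Suc n))"] conjI allI impI) (simp, meson not_le)
    with neg show False ..
  qed
  then obtain \<gamma> where \<gamma>: "\<And>n. 0 < \<gamma> n" "\<And>n. \<gamma> n < inverse (real (Suc n))"
    "\<And>n. sup_norm_on \<Omega> (neg_part (u (\<gamma> n))) < Z" by metis
  have lim: "\<gamma> \<longlonglongrightarrow> 0"
    by (rule tendsto_sandwich[OF _ _ tendsto_const LIMSEQ_inverse_real_of_nat])
      (intro always_eventually allI less_imp_le \<gamma>)+
  have low: "- Z \<le> u (\<gamma> n) x" if "x \<in> closure \<Omega>" for n x
  proof -
    have "continuous_on (closure \<Omega>) (u (\<gamma> n))" "\<And>x. x \<in> frontier \<Omega> \<Longrightarrow> u (\<gamma> n) x = 0"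
      using u[OF \<gamma>(1)[of n]] unfolding dirichlet_solution_def by auto
    from sup_norm_neg_part(2)[OF \<Omega>(1-3) this refl that] \<gamma>(3)[of n] show ?thesis by linarith
  qed
  from dirichlet_problem_limit[OF \<Omega> p f F \<gamma>(1) lim u[OF \<gamma>(1)] low] none
  show False by blast
qed

lemma uniform_limit_of_constants:
  assumes "(\<lambda>n. c n) \<longlonglongrightarrow> l"
  shows "uniform_limit X (\<lambda>n _. c n) (\<lambda>_. l) sequentially"
  by (rule uniform_limitI) (use tendstoD[OF assms] in \<open>auto elim: eventually_mono\<close>)

text \<open>The construction of \<open>C\<close> and \<open>v\<close>. A first subsequence fixes the accumulation point \<open>x0\<close> of the zeros of \<open>V n = U n + m n\<close> and
the limit \<open>C\<close> of \<open>\<gamma> n * m n\<close>; a second one makes \<open>V n\<close> converge. As \<open>V n\<close> is locally bounded, \<open>\<gamma> n * V n\<close> tends to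
\<open>0\<close>, and \<open>\<gamma> n * U n\<close> has the constant limit \<open>- C\<close>.\<close>

lemma ergodic_limit:
  fixes \<Omega> :: "(real^'n) set" and U :: "nat \<Rightarrow> real^'n \<Rightarrow> real"
  assumes \<Omega>: "open \<Omega>" "bounded \<Omega>" "\<Omega> \<noteq> {}" "C2_boundary \<Omega>" "connected \<Omega>" and p: "1 < p" "p \<le> 2"
    and f: "continuous_on \<Omega> f" and F: "\<And>x. x \<in> \<Omega> \<Longrightarrow> \<bar>f x\<bar> \<le> F" "0 \<le> F"
    and \<gamma>: "\<And>n. 0 < \<gamma> n" "\<gamma> \<longlonglongrightarrow> 0"
    and U: "\<And>n. dirichlet_solution \<Omega> p (\<gamma> n) f (U n)"
    and mdef: "m = (\<lambda>n. sup_norm_on \<Omega> (neg_part (U n)))" and m: "filterlim m at_top sequentially"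
  shows "\<exists>k C v. strict_mono (k :: nat \<Rightarrow> nat) \<and> 0 \<le> C
    \<and> locally_uniform_limit \<Omega> (\<lambda>n x. \<gamma> (k n) * U (k n) x) (\<lambda>_. - C)
    \<and> locally_uniform_limit \<Omega> (\<lambda>n x. U (k n) x + m (k n)) v
    \<and> viscosity_solution \<Omega> p 0 (\<lambda>x. f x + C) v \<and> infinite_on_boundary \<Omega> v \<and> has_min_on \<Omega> v 0"
proof -
  define K where "K = 2 * F"
  have p0: "0 \<le> p" "0 < p" and K0: "0 \<le> K" using p F(2) by (auto simp: K_def)
  have \<Omega>c: "x \<in> closure \<Omega>" if "x \<in> \<Omega>" for x using that closure_subset by blast
  have cont: "continuous_on (closure \<Omega>) (U n)" and bd: "\<And>x. x \<in> frontier \<Omega> \<Longrightarrow> U n x = 0"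
    and sub: "viscosity_subsolution \<Omega> p (\<gamma> n) f (U n)"
    and super: "viscosity_supersolution \<Omega> p (\<gamma> n) f (U n)"
    and cont\<Omega>: "continuous_on \<Omega> (U n)" for n
    using U[of n] unfolding dirichlet_solution_def viscosity_solution_def by auto
  have m0: "0 \<le> m n" and mlow: "\<And>x. x \<in> closure \<Omega> \<Longrightarrow> - m n \<le> U n x"
    and matt: "0 < m n \<Longrightarrow> \<exists>x\<in>\<Omega>. U n x = - m n" for n
    using sup_norm_neg_part[OF \<Omega>(1-3) cont bd, of "m n" n] by (auto simp: mdef)
  define V where "V n x = U n x + m n" for n x
  have V: "sub_jets \<Omega> p K (V n)" "super_jets \<Omega> p K (V n)" "continuous_on (closure \<Omega>) (V n)"
      "continuous_on \<Omega> (V n)" "\<And>x. x \<in> closure \<Omega> \<Longrightarrow> 0 \<le> V n x"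
      "\<And>x. x \<in> frontier \<Omega> \<Longrightarrow> V n x = m n" for n
  proof -
    show "sub_jets \<Omega> p K (V n)" "super_jets \<Omega> p K (V n)"
      unfolding V_def K_def
      using dirichlet_solution_jets[OF \<Omega>(1,2) \<gamma>(1) U F]
      by (auto intro: sub_jets_add_const super_jets_add_const)
    show "continuous_on (closure \<Omega>) (V n)" "continuous_on \<Omega> (V n)"
      unfolding V_def by (intro continuous_intros cont cont\<Omega>)+
    show "0 \<le> V n x" if "x \<in> closure \<Omega>" for x using mlow[OF that, of n] by (simp add: V_def)
    show "V n x = m n" if "x \<in> frontier \<Omega>" for x using bd[OF that] by (simp add: V_def)
  qed
  have "\<exists>x. x \<in> closure \<Omega> \<and> (0 < m n \<longrightarrow> x \<in> \<Omega> \<and> V n x = 0)" for n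
  proof (cases "0 < m n")
    case True
    obtain x where "x \<in> \<Omega>" "U n x = - m n" using matt[OF True] by blast
    then show ?thesis using \<Omega>c by (intro exI[of _ x]) (simp add: V_def)
  next
    case False
    then show ?thesis using \<Omega>(3) \<Omega>c by blast
  qed
  then obtain xs where xs: "\<And>n. xs n \<in> closure \<Omega>" "\<And>n. 0 < m n \<Longrightarrow> xs n \<in> \<Omega> \<and> V n (xs n) = 0"
    by metis
  have \<gamma>m: "\<gamma> n * m n \<in> {0..F}" for n
  proof (cases "0 < m n")
    case True
    then obtain x where x: "x \<in> \<Omega>" "U n x = - m n" using matt by blast
    have "\<bar>\<gamma> n * U n x\<bar> \<le> F" by (rule dirichlet_solution_bound[OF \<Omega>(1,2) \<gamma>(1) U F \<Omega>c[OF x(1)]])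
    then show ?thesis using x True \<gamma>(1)[of n] by (simp add: abs_mult)
  next
    case False
    then have "m n = 0" using m0[of n] by simp
    then show ?thesis using F(2) by simp
  qed
  have "compact (closure \<Omega> \<times> {0..F})" using \<Omega>(2) by (intro compact_Times) auto
  then obtain l k1 where l: "l \<in> closure \<Omega> \<times> {0..F}" and k1: "strict_mono (k1 :: nat \<Rightarrow> nat)"
    and lim: "((\<lambda>n. (xs n, \<gamma> n * m n)) \<circ> k1) \<longlonglongrightarrow> l"
    using xs(1) \<gamma>m unfolding compact_def by (metis (no_types, lifting) mem_Sigma_iff)
  define x0 where "x0 = fst l"
  define C where "C = snd l"
  have C0: "0 \<le> C" using l by (auto simp: C_def)
  have limx: "(\<lambda>n. xs (k1 n)) \<longlonglongrightarrow> x0" and limC: "(\<lambda>n. \<gamma> (k1 n) * m (k1 n)) \<longlonglongrightarrow> C"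
    using tendsto_fst[OF lim] tendsto_snd[OF lim] by (auto simp: x0_def C_def o_def)
  have mk1: "filterlim (\<lambda>n. m (k1 n)) at_top sequentially"
    using filterlim_compose[OF m filterlim_subseq[OF k1]] .
  have ev: "\<forall>\<^sub>F n in sequentially. xs (k1 n) \<in> \<Omega> \<and> V (k1 n) (xs (k1 n)) = 0"
  proof -
    have "\<forall>\<^sub>F n in sequentially. 0 < m (k1 n)" using mk1 by (simp add: filterlim_at_top_dense)
    then show ?thesis by eventually_elim (use xs(2) in blast)
  qed
  have blowup: "\<exists>e>0. \<forall>\<^sub>F n in sequentially. \<forall>x\<in>\<Omega>. dist x x1 < e \<longrightarrow> T \<le> V (k1 n) x"
    if "x1 \<in> frontier \<Omega>" for x1 T
    by (rule boundary_blowup[OF p0(1) p(2) \<Omega>(1,2,4) V(2,3) _ _ mk1 that]) (simp_all add: V(5,6))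
  have x0: "x0 \<in> \<Omega>"
  proof (rule ccontr)
    assume "x0 \<notin> \<Omega>"
    then have "x0 \<in> frontier \<Omega>" using l \<Omega>(1) by (auto simp: frontier_def interior_open x0_def)
    from blowup[OF this, of 1] obtain e where e: "0 < e"
      "\<forall>\<^sub>F n in sequentially. \<forall>x\<in>\<Omega>. dist x x0 < e \<longrightarrow> 1 \<le> V (k1 n) x" by blast
    from e(2) ev tendstoD[OF limx e(1)] have "\<forall>\<^sub>F n in sequentially. False"
      by eventually_elim force
    then show False by simp
  qed
  have evV: "\<forall>\<^sub>F n in sequentially. V (k1 n) (xs (k1 n)) = 0"
    using ev by eventually_elim blast
  obtain k2 v where k2: "strict_mono (k2 :: nat \<Rightarrow> nat)" and v: "continuous_on \<Omega> v"
    "locally_uniform_limit \<Omega> (\<lambda>n. V (k1 (k2 n))) v"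
  proof (rule locally_lipschitz_subsequence[OF \<Omega>(1), of "\<lambda>n. V (k1 n)"])
    fix y assume y: "y \<in> \<Omega>"
    obtain R M where R: "0 < R" "ball y R \<subseteq> \<Omega>"
      and M: "\<forall>\<^sub>F n in sequentially. \<forall>x\<in>ball y R. V (k1 n) x \<le> M"
      using bounded_near_all_points[OF \<Omega>(1,5) p K0 V(1,2,4) V(5)[OF \<Omega>c] limx x0 evV y] by blast
    have "\<forall>\<^sub>F n in sequentially. \<forall>x\<in>ball y R. \<bar>V (k1 n) x\<bar> \<le> M"
      using M
    proof eventually_elim
      case (elim n)
      show ?case
      proof
        fix x assume x: "x \<in> ball y R"
        then have "0 \<le> V (k1 n) x" using V(5)[OF \<Omega>c] R(2) by blast
        then show "\<bar>V (k1 n) x\<bar> \<le> M" using elim x by simp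
      qed
    qed
    from local_lipschitz_of_bounded[OF p0(1) p(2) V(2,4) R this]
    show "\<exists>\<rho>>0. \<exists>M L. ball y \<rho> \<subseteq> \<Omega> \<and> (\<forall>\<^sub>F n in sequentially. (\<forall>x\<in>ball y \<rho>. \<bar>V (k1 n) x\<bar> \<le> M) \<and>
        (\<forall>x\<in>ball y \<rho>. \<forall>x'\<in>ball y \<rho>. \<bar>V (k1 n) x - V (k1 n) x'\<bar> \<le> L * norm (x - x')))" .
  qed blast
  define k where "k n = k1 (k2 n)" for n
  have k: "strict_mono k" using k1 k2 by (simp add: k_def strict_mono_def)
  have limV: "locally_uniform_limit \<Omega> (\<lambda>n x. U (k n) x + m (k n)) v"
    using v(2) unfolding V_def k_def .
  have \<gamma>k: "(\<lambda>n. \<gamma> (k n)) \<longlonglongrightarrow> 0" using LIMSEQ_subseq_LIMSEQ[OF \<gamma>(2) k] by (simp add: o_def)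
  have Ck: "(\<lambda>n. \<gamma> (k n) * m (k n)) \<longlonglongrightarrow> C"
    using LIMSEQ_subseq_LIMSEQ[OF limC k2] by (simp add: o_def k_def)
  have limC: "locally_uniform_limit \<Omega> (\<lambda>n x. \<gamma> (k n) * U (k n) x) (\<lambda>_. - C)"
    unfolding locally_uniform_limit_def
  proof (intro allI impI)
    fix S assume S: "compact S \<and> S \<subseteq> \<Omega>"
    have "bounded (v ` S)"
      using S v(1) by (intro compact_imp_bounded compact_continuous_image) (auto intro: continuous_on_subset)
    moreover have "uniform_limit S (\<lambda>n x. U (k n) x + m (k n)) v sequentially"
      using limV S unfolding locally_uniform_limit_def by blast
    moreover have "bounded ((\<lambda>_. 0::real) ` S)" by (rule bounded_subset[of "{0}"]) auto
    ultimately have "uniform_limit S (\<lambda>n x. \<gamma> (k n) * (U (k n) x + m (k n))) (\<lambda>x. 0 * v x) sequentially"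
      by (intro uniform_lim_mult uniform_limit_of_constants[OF \<gamma>k])
    from uniform_limit_minus[OF this uniform_limit_of_constants[OF Ck, of S]]
    show "uniform_limit S (\<lambda>n x. \<gamma> (k n) * U (k n) x) (\<lambda>_. - C) sequentially"
      by (simp add: algebra_simps)
  qed
  have visc: "viscosity_solution \<Omega> p 0 (\<lambda>x. f x + C) v"
    unfolding viscosity_solution_def
    using v(1) viscosity_subsolution_limit[OF \<Omega>(1) p0(2) f sub cont\<Omega> limV limC]
      viscosity_supersolution_limit[OF \<Omega>(1) p0(2) f super cont\<Omega> limV limC] by blast
  have vlim: "(\<lambda>n. V (k1 (k2 n)) x) \<longlonglongrightarrow> v x" if "x \<in> \<Omega>" for x
    by (rule locally_uniform_limit_pointwise[OF v(2) that])
  have vmin: "has_min_on \<Omega> v 0"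
    unfolding has_min_on_def
  proof (intro conjI bexI[OF _ x0] ballI)
    show "0 \<le> v x" if "x \<in> \<Omega>" for x
      by (rule LIMSEQ_le_const[OF vlim[OF that]]) (use V(5)[OF \<Omega>c[OF that]] in auto)
    define ys where "ys n = xs (k1 (k2 n))" for n
    have ys: "ys \<longlonglongrightarrow> x0"
      using LIMSEQ_subseq_LIMSEQ[OF limx k2] by (simp add: o_def ys_def[abs_def])
    obtain e where e: "e > 0" "cball x0 e \<subseteq> \<Omega>" using \<Omega>(1) x0 open_contains_cball by blast
    have evys: "\<forall>\<^sub>F n in sequentially. ys n \<in> cball x0 e"
      using tendstoD[OF ys e(1)] by eventually_elim (simp add: dist_commute less_imp_le)
    have "(\<lambda>n. v (ys n)) \<longlonglongrightarrow> v x0"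
      by (rule continuous_on_tendsto_compose[OF v(1) ys x0 eventually_mono[OF evys]]) (use e in blast)
    moreover have "(\<lambda>n. v (ys n)) \<longlonglongrightarrow> 0"
    proof (rule tendstoI)
      fix \<epsilon> :: real assume \<epsilon>: "0 < \<epsilon>"
      have "uniform_limit (cball x0 e) (\<lambda>n. V (k1 (k2 n))) v sequentially"
        using v(2) e unfolding locally_uniform_limit_def by auto
      from uniform_limitD[OF this \<epsilon>] evys
        eventually_compose_filterlim[OF evV filterlim_subseq[OF k2]]
      show "\<forall>\<^sub>F n in sequentially. dist (v (ys n)) 0 < \<epsilon>"
      proof eventually_elim
        case (elim n)
        then show ?case unfolding ys_def by (metis dist_commute)
      qed
    qed
    ultimately show "v x0 = 0" by (rule LIMSEQ_unique)
  qed
  have "infinite_on_boundary \<Omega> v"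
    unfolding infinite_on_boundary_def
  proof (intro allI, rule ccontr)
    fix M assume neg: "\<not> (\<exists>\<delta>>0. \<forall>x\<in>\<Omega>. infdist x (frontier \<Omega>) < \<delta> \<longrightarrow> M < v x)"
    have "\<exists>x\<in>\<Omega>. infdist x (frontier \<Omega>) < inverse (real (Suc j)) \<and> v x \<le> M" for j
    proof -
      have "0 < inverse (real (Suc j))" by simp
      with neg show ?thesis by (meson not_le)
    qed
    then obtain ys where ys: "\<And>j. ys j \<in> \<Omega>" "\<And>j. infdist (ys j) (frontier \<Omega>) < inverse (real (Suc j))"
      "\<And>j. v (ys j) \<le> M" by metis
    have "compact (closure \<Omega>)" using \<Omega>(2) by simp
    then obtain x1 r where x1: "x1 \<in> closure \<Omega>" and r: "strict_mono (r :: nat \<Rightarrow> nat)"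
      and lx: "(ys \<circ> r) \<longlonglongrightarrow> x1"
      using \<Omega>c[OF ys(1)] unfolding compact_def by metis
    have "(\<lambda>j. infdist (ys j) (frontier \<Omega>)) \<longlonglongrightarrow> 0"
      by (rule tendsto_sandwich[OF _ _ tendsto_const LIMSEQ_inverse_real_of_nat])
        (intro always_eventually allI less_imp_le ys(2) infdist_nonneg)+
    from LIMSEQ_subseq_LIMSEQ[OF this r] have "(\<lambda>j. infdist ((ys \<circ> r) j) (frontier \<Omega>)) \<longlonglongrightarrow> 0"
      by (simp add: o_def)
    moreover have "(\<lambda>j. infdist ((ys \<circ> r) j) (frontier \<Omega>)) \<longlonglongrightarrow> infdist x1 (frontier \<Omega>)"
      by (rule tendsto_infdist[OF lx])
    ultimately have "infdist x1 (frontier \<Omega>) = 0" using LIMSEQ_unique by blast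
    moreover have "frontier \<Omega> \<noteq> {}"
      using \<Omega>(2,3) frontier_eq_empty not_bounded_UNIV by blast
    ultimately have "x1 \<in> frontier \<Omega>" using in_closed_iff_infdist_zero[OF frontier_closed] by blast
    from blowup[OF this, of "M + 1"] obtain e where e: "0 < e"
      "\<forall>\<^sub>F n in sequentially. \<forall>x\<in>\<Omega>. dist x x1 < e \<longrightarrow> M + 1 \<le> V (k1 n) x" by blast
    have big: "M + 1 \<le> v x" if x: "x \<in> \<Omega>" "dist x x1 < e" for x
    proof (rule tendsto_lowerbound[OF vlim[OF x(1)]])
      from eventually_compose_filterlim[OF e(2) filterlim_subseq[OF k2]]
      show "\<forall>\<^sub>F n in sequentially. M + 1 \<le> V (k1 (k2 n)) x"
        by eventually_elim (use x in blast)
    qed simp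
    have "\<forall>\<^sub>F j in sequentially. dist ((ys \<circ> r) j) x1 < e" by (rule tendstoD[OF lx e(1)])
    then obtain j where "dist (ys (r j)) x1 < e" by (auto dest: eventually_happens)
    from big[OF ys(1) this] ys(3)[of "r j"] show False by simp
  qed
  then show ?thesis using k C0 limC limV visc vmin by blast
qed

theorem theorem5p4:
  fixes \<Omega> :: "(real^'n) set" and p :: real and f :: "real^'n \<Rightarrow> real"
    and u :: "real \<Rightarrow> real^'n \<Rightarrow> real"
  assumes "bounded_C2_domain \<Omega>"
    and "1 < p" and "p \<le> 2"
    and "locally_lipschitz_on \<Omega> f" and "bounded (f ` \<Omega>)"
    and "\<not> (\<exists>w. dirichlet_solution \<Omega> p 0 f w)"
    and "\<And>\<gamma>. \<gamma> > 0 \<Longrightarrow> dirichlet_solution \<Omega> p \<gamma> f (u \<gamma>)"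
  shows "filterlim (\<lambda>\<gamma>. sup_norm_on \<Omega> (neg_part (u \<gamma>))) at_top (at_right 0)
    \<and> (\<exists>\<gamma>s :: nat \<Rightarrow> real. \<exists>C :: real.
         (\<forall>n. 0 < \<gamma>s n) \<and> \<gamma>s \<longlonglongrightarrow> 0 \<and> 0 \<le> C
         \<and> locally_uniform_limit \<Omega> (\<lambda>n x. \<gamma>s n * u (\<gamma>s n) x) (\<lambda>_. - C)
         \<and> (\<exists>v. locally_uniform_limit \<Omega>
                   (\<lambda>n x. u (\<gamma>s n) x + sup_norm_on \<Omega> (neg_part (u (\<gamma>s n)))) v
              \<and> viscosity_solution \<Omega> p 0 (\<lambda>x. f x + C) v
              \<and> infinite_on_boundary \<Omega> v
              \<and> has_min_on \<Omega> v 0))"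
proof -
  have \<Omega>: "open \<Omega>" "bounded \<Omega>" "\<Omega> \<noteq> {}" "C2_boundary \<Omega>" "connected \<Omega>"
    using assms(1) by (auto simp: bounded_C2_domain_def)
  have f: "continuous_on \<Omega> f"
    using local_lipschitz_continuous_on[OF assms(4)[unfolded locally_lipschitz_on_def], of 0] by simp
  obtain F where F: "\<And>x. x \<in> \<Omega> \<Longrightarrow> \<bar>f x\<bar> \<le> F" using assms(5) by (auto simp: bounded_iff)
  have F0: "0 \<le> F" using \<Omega>(3) F abs_ge_zero order_trans by blast
  have top: "filterlim (\<lambda>\<gamma>. sup_norm_on \<Omega> (neg_part (u \<gamma>))) at_top (at_right 0)"
    by (rule neg_part_norm_tendsto_infinity[OF \<Omega>(1-4) assms(2,3) f F F0 assms(6,7)])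
  define \<gamma> where "\<gamma> n = inverse (real (Suc n))" for n
  have \<gamma>: "\<And>n. 0 < \<gamma> n" "\<gamma> \<longlonglongrightarrow> 0"
    using LIMSEQ_inverse_real_of_nat by (auto simp: \<gamma>_def[abs_def])
  have "filterlim \<gamma> (at_right 0) sequentially"
    unfolding filterlim_at using \<gamma>(1)[THEN less_imp_neq] \<gamma>
    by (auto intro!: always_eventually)
  from filterlim_compose[OF top this]
  have m: "filterlim (\<lambda>n. sup_norm_on \<Omega> (neg_part (u (\<gamma> n)))) at_top sequentially" .
  obtain k C v where k: "strict_mono (k :: nat \<Rightarrow> nat)" and rest: "0 \<le> C"
    "locally_uniform_limit \<Omega> (\<lambda>n x. \<gamma> (k n) * u (\<gamma> (k n)) x) (\<lambda>_. - C)"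
    "locally_uniform_limit \<Omega> (\<lambda>n x. u (\<gamma> (k n)) x + sup_norm_on \<Omega> (neg_part (u (\<gamma> (k n))))) v"
    "viscosity_solution \<Omega> p 0 (\<lambda>x. f x + C) v" "infinite_on_boundary \<Omega> v" "has_min_on \<Omega> v 0"
    using ergodic_limit[OF \<Omega> assms(2,3) f F F0 \<gamma> assms(7)[OF \<gamma>(1)] refl m] by blast
  have "(\<lambda>n. \<gamma> (k n)) \<longlonglongrightarrow> 0" using LIMSEQ_subseq_LIMSEQ[OF \<gamma>(2) k] by (simp add: o_def)
  then show ?thesis using top \<gamma>(1) rest
    by (intro conjI exI[of _ "\<lambda>n. \<gamma> (k n)"] exI[of _ C] exI[of _ v] allI) auto
qed

end
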